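(* Let $u \in L^{\infty}(\mathbb{B}_n)$ and $p \in (1,\infty)$. If $u(z)\rightarrow 0$ as $|z|\rightarrow 1^-$, then $T_u$ acts compactly on $L^p_{\sigma}$ for all $\sigma \in B_p$, and $T_u$ acts compactly from $L^1_{\sigma}$ to $L^{1,\infty}_{\sigma}$ for all $\sigma \in B_1$.
   Context: $\mathbb{B}_n$ is the open unit ball of $\mathbb{C}^n$, $V$ is normalized Lebesgue measure on $\mathbb{B}_n$, $|A|=V(A)$ and $z\overline{w}=\sum_{j=1}^n z_j\overline{w}_j$. For $u\in L^\infty=L^\infty(\mathbb{B}_n)$ the Toeplitz operator is $T_uf(z)=\int_{\mathbb{B}_n}\frac{u(w)f(w)}{(1-z\overline{w})^{n+1}}\,dV(w)$. A weight is a locally integrable function on $\mathbb{B}_n$ that is positive almost everywhere; $\sigma(A)=\int_A\sigma\,dV$; $\langle f\rangle_A=\frac{1}{|A|}\int_A f\,dV$. $L^p_\sigma$ is the space of $f$ with $\|f\|_{L^p_\sigma}^p=\int_{\mathbb{B}_n}|f|^p\sigma\,dV<\infty$, and $L^{1,\infty}_\sigma$ is the space of $f$ with $\|f\|_{L^{1,\infty}_\sigma}=\sup_{\lambda>0}\lambda\,\sigma(\{z:|f(z)|>\lambda\})<\infty$. The Carleson tent over $z\in\mathbb{B}_n\setminus\{0\}$ is $\mathcal{T}_z=\{w\in\mathbb{B}_n: |1-\overline{w}\frac{z}{|z|}|<1-|z|\}$, and $\mathcal{T}_0=\mathbb{B}_n$. With $p'=p/(p-1)$, a weight $\sigma$ is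 in $B_p$, $p\in(1,\infty)$, if $[\sigma]_{B_p}=\sup_{z}\langle\sigma\rangle_{\mathcal{T}_z}\langle\sigma^{1-p'}\rangle_{\mathcal{T}_z}^{p-1}<\infty$, and in $B_1$ if $[\sigma]_{B_1}=\sup_z\langle\sigma\rangle_{\mathcal{T}_z}\|\sigma^{-1}\|_{L^\infty(\mathcal{T}_z)}<\infty$. An operator is compact if it maps bounded sets to precompact sets. *)

theory Defs
  imports "HOL-Analysis.Analysis" "HOL-Probability.Essential_Supremum"
begin

abbreviation unit_ball :: "(complex ^ 'n) set" (\<open>\<bbbB>\<close>)
  where "\<bbbB> \<equiv> ball 0 1"

definition V :: "(complex ^ 'n) measure"
  where "V = uniform_measure (lebesgue_on \<bbbB>) \<bbbB>"

definition herm :: "complex ^ 'n \<Rightarrow> complex ^ 'n \<Rightarrow> complex"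
  where "herm z w = (\<Sum>j\<in>UNIV. z $ j * cnj (w $ j))"

(* Bochner integrals default to 0, so integrability is asserted separately where T_u is
   said to act on a space. *)
definition toeplitz_integrand ::
    "(complex ^ 'n \<Rightarrow> complex) \<Rightarrow> (complex ^ 'n \<Rightarrow> complex) \<Rightarrow> complex ^ 'n \<Rightarrow> complex ^ 'n \<Rightarrow> complex"
  where "toeplitz_integrand u f z w = u w * f w / (1 - herm z w) ^ (CARD('n) + 1)"

definition toeplitz ::
    "(complex ^ 'n \<Rightarrow> complex) \<Rightarrow> (complex ^ 'n \<Rightarrow> complex) \<Rightarrow> complex ^ 'n \<Rightarrow> complex"
  where "toeplitz u f z = (LINT w|V. toeplitz_integrand u f z w)"

definition L_infinity :: "(complex ^ 'n \<Rightarrow> complex) set"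
  where "L_infinity =
    {u. u \<in> borel_measurable V \<and> esssup V (\<lambda>z. ennreal (norm (u z))) < \<infinity>}"

(* Elements of L_infinity are only determined almost everywhere, so the limit is required of
   some representative. The filter filtercomap norm (at_left 1) expresses that norm z tends
   to 1 from below. *)
definition vanishes_at_boundary :: "(complex ^ 'n \<Rightarrow> complex) \<Rightarrow> bool"
  where "vanishes_at_boundary u \<longleftrightarrow>
    (\<exists>v. (AE z in V. u z = v z) \<and> (v \<longlongrightarrow> 0) (filtercomap norm (at_left 1)))"

definition weight :: "(complex ^ 'n \<Rightarrow> real) \<Rightarrow> bool"
  where "weight \<sigma> \<longleftrightarrow> \<sigma> \<in> borel_measurable V \<and>
    (\<forall>K. compact K \<and> K \<subseteq> \<bbbB> \<longrightarrow> set_integrable V K \<sigma>) \<and> (AE z in V. 0 < \<sigma> z)"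

definition weight_measure :: "(complex ^ 'n \<Rightarrow> real) \<Rightarrow> (complex ^ 'n) set \<Rightarrow> ennreal"
  where "weight_measure \<sigma> A = (\<integral>\<^sup>+z\<in>A. ennreal (\<sigma> z) \<partial>V)"

definition average :: "(complex ^ 'n \<Rightarrow> real) \<Rightarrow> (complex ^ 'n) set \<Rightarrow> ennreal"
  where "average f A = (\<integral>\<^sup>+z\<in>A. ennreal (f z) \<partial>V) / emeasure V A"

definition tent :: "complex ^ 'n \<Rightarrow> (complex ^ 'n) set"
  where "tent z = (if z = 0 then \<bbbB>
    else {w \<in> \<bbbB>. norm (1 - herm (z /\<^sub>R norm z) w) < 1 - norm z})"

(* Only used for a > 0, where infinity to the power a is infinity. *)
definition ennreal_powr :: "ennreal \<Rightarrow> real \<Rightarrow> ennreal"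
  where "ennreal_powr x a = (if x = \<infinity> then \<infinity> else ennreal (enn2real x powr a))"

(* For a weight both averages are nonzero, so the product 0 * infinity does not occur. *)
definition Bp_const :: "real \<Rightarrow> (complex ^ 'n \<Rightarrow> real) \<Rightarrow> ennreal"
  where "Bp_const p \<sigma> = (SUP z\<in>\<bbbB>.
    average \<sigma> (tent z) * ennreal_powr (average (\<lambda>w. \<sigma> w powr (1 - p / (p - 1))) (tent z)) (p - 1))"

definition B1_const :: "(complex ^ 'n \<Rightarrow> real) \<Rightarrow> ennreal"
  where "B1_const \<sigma> = (SUP z\<in>\<bbbB>.
    average \<sigma> (tent z) * esssup (restrict_space V (tent z)) (\<lambda>w. ennreal (inverse (\<sigma> w))))"

definition Bp_class :: "real \<Rightarrow> (complex ^ 'n \<Rightarrow> real) set"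
  where "Bp_class p = {\<sigma>. weight \<sigma> \<and> Bp_const p \<sigma> < \<infinity>}"

definition B1_class :: "(complex ^ 'n \<Rightarrow> real) set"
  where "B1_class = {\<sigma>. weight \<sigma> \<and> B1_const \<sigma> < \<infinity>}"

definition Lp_norm :: "real \<Rightarrow> (complex ^ 'n \<Rightarrow> real) \<Rightarrow> (complex ^ 'n \<Rightarrow> complex) \<Rightarrow> ennreal"
  where "Lp_norm p \<sigma> f = ennreal_powr (\<integral>\<^sup>+z. ennreal (norm (f z) powr p * \<sigma> z) \<partial>V) (1 / p)"

definition Lp_space :: "real \<Rightarrow> (complex ^ 'n \<Rightarrow> real) \<Rightarrow> (complex ^ 'n \<Rightarrow> complex) set"
  where "Lp_space p \<sigma> = {f. f \<in> borel_measurable V \<and> Lp_norm p \<sigma> f < \<infinity>}"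

definition weak_L1_norm :: "(complex ^ 'n \<Rightarrow> real) \<Rightarrow> (complex ^ 'n \<Rightarrow> complex) \<Rightarrow> ennreal"
  where "weak_L1_norm \<sigma> f =
    (SUP t\<in>{0<..}. ennreal t * weight_measure \<sigma> {z \<in> \<bbbB>. norm (f z) > t})"

definition weak_L1_space :: "(complex ^ 'n \<Rightarrow> real) \<Rightarrow> (complex ^ 'n \<Rightarrow> complex) set"
  where "weak_L1_space \<sigma> = {f. f \<in> borel_measurable V \<and> weak_L1_norm \<sigma> f < \<infinity>}"

(* The topology of a space X of functions under a (quasi-)seminorm N. Functions that agree
   almost everywhere are not identified but are topologically indistinguishable, so compactness
   agrees with compactness in the space of equivalence classes. Balls of N need not be
   open when N is only a quasinorm, hence the definition through neighbourhoods. *)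
definition qnorm_topology ::
    "('a \<Rightarrow> complex) set \<Rightarrow> (('a \<Rightarrow> complex) \<Rightarrow> ennreal) \<Rightarrow> ('a \<Rightarrow> complex) topology"
  where "qnorm_topology X N = topology (\<lambda>U. U \<subseteq> X \<and>
    (\<forall>f\<in>U. \<exists>e>0. \<forall>g\<in>X. N (\<lambda>z. g z - f z) < ennreal e \<longrightarrow> g \<in> U))"

lemma openin_qnorm_topology:
  "openin (qnorm_topology X N) U \<longleftrightarrow> U \<subseteq> X \<and>
    (\<forall>f\<in>U. \<exists>e>0. \<forall>g\<in>X. N (\<lambda>z. g z - f z) < ennreal e \<longrightarrow> g \<in> U)"
proof -
  have "istopology (\<lambda>U. U \<subseteq> X \<and>
    (\<forall>f\<in>U. \<exists>e>0. \<forall>g\<in>X. N (\<lambda>z. g z - f z) < ennreal e \<longrightarrow> g \<in> U))" (is "istopology ?P")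
    unfolding istopology_def
  proof (intro conjI allI impI)
    fix S T assume S: "?P S" and T: "?P T"
    show "S \<inter> T \<subseteq> X" using S by blast
    show "\<forall>f\<in>S \<inter> T. \<exists>e>0. \<forall>g\<in>X. N (\<lambda>z. g z - f z) < ennreal e \<longrightarrow> g \<in> S \<inter> T"
    proof
      fix f assume f: "f \<in> S \<inter> T"
      from f S obtain d where d: "d > 0" "\<And>g. g \<in> X \<Longrightarrow> N (\<lambda>z. g z - f z) < ennreal d \<Longrightarrow> g \<in> S"
        by blast
      from f T obtain e where e: "e > 0" "\<And>g. g \<in> X \<Longrightarrow> N (\<lambda>z. g z - f z) < ennreal e \<Longrightarrow> g \<in> T"
        by blast
      show "\<exists>e>0. \<forall>g\<in>X. N (\<lambda>z. g z - f z) < ennreal e \<longrightarrow> g \<in> S \<inter> T"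
      proof (intro exI[of _ "min d e"] conjI ballI impI)
        show "min d e > 0" using d(1) e(1) by simp
        fix g assume g: "g \<in> X" and N: "N (\<lambda>z. g z - f z) < ennreal (min d e)"
        have "N (\<lambda>z. g z - f z) < ennreal d" "N (\<lambda>z. g z - f z) < ennreal e"
          by (rule less_le_trans[OF N], simp add: ennreal_leI)+
        then show "g \<in> S \<inter> T" using g d(2) e(2) by blast
      qed
    qed
  next
    fix \<K> assume K: "\<forall>U\<in>\<K>. ?P U"
    show "\<Union>\<K> \<subseteq> X" using K by blast
    show "\<forall>f\<in>\<Union>\<K>. \<exists>e>0. \<forall>g\<in>X. N (\<lambda>z. g z - f z) < ennreal e \<longrightarrow> g \<in> \<Union>\<K>"
    proof
      fix f assume "f \<in> \<Union>\<K>"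
      then obtain U where U: "U \<in> \<K>" "f \<in> U" by blast
      then obtain e where "e > 0" "\<forall>g\<in>X. N (\<lambda>z. g z - f z) < ennreal e \<longrightarrow> g \<in> U"
        using K by blast
      then show "\<exists>e>0. \<forall>g\<in>X. N (\<lambda>z. g z - f z) < ennreal e \<longrightarrow> g \<in> \<Union>\<K>"
        using U(1) by blast
    qed
  qed
  then show ?thesis
    by (simp add: qnorm_topology_def)
qed

lemma topspace_qnorm_topology [simp]: "topspace (qnorm_topology X N) = X"
proof
  show "topspace (qnorm_topology X N) \<subseteq> X"
    using openin_topspace openin_qnorm_topology by blast
  have "openin (qnorm_topology X N) X"
    by (auto simp: openin_qnorm_topology intro: exI[of _ 1])
  then show "X \<subseteq> topspace (qnorm_topology X N)"
    by (rule openin_subset)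
qed

definition precompact_in :: "'a topology \<Rightarrow> 'a set \<Rightarrow> bool"
  where "precompact_in \<tau> S \<longleftrightarrow> S \<subseteq> topspace \<tau> \<and> compactin \<tau> (\<tau> closure_of S)"

definition compact_operator ::
    "('a \<Rightarrow> complex) set \<Rightarrow> (('a \<Rightarrow> complex) \<Rightarrow> ennreal) \<Rightarrow>
     ('b \<Rightarrow> complex) set \<Rightarrow> (('b \<Rightarrow> complex) \<Rightarrow> ennreal) \<Rightarrow>
     (('a \<Rightarrow> complex) \<Rightarrow> ('b \<Rightarrow> complex)) \<Rightarrow> bool"
  where "compact_operator X NX Y NY T \<longleftrightarrow> T ` X \<subseteq> Y \<and>
    (\<forall>S\<subseteq>X. (\<exists>M::real. \<forall>f\<in>S. NX f \<le> ennreal M) \<longrightarrow> precompact_in (qnorm_topology Y NY) (T ` S))"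

definition toeplitz_acts_compactly ::
    "(complex ^ 'n \<Rightarrow> complex) \<Rightarrow>
     (complex ^ 'n \<Rightarrow> complex) set \<Rightarrow> ((complex ^ 'n \<Rightarrow> complex) \<Rightarrow> ennreal) \<Rightarrow>
     (complex ^ 'n \<Rightarrow> complex) set \<Rightarrow> ((complex ^ 'n \<Rightarrow> complex) \<Rightarrow> ennreal) \<Rightarrow> bool"
  where "toeplitz_acts_compactly u X NX Y NY \<longleftrightarrow>
    (\<forall>f\<in>X. \<forall>z\<in>\<bbbB>. integrable V (toeplitz_integrand u f z)) \<and>
    compact_operator X NX Y NY (toeplitz u)"

end

theory Submission
  imports Defs "HOL-Library.Diagonal_Subsequence" "HOL-Complex_Analysis.Great_Picard"
begin

text \<open>
  Write \<open>r z = 1 - norm z\<close>, \<open>\<rho> z w = norm (1 - herm z w)\<close> and \<open>N = n + 1\<close>. The Toeplitz operator with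
  symbol \<open>u\<close> is the sum of the one with symbol \<open>u\<close> cut off to a ball of radius \<open>t < 1\<close> and the one
  with the rest of \<open>u\<close> as symbol. The first has a kernel that is Lipschitz up to the boundary, so by
  Arzela-Ascoli it maps bounded sets to sets that are totally bounded in the supremum norm. The
  symbol of the second is small when \<open>t\<close> is close to 1, since \<open>u\<close> vanishes at the boundary. What
  remains is a bound for the second operator by the supremum of its symbol, and this is the theorem
  of Bekolle and Bonami: the positive operator with kernel \<open>\<rho> z w ^ -N\<close> (\<open>bergman\<close> below) is bounded
  on weighted \<open>L^p\<close> for \<open>B_p\<close> weights and of weak type (1,1) for \<open>B_1\<close> weights
  (\<open>bergman_strong_bound\<close>, \<open>bergman_weak_bound\<close>).

  These two bounds use very little about the ball, namely that \<open>\<rho>\<close> is a quasi-metric with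
  \<open>r z \<le> \<rho> z w\<close>, that a quasiball of radius \<open>s\<close> has measure of order \<open>s ^ N\<close>, and that a fixed
  proportion of it lies at height \<open>r\<close> comparable to \<open>s\<close>. The locale \<open>tent_geometry\<close> records this.

  The strong bound avoids dyadic systems and maximal functions. The kernel is dominated by an
  average over all tents: \<open>\<rho> z w ^ -N\<close> is at most a constant times the integral of \<open>r \<zeta> ^ (-2N)\<close> over
  all \<open>\<zeta>\<close> whose tent \<open>D \<zeta>\<close> contains both \<open>z\<close> and \<open>w\<close>. This factors the operator into averaging over
  tents and its adjoint, and to each factor Hoelder's inequality is applied with a power of \<open>r\<close> as
  test function, in the manner of Schur. The test functions are admissible because a \<open>B_p\<close> weight
  cannot concentrate at the boundary of a tent: for some \<open>\<delta> > 0\<close> the mean of \<open>r ^ -\<delta>\<close> over a tent, with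
  respect to the weight, is at most a constant times the \<open>-\<delta>\<close>-th power of the height of the tent
  (\<open>exists_decay\<close>). The \<open>B_p\<close> condition itself enters once more, to cancel the product of the masses of
  a weight and its dual on one tent.

  For the weak bound at level \<open>\<lambda>\<close>, the set \<open>\<Omega>\<close> where averages of \<open>f\<close> exceed \<open>\<lambda>\<close> is small by Vitali's
  covering argument. Let \<open>d v\<close> be the \<open>\<rho>\<close>-distance from \<open>v\<close> to the complement of \<open>\<Omega>\<close>. Spreading the
  mass of \<open>f\<close> at every point \<open>v\<close> evenly over the part at height \<open>d v\<close> of a quasiball of radius \<open>d v\<close>
  gives a function \<open>F \<le> C\<lambda>\<close> whose weighted mass is at most a constant times that of \<open>f\<close>. Since the kernel is positive and
  varies slowly at scale \<open>d v\<close> when seen from outside \<open>\<Omega>\<close>, the operator applied to \<open>f\<close> is there at most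
  a constant times the operator applied to \<open>F\<close>, and Chebyshev's inequality with the strong bound for
  \<open>p = 2\<close> finishes the proof.

  The volume of a quasiball of the unit ball is computed by a unitary map that moves its centre to a
  coordinate axis, where boxes can be compared with it.
\<close>

section \<open>Real powers of extended nonnegative reals and Hoelder's inequality\<close>

lemma ennreal_powr_ennreal: "0 \<le> x \<Longrightarrow> ennreal_powr (ennreal x) a = ennreal (x powr a)"
  by (simp add: ennreal_powr_def)

lemma ennreal_powr_top [simp]: "ennreal_powr top a = top"
  by (simp add: ennreal_powr_def)

lemma ennreal_powr_zero [simp]: "ennreal_powr 0 a = 0"
  by (simp add: ennreal_powr_def)

lemma ennreal_powr_one [simp]: "ennreal_powr x 1 = x"
  by (cases x) (simp_all add: ennreal_powr_ennreal)

lemma ennreal_powr_one_left [simp]: "ennreal_powr 1 a = 1"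
  using ennreal_powr_ennreal[of 1 a] by simp

lemma ennreal_powr_less_top_iff [simp]: "ennreal_powr x a < top \<longleftrightarrow> x < top"
  by (simp add: ennreal_powr_def less_top)

lemma ennreal_powr_mono:
  assumes "0 \<le> a" "x \<le> y"
  shows "ennreal_powr x a \<le> ennreal_powr y a"
proof (cases y)
  case (real s)
  with assms(2) obtain r where r: "x = ennreal r" "0 \<le> r" "r \<le> s"
    by (cases x) (auto simp: top_unique)
  then show ?thesis using real assms(1)
    by (simp add: ennreal_powr_ennreal ennreal_leI powr_mono2)
qed simp

lemma ennreal_powr_mult:
  assumes "0 < a"
  shows "ennreal_powr (x * y) a = ennreal_powr x a * ennreal_powr y a"
proof (cases "x = 0 \<or> y = 0")
  case False
  then show ?thesis using assms
    by (cases x; cases y)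
      (auto simp: ennreal_powr_ennreal powr_mult ennreal_mult[symmetric] ennreal_mult_top
          ennreal_top_mult ennreal_eq_0_iff simp del: ennreal_mult'')
qed auto

lemma ennreal_powr_powr: "ennreal_powr (ennreal_powr x a) b = ennreal_powr x (a * b)"
  by (cases x) (auto simp: ennreal_powr_ennreal powr_powr)

lemma ennreal_powr_add:
  assumes "0 < a" "0 < b"
  shows "ennreal_powr x (a + b) = ennreal_powr x a * ennreal_powr x b"
  by (cases x) (auto simp: ennreal_powr_ennreal powr_add ennreal_mult[symmetric])

lemma ennreal_powr_inverse:
  assumes "0 < a"
  shows "ennreal_powr (ennreal_powr x a) (1 / a) = x"
    and "ennreal_powr (ennreal_powr x (1 / a)) a = x"
  using assms by (simp_all add: ennreal_powr_powr)

lemma ennreal_powr_eq_0_iff [simp]: "ennreal_powr x a = 0 \<longleftrightarrow> x = 0"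
  by (cases x) (auto simp: ennreal_powr_ennreal ennreal_eq_0_iff)

lemma ennreal_powr_le_iff:
  assumes "0 < a"
  shows "ennreal_powr x (1 / a) \<le> y \<longleftrightarrow> x \<le> ennreal_powr y a"
proof
  assume "ennreal_powr x (1 / a) \<le> y"
  then have "ennreal_powr (ennreal_powr x (1 / a)) a \<le> ennreal_powr y a"
    using assms by (intro ennreal_powr_mono) auto
  then show "x \<le> ennreal_powr y a" using assms by (simp add: ennreal_powr_inverse)
next
  assume "x \<le> ennreal_powr y a"
  then have "ennreal_powr x (1 / a) \<le> ennreal_powr (ennreal_powr y a) (1 / a)"
    using assms by (intro ennreal_powr_mono) auto
  then show "ennreal_powr x (1 / a) \<le> y" using assms by (simp add: ennreal_powr_inverse)
qed

lemma ennreal_powr_real_power: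
  assumes "0 < (r::real)"
  shows "ennreal_powr (ennreal (r powr a)) b = ennreal (r powr (a * b))"
  using assms by (simp add: ennreal_powr_ennreal powr_powr)

lemma measurable_ennreal_powr [measurable]:
  assumes [measurable]: "f \<in> borel_measurable M"
  shows "(\<lambda>x. ennreal_powr (f x) a) \<in> borel_measurable M"
  unfolding ennreal_powr_def by measurable

lemma ennreal_powr_add_le:
  assumes q: "0 < q"
  shows "ennreal_powr (a + b) q \<le> ennreal (2 powr q) * (ennreal_powr a q + ennreal_powr b q)"
proof -
  have "a + b \<le> 2 * max a b" by (simp add: mult_2 add_mono)
  then have "ennreal_powr (a + b) q \<le> ennreal_powr (ennreal 2 * max a b) q"
    using q by (intro ennreal_powr_mono) auto
  also have "\<dots> = ennreal (2 powr q) * ennreal_powr (max a b) q"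
    using q by (simp only: ennreal_powr_mult) (subst ennreal_powr_ennreal, auto)
  also have "ennreal_powr (max a b) q \<le> ennreal_powr a q + ennreal_powr b q"
    by (simp add: max_def)
  finally show ?thesis by (simp add: mult_left_mono)
qed

lemma ennreal_less_top_obtain:
  assumes "(a::ennreal) < \<infinity>" obtains k where "0 < k" "a \<le> ennreal k"
proof -
  have "a = ennreal (enn2real a)" using assms by (simp add: less_top)
  then have "a \<le> ennreal (enn2real a + 1)" by (metis ennreal_leI le_add_same_cancel1 zero_le_one)
  then show thesis using that[of "enn2real a + 1"] by (simp add: add_nonneg_pos)
qed

text \<open>
  Young's inequality in the scaled form that integrates to Hoelder's: when \<open>a\<close> and \<open>b\<close> are the
  integrals of the two powers, the bracket on the right integrates to \<open>1/p + 1/q = 1\<close>.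
\<close>

lemma Young_ennreal:
  fixes f g :: ennreal and a b p q :: real
  assumes "1 < p" "1 < q" "1 / p + 1 / q = 1" "0 < a" "0 < b"
  shows "f * g \<le> ennreal (a powr (1/p) * b powr (1/q)) *
    (ennreal (1 / (a * p)) * ennreal_powr f p + ennreal (1 / (b * q)) * ennreal_powr g q)"
proof (cases "f = top \<or> g = top")
  case True
  have "ennreal (1 / (a * p)) \<noteq> 0" "ennreal (1 / (b * q)) \<noteq> 0"
    "ennreal (a powr (1/p) * b powr (1/q)) \<noteq> 0"
    using assms by (auto simp: ennreal_eq_0_iff not_le)
  then show ?thesis using True by (auto simp: ennreal_mult_top)
next
  case False
  then obtain x y where xy: "f = ennreal x" "g = ennreal y" "0 \<le> x" "0 \<le> y"
    by (metis ennreal_cases)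
  let ?A = "a powr (1/p)" and ?B = "b powr (1/q)"
  have "(x / ?A) * (y / ?B) \<le> (x / ?A) powr p / p + (y / ?B) powr q / q"
    using assms xy by (intro Youngs_inequality) auto
  also have "\<dots> = 1 / (a * p) * x powr p + 1 / (b * q) * y powr q"
    using assms xy by (simp add: powr_divide powr_powr)
  finally have "?A * ?B * ((x / ?A) * (y / ?B)) \<le>
      ?A * ?B * (1 / (a * p) * x powr p + 1 / (b * q) * y powr q)"
    by (intro mult_left_mono) auto
  then have "x * y \<le> ?A * ?B * (1 / (a * p) * x powr p + 1 / (b * q) * y powr q)"
    using assms by simp
  then show ?thesis using xy assms
    by (simp add: ennreal_powr_ennreal ennreal_mult[symmetric] ennreal_plus[symmetric] ennreal_leI
        del: ennreal_plus)
qed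

text \<open>
  Hoelder's inequality is stated for the \<open>p\<close>-th power of the integral because it is applied twice in
  succession below, and this form needs no roots in between.
\<close>

lemma Holder_ennreal_powr:
  fixes f g :: "'a \<Rightarrow> ennreal" and p :: real
  assumes p: "1 < p" and [measurable]: "f \<in> borel_measurable M" "g \<in> borel_measurable M"
  shows "ennreal_powr (\<integral>\<^sup>+x. f x * g x \<partial>M) p \<le>
    (\<integral>\<^sup>+x. ennreal_powr (f x) p \<partial>M) * ennreal_powr (\<integral>\<^sup>+x. ennreal_powr (g x) (p / (p - 1)) \<partial>M) (p - 1)"
proof -
  define q where "q = p / (p - 1)"
  define A where "A = (\<integral>\<^sup>+x. ennreal_powr (f x) p \<partial>M)"
  define B where "B = (\<integral>\<^sup>+x. ennreal_powr (g x) q \<partial>M)"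
  have q: "1 < q" "1 / p + 1 / q = 1" using p by (auto simp: q_def field_simps)
  consider "A = 0 \<or> B = 0" | "A \<noteq> 0" "B \<noteq> 0" "A = top \<or> B = top"
    | "A \<noteq> 0" "B \<noteq> 0" "A \<noteq> top" "B \<noteq> top" by auto
  then have "ennreal_powr (\<integral>\<^sup>+x. f x * g x \<partial>M) p \<le> A * ennreal_powr B (p - 1)"
  proof cases
    case 1
    then have "AE x in M. f x * g x = 0"
      unfolding A_def B_def by (auto simp: nn_integral_0_iff_AE)
    then have "(\<integral>\<^sup>+x. f x * g x \<partial>M) = 0"
      by (subst nn_integral_0_iff_AE) auto
    then show ?thesis by simp
  next
    case 2
    then show ?thesis by (auto simp: ennreal_mult_top ennreal_top_mult)
  next
    case 3
    then obtain a b where ab: "A = ennreal a" "B = ennreal b" "0 < a" "0 < b"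
      by (metis ennreal_cases ennreal_eq_0_iff not_le)
    let ?c = "ennreal (a powr (1/p) * b powr (1/q))"
    have "(\<integral>\<^sup>+x. f x * g x \<partial>M) \<le> (\<integral>\<^sup>+x. ?c * (ennreal (1 / (a * p)) * ennreal_powr (f x) p
        + ennreal (1 / (b * q)) * ennreal_powr (g x) q) \<partial>M)"
      using p q ab by (intro nn_integral_mono Young_ennreal)
    also have "\<dots> = ?c * (ennreal (1 / (a * p)) * A + ennreal (1 / (b * q)) * B)"
      by (simp add: nn_integral_cmult nn_integral_add A_def B_def)
    also have "ennreal (1 / (a * p)) * A + ennreal (1 / (b * q)) * B = 1"
      using ab p q by (simp add: ennreal_mult[symmetric] ennreal_plus[symmetric] del: ennreal_plus)
    finally have "ennreal_powr (\<integral>\<^sup>+x. f x * g x \<partial>M) p \<le> ennreal_powr ?c p"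
      using p by (intro ennreal_powr_mono) auto
    also have "ennreal_powr ?c p = ennreal (a * b powr (p - 1))"
      using ab p by (simp add: ennreal_powr_ennreal powr_mult powr_powr q_def)
    also have "\<dots> = A * ennreal_powr B (p - 1)"
      using ab by (simp add: ennreal_powr_ennreal ennreal_mult)
    finally show ?thesis .
  qed
  then show ?thesis by (simp add: A_def B_def q_def)
qed

text \<open>
  Hoelder's inequality for the factors \<open>f \<sigma>^(1/p)\<close> and \<open>\<sigma>^(-1/p)\<close>. The exponent \<open>1 - p / (p - 1)\<close> is
  \<open>1 - p'\<close>, so the last factor is the mass of the dual weight in the \<open>B_p\<close> condition.
\<close>

lemma weighted_Holder:
  fixes f :: "'a \<Rightarrow> ennreal" and \<sigma> :: "'a \<Rightarrow> real"
  assumes p: "1 < p" and [measurable]: "f \<in> borel_measurable M" "\<sigma> \<in> borel_measurable M"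
    and pos: "AE x in M. 0 < \<sigma> x" and A [measurable]: "A \<in> sets M"
  shows "ennreal_powr (\<integral>\<^sup>+x. f x * indicator A x \<partial>M) p \<le>
    (\<integral>\<^sup>+x. ennreal_powr (f x) p * ennreal (\<sigma> x) * indicator A x \<partial>M) *
    ennreal_powr (\<integral>\<^sup>+x. ennreal (\<sigma> x powr (1 - p / (p - 1))) * indicator A x \<partial>M) (p - 1)"
proof -
  have e: "1 - p / (p - 1) = - 1 / p * (p / (p - 1))" using p by (simp add: field_simps)
  let ?F = "\<lambda>x. f x * ennreal (\<sigma> x powr (1 / p)) * indicator A x"
  let ?G = "\<lambda>x. ennreal (\<sigma> x powr (- 1 / p)) * indicator A x"
  have "(\<integral>\<^sup>+x. f x * indicator A x \<partial>M) = (\<integral>\<^sup>+x. ?F x * ?G x \<partial>M)"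
  proof (rule nn_integral_cong_AE, use pos in eventually_elim)
    fix x assume x: "0 < \<sigma> x"
    have "ennreal (\<sigma> x powr (1 / p)) * ennreal (\<sigma> x powr (- 1 / p)) = 1"
      using x by (simp add: ennreal_mult[symmetric] powr_add[symmetric])
    then show "f x * indicator A x = ?F x * ?G x"
      by (auto simp: indicator_def mult.assoc)
  qed
  also have "ennreal_powr \<dots> p \<le> (\<integral>\<^sup>+x. ennreal_powr (?F x) p \<partial>M) *
      ennreal_powr (\<integral>\<^sup>+x. ennreal_powr (?G x) (p / (p - 1)) \<partial>M) (p - 1)"
    by (rule Holder_ennreal_powr[OF p]) measurable
  also have "(\<integral>\<^sup>+x. ennreal_powr (?F x) p \<partial>M)
      = (\<integral>\<^sup>+x. ennreal_powr (f x) p * ennreal (\<sigma> x) * indicator A x \<partial>M)"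
  proof (rule nn_integral_cong_AE, use pos in eventually_elim)
    fix x assume x: "0 < \<sigma> x"
    then have "ennreal_powr (ennreal (\<sigma> x powr (1 / p))) p = ennreal (\<sigma> x)"
      using p by (simp add: ennreal_powr_real_power)
    then show "ennreal_powr (?F x) p = ennreal_powr (f x) p * ennreal (\<sigma> x) * indicator A x"
      using p by (auto simp: ennreal_powr_mult indicator_def)
  qed
  also have "(\<integral>\<^sup>+x. ennreal_powr (?G x) (p / (p - 1)) \<partial>M)
      = (\<integral>\<^sup>+x. ennreal (\<sigma> x powr (1 - p / (p - 1))) * indicator A x \<partial>M)"
  proof (rule nn_integral_cong_AE, use pos in eventually_elim)
    fix x assume x: "0 < \<sigma> x"
    show "ennreal_powr (?G x) (p / (p - 1)) = ennreal (\<sigma> x powr (1 - p / (p - 1))) * indicator A x"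
      using x by (simp only: e) (auto simp: ennreal_powr_real_power indicator_def)
  qed
  finally show ?thesis .
qed

lemma nn_integral_le_of_tendsto:
  fixes f :: "nat \<Rightarrow> 'a \<Rightarrow> ennreal"
  assumes [measurable]: "\<And>n. f n \<in> borel_measurable M"
    and lim: "AE x in M. (\<lambda>n. f n x) \<longlonglongrightarrow> g x" and le: "\<And>n. (\<integral>\<^sup>+x. f n x \<partial>M) \<le> K"
  shows "(\<integral>\<^sup>+x. g x \<partial>M) \<le> K"
proof -
  have "(\<integral>\<^sup>+x. g x \<partial>M) = (\<integral>\<^sup>+x. liminf (\<lambda>n. f n x) \<partial>M)"
    using lim by (intro nn_integral_cong_AE, elim AE_mp, intro AE_I2) (simp add: lim_imp_Liminf)
  also have "\<dots> \<le> liminf (\<lambda>n. \<integral>\<^sup>+x. f n x \<partial>M)"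
    by (intro nn_integral_liminf) auto
  also have "\<dots> \<le> K" using le by (intro Liminf_le) auto
  finally show ?thesis .
qed

lemma nn_integral_le_of_eventually_le:
  fixes f :: "nat \<Rightarrow> 'a \<Rightarrow> ennreal"
  assumes [measurable]: "\<And>n. f n \<in> borel_measurable M"
    and lim: "\<And>x. x \<in> space M \<Longrightarrow> \<forall>\<^sub>F n in sequentially. g x \<le> f n x"
    and le: "\<And>n. (\<integral>\<^sup>+x. f n x \<partial>M) \<le> K"
  shows "(\<integral>\<^sup>+x. g x \<partial>M) \<le> K"
proof -
  have "(\<integral>\<^sup>+x. g x \<partial>M) \<le> (\<integral>\<^sup>+x. liminf (\<lambda>n. f n x) \<partial>M)"
    by (intro nn_integral_mono Liminf_bounded lim)
  also have "\<dots> \<le> liminf (\<lambda>n. \<integral>\<^sup>+x. f n x \<partial>M)"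
    by (intro nn_integral_liminf) auto
  also have "\<dots> \<le> K" using le by (intro Liminf_le) auto
  finally show ?thesis .
qed

section \<open>Tent geometries\<close>

text \<open>
  A quasi-metric \<open>\<rho>\<close> and a height \<open>r\<close> such that \<open>\<rho>\<close> never sees below the height. Thus \<open>\<rho> x x\<close> is of
  the order of \<open>r x\<close> and not 0, and quasiballs of radius below \<open>r x\<close> around \<open>x\<close> are empty. The last
  assumption says that the part of a quasiball at height comparable to its radius carries a fixed
  proportion of the volume \<open>s ^ N\<close>. In the unit ball, quasiballs correspond to Carleson tents and
  \<open>N = n + 1\<close>.
\<close>

locale tent_geometry = sigma_finite_measure M
  for M :: "'a::second_countable_topology measure" +
  fixes \<rho> :: "'a \<Rightarrow> 'a \<Rightarrow> real" and r :: "'a \<Rightarrow> real" and N :: nat and c C :: real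
  assumes rho_measurable: "(\<lambda>x. \<rho> (fst x) (snd x)) \<in> borel_measurable (M \<Otimes>\<^sub>M M)"
    and r_measurable [measurable]: "r \<in> borel_measurable M"
    and open_quasiball: "\<And>x s. x \<in> space M \<Longrightarrow> open {y \<in> space M. \<rho> x y < s}"
    and r_pos: "\<And>x. x \<in> space M \<Longrightarrow> 0 < r x"
    and r_le_1: "\<And>x. x \<in> space M \<Longrightarrow> r x \<le> 1"
    and r_le_rho: "\<And>x y. x \<in> space M \<Longrightarrow> y \<in> space M \<Longrightarrow> r x \<le> \<rho> x y"
    and rho_le_2: "\<And>x y. x \<in> space M \<Longrightarrow> y \<in> space M \<Longrightarrow> \<rho> x y \<le> 2"
    and rho_sym: "\<And>x y. x \<in> space M \<Longrightarrow> y \<in> space M \<Longrightarrow> \<rho> x y = \<rho> y x"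
    and rho_triangle: "\<And>x y z. x \<in> space M \<Longrightarrow> y \<in> space M \<Longrightarrow> z \<in> space M \<Longrightarrow>
      \<rho> x z \<le> 3 * (\<rho> x y + \<rho> y z)"
    and c_pos: "0 < c" and C_pos: "0 < C"
    and measure_upper: "\<And>x s. x \<in> space M \<Longrightarrow> 0 < s \<Longrightarrow>
      emeasure M {y \<in> space M. \<rho> x y < s} \<le> ennreal (C * s ^ N)"
    and measure_lower: "\<And>x s. x \<in> space M \<Longrightarrow> r x \<le> s \<Longrightarrow> s \<le> 1 \<Longrightarrow>
      ennreal (c * s ^ N) \<le> emeasure M {y \<in> space M. \<rho> x y < 6 * s \<and> s / 4 \<le> r y \<and> r y < s}"
begin

definition Q :: "'a \<Rightarrow> real \<Rightarrow> 'a set"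
  where "Q x s = {y \<in> space M. \<rho> x y < s}"

definition E :: "'a \<Rightarrow> real \<Rightarrow> 'a set"
  where "E x s = {y \<in> space M. \<rho> x y < 6 * s \<and> s / 4 \<le> r y \<and> r y < s}"

text \<open>
  The factor 96 makes the tents of all the points of \<open>E z s\<close>, with \<open>s\<close> of order \<open>\<rho> z w\<close>, contain \<open>z\<close>
  and \<open>w\<close>; see \<open>kernel_le_tent_integral\<close>.
\<close>

definition D :: "'a \<Rightarrow> 'a set"
  where "D x = Q x (96 * r x)"

abbreviation mass :: "('a \<Rightarrow> ennreal) \<Rightarrow> 'a set \<Rightarrow> ennreal"
  where "mass s A \<equiv> (\<integral>\<^sup>+y. s y * indicator A y \<partial>M)"

text \<open>
  The measurability rules are stated for composed arguments, so that functions of two points can be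
  shown to be jointly measurable before the order of integration is exchanged.
\<close>

lemma measurable_rho [measurable]:
  assumes [measurable]: "f \<in> L \<rightarrow>\<^sub>M M" "g \<in> L \<rightarrow>\<^sub>M M"
  shows "(\<lambda>x. \<rho> (f x) (g x)) \<in> borel_measurable L"
proof -
  have "(\<lambda>x. (f x, g x)) \<in> L \<rightarrow>\<^sub>M M \<Otimes>\<^sub>M M" by measurable
  from measurable_compose[OF this rho_measurable] show ?thesis by simp
qed

lemma measurable_r_compose [measurable]:
  assumes "f \<in> L \<rightarrow>\<^sub>M M"
  shows "(\<lambda>x. r (f x)) \<in> borel_measurable L"
  using measurable_compose[OF assms r_measurable] .

lemma measurable_indicator_Q [measurable]:
  assumes [measurable]: "f \<in> L \<rightarrow>\<^sub>M M" "g \<in> L \<rightarrow>\<^sub>M M" "s \<in> borel_measurable L"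
  shows "(\<lambda>x. indicator (Q (f x) (s x)) (g x) :: ennreal) \<in> borel_measurable L"
proof -
  have "(\<lambda>x. if \<rho> (f x) (g x) < s x then 1 else 0 :: ennreal) \<in> borel_measurable L"
    by measurable
  then show ?thesis
    by (rule measurable_cong[THEN iffD1, rotated])
      (use measurable_space[OF assms(2)] in \<open>auto simp: Q_def indicator_def\<close>)
qed

lemma measurable_indicator_E [measurable]:
  assumes [measurable]: "f \<in> L \<rightarrow>\<^sub>M M" "g \<in> L \<rightarrow>\<^sub>M M" "s \<in> borel_measurable L"
  shows "(\<lambda>x. indicator (E (f x) (s x)) (g x) :: ennreal) \<in> borel_measurable L"
proof -
  have "(\<lambda>x. if \<rho> (f x) (g x) < 6 * s x \<and> s x / 4 \<le> r (g x) \<and> r (g x) < s x then 1 else 0 :: ennreal)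
      \<in> borel_measurable L"
    by measurable
  then show ?thesis
    by (rule measurable_cong[THEN iffD1, rotated])
      (use measurable_space[OF assms(2)] in \<open>auto simp: E_def indicator_def\<close>)
qed

lemma measurable_indicator_D [measurable]:
  assumes [measurable]: "f \<in> L \<rightarrow>\<^sub>M M" "g \<in> L \<rightarrow>\<^sub>M M"
  shows "(\<lambda>x. indicator (D (f x)) (g x) :: ennreal) \<in> borel_measurable L"
  unfolding D_def by measurable

lemma sets_Q [measurable]: "x \<in> space M \<Longrightarrow> Q x s \<in> sets M"
  unfolding Q_def by measurable

lemma sets_E [measurable]: "x \<in> space M \<Longrightarrow> E x s \<in> sets M"
  unfolding E_def by measurable

lemma nn_integral_swap:
  assumes "case_prod f \<in> borel_measurable (M \<Otimes>\<^sub>M M)"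
  shows "(\<integral>\<^sup>+x. \<integral>\<^sup>+y. f x y \<partial>M \<partial>M) = (\<integral>\<^sup>+y. \<integral>\<^sup>+x. f x y \<partial>M \<partial>M)"
proof -
  interpret pair_sigma_finite M M ..
  show ?thesis using Fubini'[OF assms] by simp
qed

lemma rho_pos: "x \<in> space M \<Longrightarrow> y \<in> space M \<Longrightarrow> 0 < \<rho> x y"
  using r_pos r_le_rho by (meson less_le_trans)

lemma r_le_rho': "x \<in> space M \<Longrightarrow> y \<in> space M \<Longrightarrow> r y \<le> \<rho> x y"
  using r_le_rho rho_sym by metis

lemma emeasure_Q_le: "x \<in> space M \<Longrightarrow> 0 < s \<Longrightarrow> emeasure M (Q x s) \<le> ennreal (C * s ^ N)"
  unfolding Q_def by (rule measure_upper)

lemma emeasure_E_ge: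
  "x \<in> space M \<Longrightarrow> r x \<le> s \<Longrightarrow> s \<le> 1 \<Longrightarrow> ennreal (c * s ^ N) \<le> emeasure M (E x s)"
  unfolding E_def by (rule measure_lower)

lemma Q_mono: "s \<le> t \<Longrightarrow> Q x s \<subseteq> Q x t"
  by (auto simp: Q_def)

lemma E_subset_Q: "6 * s \<le> t \<Longrightarrow> E x s \<subseteq> Q x t"
  by (auto simp: E_def Q_def)

lemma Q_eq_space: "x \<in> space M \<Longrightarrow> 2 < s \<Longrightarrow> Q x s = space M"
  using rho_le_2 by (force simp: Q_def)

lemma mass_mono: "A \<subseteq> B \<Longrightarrow> mass s A \<le> mass s B"
  by (intro nn_integral_mono mult_left_mono) (auto simp: indicator_def)

text \<open>
  With \<open>s\<close> of order \<open>\<rho> z w\<close>, every \<open>\<zeta>\<close> in \<open>E z s\<close> has a tent that contains both points. Such \<open>\<zeta>\<close> have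
  measure of order \<open>s ^ N\<close>, and the integrand there is of order \<open>s ^ (-2N)\<close>.
\<close>

lemma kernel_le_tent_integral:
  assumes z: "z \<in> space M" and w: "w \<in> space M"
  shows "ennreal (1 / \<rho> z w ^ N) \<le> ennreal (1 / c) *
    (\<integral>\<^sup>+\<zeta>. indicator (D \<zeta>) z * indicator (D \<zeta>) w * ennreal (r \<zeta> powr (- 2 * real N)) \<partial>M)"
proof -
  define s where "s = min 1 (\<rho> z w)"
  have s: "r z \<le> s" "s \<le> 1" "s \<le> \<rho> z w" "\<rho> z w \<le> 2 * s" "0 < s"
    using r_le_rho[OF z w] r_le_1[OF z] rho_le_2[OF z w] rho_pos[OF z w] by (auto simp: s_def)
  have "ennreal (1 / \<rho> z w ^ N) \<le> ennreal (1 / s ^ N)"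
    using s by (intro ennreal_leI divide_left_mono power_mono mult_pos_pos zero_less_power) auto
  also have "\<dots> = ennreal (1 / c) * (ennreal (s powr (- 2 * real N)) * ennreal (c * s ^ N))"
    using s c_pos by (simp add: ennreal_mult[symmetric] powr_minus powr_realpow field_simps
        flip: power2_eq_square power_mult) (simp add: powr_power powr_realpow[symmetric] power2_eq_square powr_add[symmetric])
  also have "\<dots> \<le> ennreal (1 / c) * (ennreal (s powr (- 2 * real N)) * emeasure M (E z s))"
    using s z by (intro mult_left_mono emeasure_E_ge) auto
  also have "ennreal (s powr (- 2 * real N)) * emeasure M (E z s)
      = (\<integral>\<^sup>+\<zeta>. ennreal (s powr (- 2 * real N)) * indicator (E z s) \<zeta> \<partial>M)"
    using z by (simp add: nn_integral_cmult_indicator)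
  also have "\<dots> \<le> (\<integral>\<^sup>+\<zeta>. indicator (D \<zeta>) z * indicator (D \<zeta>) w * ennreal (r \<zeta> powr (- 2 * real N)) \<partial>M)"
  proof (intro nn_integral_mono)
    fix \<zeta> assume \<zeta>: "\<zeta> \<in> space M"
    show "ennreal (s powr (- 2 * real N)) * indicator (E z s) \<zeta>
      \<le> indicator (D \<zeta>) z * indicator (D \<zeta>) w * ennreal (r \<zeta> powr (- 2 * real N))"
    proof (cases "\<zeta> \<in> E z s")
      case True
      then have e: "\<rho> z \<zeta> < 6 * s" "s / 4 \<le> r \<zeta>" "r \<zeta> < s" by (auto simp: E_def)
      have "\<rho> \<zeta> w \<le> 3 * (\<rho> \<zeta> z + \<rho> z w)" by (rule rho_triangle[OF \<zeta> z w])
      then have "z \<in> D \<zeta>" "w \<in> D \<zeta>"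
        using e s z w rho_sym[OF z \<zeta>] by (auto simp: D_def Q_def)
      moreover have "s powr (- 2 * real N) \<le> r \<zeta> powr (- 2 * real N)"
        using e s r_pos[OF \<zeta>] by (intro powr_mono2') auto
      ultimately show ?thesis using True by (simp add: ennreal_leI)
    qed simp
  qed
  finally show ?thesis by (simp add: mult_left_mono)
qed

text \<open>
  If \<open>w\<close> lies in \<open>D \<zeta>\<close>, then \<open>r \<zeta>\<close> is at least \<open>\<rho> w \<zeta> / 96\<close>. The integral is therefore a sum over
  dyadic shells around \<open>w\<close>, which is geometric because \<open>a > 0\<close> and starts at radius \<open>r w\<close>.
\<close>

lemma tent_integral_le:
  assumes a: "0 < a"
  obtains K where "0 < K" and
    "\<And>w. w \<in> space M \<Longrightarrow>
      (\<integral>\<^sup>+\<zeta>. indicator (D \<zeta>) w * ennreal (r \<zeta> powr (- real N - a)) \<partial>M) \<le> ennreal (K * r w powr (- a))"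
proof
  define q where "q = 2 powr (- a)"
  have q: "0 < q" "q < 1" using a powr_less_mono[of "-a" 0 2] by (auto simp: q_def)
  define K where "K = 96 powr (real N + a) * C * 2 ^ N / (1 - q)"
  show "0 < K" using C_pos q by (simp add: K_def)
  fix w assume w: "w \<in> space M"
  note rw = r_pos[OF w]
  define L where "L k = {\<zeta> \<in> space M. 2 ^ k * r w \<le> \<rho> w \<zeta> \<and> \<rho> w \<zeta> < 2 ^ Suc k * r w}" for k :: nat
  define b where "b k = 96 powr (real N + a) * (2 ^ k * r w) powr (- real N - a)" for k :: nat
  have [measurable]: "L k \<in> sets M" for k using w unfolding L_def by measurable
  have "(\<integral>\<^sup>+\<zeta>. indicator (D \<zeta>) w * ennreal (r \<zeta> powr (- real N - a)) \<partial>M)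
      \<le> (\<integral>\<^sup>+\<zeta>. (\<Sum>k. ennreal (b k) * indicator (L k) \<zeta>) \<partial>M)"
  proof (intro nn_integral_mono)
    fix \<zeta> assume \<zeta>: "\<zeta> \<in> space M"
    show "indicator (D \<zeta>) w * ennreal (r \<zeta> powr (- real N - a)) \<le> (\<Sum>k. ennreal (b k) * indicator (L k) \<zeta>)"
    proof (cases "w \<in> D \<zeta>")
      case True
      then have less: "\<rho> w \<zeta> < 96 * r \<zeta>" using rho_sym[OF w \<zeta>] by (auto simp: D_def Q_def)
      define k where "k = (LEAST k. \<rho> w \<zeta> < 2 ^ Suc k * r w)"
      obtain n where "\<rho> w \<zeta> / r w < 2 ^ n" using real_arch_pow[of 2] by auto
      moreover have "(2::real) ^ n \<le> 2 ^ Suc n" by simp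
      ultimately have "\<rho> w \<zeta> / r w < 2 ^ Suc n" by (meson less_le_trans)
      then have "\<exists>k. \<rho> w \<zeta> < 2 ^ Suc k * r w" using rw by (auto simp: field_simps)
      then have k1: "\<rho> w \<zeta> < 2 ^ Suc k * r w" unfolding k_def by (rule LeastI_ex)
      have k2: "2 ^ k * r w \<le> \<rho> w \<zeta>"
      proof (cases k)
        case 0 then show ?thesis using r_le_rho[OF w \<zeta>] by simp
      next
        case (Suc j)
        then have "\<not> \<rho> w \<zeta> < 2 ^ Suc j * r w" using not_less_Least[of j "\<lambda>k. \<rho> w \<zeta> < 2 ^ Suc k * r w"]
            unfolding k_def by simp
        then show ?thesis using Suc by simp
      qed
      have "r \<zeta> powr (- real N - a) \<le> (2 ^ k * r w / 96) powr (- real N - a)"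
        using k2 less a rw by (intro powr_mono2') auto
      also have "\<dots> = b k"
        using rw by (simp add: b_def powr_divide powr_minus[of 96, symmetric] divide_powr_uminus add.commute)
      finally have "ennreal (r \<zeta> powr (- real N - a)) \<le> ennreal (b k) * indicator (L k) \<zeta>"
        using k1 k2 \<zeta> by (simp add: L_def ennreal_leI)
      also have "\<dots> \<le> (\<Sum>k. ennreal (b k) * indicator (L k) \<zeta>)"
        using sum_le_suminf[of "\<lambda>k. ennreal (b k) * indicator (L k) \<zeta>" "{k}"]
        by (simp del: sum_mult_indicator)
      finally show ?thesis using True by simp
    qed simp
  qed
  also have "\<dots> = (\<Sum>k. ennreal (b k) * emeasure M (L k))"
    by (subst nn_integral_suminf) (auto simp: nn_integral_cmult_indicator)
  also have "\<dots> \<le> (\<Sum>k. ennreal (96 powr (real N + a) * C * 2 ^ N * r w powr (- a) * q ^ k))"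
  proof (intro suminf_le)
    fix k
    have "emeasure M (L k) \<le> emeasure M (Q w (2 ^ Suc k * r w))"
      using w by (intro emeasure_mono) (auto simp: L_def Q_def)
    also have "\<dots> \<le> ennreal (C * (2 ^ Suc k * r w) ^ N)"
      using w rw by (intro emeasure_Q_le) auto
    finally have "ennreal (b k) * emeasure M (L k) \<le> ennreal (b k) * ennreal (C * (2 ^ Suc k * r w) ^ N)"
      by (intro mult_left_mono) auto
    also have "\<dots> = ennreal (b k * (C * (2 ^ Suc k * r w) ^ N))"
      using C_pos rw by (simp add: ennreal_mult[symmetric] b_def)
    also have "(2 ^ Suc k * r w) ^ N = 2 ^ N * (2 ^ k * r w) powr real N"
      using rw by (simp add: powr_realpow power_mult_distrib)
    also have "b k * (C * (2 ^ N * (2 ^ k * r w) powr real N))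
        = 96 powr (real N + a) * C * 2 ^ N * ((2 ^ k * r w) powr (- real N - a) * (2 ^ k * r w) powr real N)"
      by (simp add: b_def)
    also have "(2 ^ k * r w) powr (- real N - a) * (2 ^ k * r w) powr real N = (2 ^ k * r w) powr (- a)"
      by (simp add: powr_add[symmetric])
    also have "\<dots> = r w powr (- a) * q ^ k"
      using rw by (simp add: powr_mult q_def powr_power powr_realpow[symmetric] powr_powr mult.commute)
    finally show "ennreal (b k) * emeasure M (L k)
      \<le> ennreal (96 powr (real N + a) * C * 2 ^ N * r w powr (- a) * q ^ k)"
      by (simp add: mult_ac)
  qed auto
  also have "\<dots> = ennreal (K * r w powr (- a))"
  proof -
    have "(\<lambda>k. 96 powr (real N + a) * C * 2 ^ N * r w powr (- a) * q ^ k) sums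
        (96 powr (real N + a) * C * 2 ^ N * r w powr (- a) * (1 / (1 - q)))"
      using q by (intro sums_mult geometric_sums) auto
    then show ?thesis using C_pos q
      by (subst suminf_ennreal_eq[where x="K * r w powr (- a)"]) (auto simp: K_def mult_ac)
  qed
  finally show "(\<integral>\<^sup>+\<zeta>. indicator (D \<zeta>) w * ennreal (r \<zeta> powr (- real N - a)) \<partial>M)
    \<le> ennreal (K * r w powr (- a))" .
qed

section \<open>Decay of a weight towards the boundary\<close>

text \<open>
  Over the disjoint upper parts \<open>E w (h / 4^k)\<close> between the heights \<open>h\<close> and \<open>max (r w) \<eta>\<close>, the integral
  of \<open>r \<zeta> powr (-N-\<delta>)\<close> is a geometric sum comparable to the power of the lowest height. The factor
  \<open>4 powr \<delta> - 1\<close> of this geometric sum tends to 0 with \<open>\<delta>\<close>; the decay estimate depends on that. The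
  truncation at \<open>\<eta>\<close> keeps all the quantities finite until the end.
\<close>

lemma truncated_power_le:
  assumes \<delta>: "0 < \<delta>" and \<eta>: "0 < \<eta>" and w: "w \<in> space M" and h: "0 < h" "h \<le> 1"
  shows "ennreal (max (r w) \<eta> powr (- \<delta>)) \<le> ennreal (h powr (- \<delta>)) + ennreal ((4 powr \<delta> - 1) / c) *
    (\<integral>\<^sup>+\<zeta>. indicator {\<zeta> \<in> space M. \<rho> w \<zeta> < 24 * r \<zeta> \<and> r \<zeta> < h \<and> \<eta> \<le> 4 * r \<zeta>} \<zeta> *
      ennreal (r \<zeta> powr (- real N - \<delta>)) \<partial>M)"
    (is "_ \<le> _ + _ * (\<integral>\<^sup>+\<zeta>. indicator ?P \<zeta> * _ \<partial>M)")
proof (cases "h \<le> max (r w) \<eta>")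
  case True
  then have "ennreal (max (r w) \<eta> powr (- \<delta>)) \<le> ennreal (h powr (- \<delta>))"
    using h \<delta> by (intro ennreal_leI powr_mono2') auto
  then show ?thesis by (rule order_trans) simp
next
  case False
  define m where "m = max (r w) \<eta>"
  have m: "0 < m" "m < h" "r w \<le> m" "\<eta> \<le> m" using False \<eta> by (auto simp: m_def)
  define t where "t k = h / 4 ^ k" for k :: nat
  have t_pos: "0 < t k" for k using h by (simp add: t_def)
  define K where "K = (LEAST k. t k \<le> m)"
  have "\<exists>k. t k \<le> m"
  proof -
    obtain n where "h / m < 4 ^ n" using real_arch_pow[of 4] by auto
    then show ?thesis using m by (auto simp: t_def field_simps intro!: exI[of _ n])
  qed
  then have tK: "t K \<le> m" unfolding K_def by (rule LeastI_ex)
  have tk: "m < t k" if "k < K" for k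
    using not_less_Least[of k "\<lambda>k. t k \<le> m"] that by (simp add: K_def)
  define q where "q = 4 powr \<delta>"
  have q: "1 < q" using \<delta> by (simp add: q_def)
  have t_powr: "t k powr (- \<delta>) = h powr (- \<delta>) * q ^ k" for k
    using h by (simp add: t_def q_def powr_divide powr_minus powr_power powr_realpow[symmetric] powr_powr
        field_simps)
  have E_term: "ennreal (c * t k powr (- \<delta>)) \<le>
      (\<integral>\<^sup>+\<zeta>. indicator (E w (t k)) \<zeta> * ennreal (r \<zeta> powr (- real N - \<delta>)) \<partial>M)" if "k < K" for k
  proof -
    have "t k \<le> h" using h by (simp add: t_def field_simps)
    then have tk1: "t k \<le> 1" "r w \<le> t k"
      using h tk[OF that] m by linarith+
    have "c * t k powr (- \<delta>) = t k powr (- real N - \<delta>) * (c * t k ^ N)"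
      using t_pos[of k] by (simp add: powr_realpow[symmetric] powr_add[symmetric])
    then have "ennreal (c * t k powr (- \<delta>)) = ennreal (t k powr (- real N - \<delta>)) * ennreal (c * t k ^ N)"
      using c_pos t_pos[of k] by (simp add: ennreal_mult mult_ac)
    also have "\<dots> \<le> ennreal (t k powr (- real N - \<delta>)) * emeasure M (E w (t k))"
      using w tk1 by (intro mult_left_mono emeasure_E_ge) auto
    also have "\<dots> = (\<integral>\<^sup>+\<zeta>. ennreal (t k powr (- real N - \<delta>)) * indicator (E w (t k)) \<zeta> \<partial>M)"
      using w by (simp add: nn_integral_cmult_indicator)
    also have "\<dots> \<le> (\<integral>\<^sup>+\<zeta>. indicator (E w (t k)) \<zeta> * ennreal (r \<zeta> powr (- real N - \<delta>)) \<partial>M)"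
    proof (intro nn_integral_mono)
      fix \<zeta> assume \<zeta>: "\<zeta> \<in> space M"
      show "ennreal (t k powr (- real N - \<delta>)) * indicator (E w (t k)) \<zeta>
        \<le> indicator (E w (t k)) \<zeta> * ennreal (r \<zeta> powr (- real N - \<delta>))"
        using \<delta> r_pos[OF \<zeta>]
        by (auto simp: E_def indicator_def intro!: ennreal_leI powr_mono2')
    qed
    finally show ?thesis .
  qed
  have disj: "disjoint_family_on (\<lambda>k. E w (t k)) {..<K}"
  proof -
    have "E w (t i) \<inter> E w (t j) = {}" if "i < j" for i j
    proof -
      have "(4::real) ^ Suc i \<le> 4 ^ j" using that by (intro power_increasing) auto
      then have "h / 4 ^ j \<le> h / 4 ^ Suc i" using h by (intro divide_left_mono) auto
      then have "t j \<le> t i / 4" by (simp add: t_def)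
      then show ?thesis by (auto simp: E_def)
    qed
    then show ?thesis unfolding disjoint_family_on_def by (metis inf_commute linorder_neqE_nat)
  qed
  have sub: "E w (t k) \<subseteq> ?P" if "k < K" for k
  proof
    fix \<zeta> assume "\<zeta> \<in> E w (t k)"
    moreover have "t k \<le> h" using h by (simp add: t_def field_simps)
    ultimately show "\<zeta> \<in> ?P" using tk[OF that] m by (auto simp: E_def)
  qed
  have [measurable]: "E w (t k) \<in> sets M" for k using w by measurable
  have "(\<Sum>k<K. ennreal (c * t k powr (- \<delta>)))
      \<le> (\<Sum>k<K. \<integral>\<^sup>+\<zeta>. indicator (E w (t k)) \<zeta> * ennreal (r \<zeta> powr (- real N - \<delta>)) \<partial>M)"
    by (intro sum_mono E_term) auto
  also have "\<dots> = (\<integral>\<^sup>+\<zeta>. (\<Sum>k<K. indicator (E w (t k)) \<zeta>) * ennreal (r \<zeta> powr (- real N - \<delta>)) \<partial>M)"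
    by (subst nn_integral_sum[symmetric]) (auto simp: sum_distrib_right)
  also have "\<dots> \<le> (\<integral>\<^sup>+\<zeta>. indicator ?P \<zeta> * ennreal (r \<zeta> powr (- real N - \<delta>)) \<partial>M)"
  proof (intro nn_integral_mono mult_right_mono)
    fix \<zeta>
    have "(\<Sum>k<K. indicator (E w (t k)) \<zeta>) = (indicator (\<Union>k<K. E w (t k)) \<zeta> :: ennreal)"
      by (rule indicator_UN_disjoint[symmetric]) (use disj in auto)
    also have "\<dots> \<le> indicator ?P \<zeta>"
      using sub by (cases "\<zeta> \<in> ?P") (simp_all add: indicator_def, blast)
    finally show "(\<Sum>k<K. indicator (E w (t k)) \<zeta>) \<le> (indicator ?P \<zeta> :: ennreal)" .
  qed auto
  finally have int: "ennreal (c * h powr (- \<delta>) * (\<Sum>k<K. q ^ k))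
      \<le> (\<integral>\<^sup>+\<zeta>. indicator ?P \<zeta> * ennreal (r \<zeta> powr (- real N - \<delta>)) \<partial>M)"
    using c_pos q by (subst (asm) sum_ennreal) (auto simp: t_powr sum_distrib_left mult_ac)
  have "m powr (- \<delta>) \<le> t K powr (- \<delta>)"
    using tK t_pos \<delta> by (intro powr_mono2') auto
  also have "\<dots> = h powr (- \<delta>) + (q - 1) / c * (c * h powr (- \<delta>) * (\<Sum>k<K. q ^ k))"
  proof -
    have "(q - 1) * (\<Sum>k<K. q ^ k) = q ^ K - 1" by (simp add: power_diff_1_eq)
    then have "(q - 1) / c * (c * h powr (- \<delta>) * (\<Sum>k<K. q ^ k)) = h powr (- \<delta>) * (q ^ K - 1)"
      using c_pos by (metis (no_types, lifting) divide_inverse less_irrefl mult.assoc mult.commute mult.right_neutral right_inverse)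
    then show ?thesis by (simp add: t_powr algebra_simps)
  qed
  finally have "ennreal (m powr (- \<delta>)) \<le> ennreal (h powr (- \<delta>)) +
      ennreal ((q - 1) / c) * ennreal (c * h powr (- \<delta>) * (\<Sum>k<K. q ^ k))"
    using q c_pos by (simp add: ennreal_mult[symmetric] ennreal_plus[symmetric] sum_nonneg ennreal_leI
        del: ennreal_plus)
  also have "\<dots> \<le> ennreal (h powr (- \<delta>)) + ennreal ((q - 1) / c) *
      (\<integral>\<^sup>+\<zeta>. indicator ?P \<zeta> * ennreal (r \<zeta> powr (- real N - \<delta>)) \<partial>M)"
    by (intro add_left_mono mult_left_mono int) auto
  finally show ?thesis by (simp add: m_def q_def)
qed

text \<open>
  If the decay estimate holds with constant \<open>q\<close>, then it holds with constant \<open>1 + q/2\<close>. The previous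
  lemma bounds the integral over \<open>Q x (96 h)\<close> by the trivial part plus an integral over \<open>\<zeta>\<close> of masses of
  quasiballs around \<open>\<zeta>\<close>. The doubling hypothesis replaces each such mass by that of the part at height
  \<open>r \<zeta>\<close> only, and there \<open>r \<zeta>\<close> is comparable to the height of the points themselves. After exchanging
  the integrals the same kind of integral reappears, over a larger quasiball, with a factor that is
  small with \<open>\<delta>\<close>. The radius \<open>1098 h\<close> of the larger quasiball comes from three applications of
  the quasi-triangle inequality: \<open>3 * (24 + 96) = 360\<close> and \<open>3 * (6 + 360) = 1098\<close>.
\<close>

lemma truncated_decay_step:
  assumes [measurable]: "s \<in> borel_measurable M" and "0 \<le> K"
    and vd: "\<And>x t. x \<in> space M \<Longrightarrow> r x \<le> t \<Longrightarrow> t \<le> 1 \<Longrightarrow>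
      mass s (Q x (1098 * t)) \<le> ennreal K * mass s (E x t)"
    and \<delta>: "0 < \<delta>" and \<eta>: "0 < \<eta>"
    and small: "(4 powr \<delta> - 1) / c * K * (4 powr \<delta> * C * 24 ^ N) * K \<le> 1 / 2"
    and q: "0 \<le> q" and valid: "\<And>x t. x \<in> space M \<Longrightarrow> r x \<le> t \<Longrightarrow> t \<le> 1 \<Longrightarrow>
      (\<integral>\<^sup>+y. s y * ennreal (max (r y) \<eta> powr (- \<delta>)) * indicator (Q x (96 * t)) y \<partial>M)
        \<le> ennreal (q * t powr (- \<delta>)) * mass s (Q x (96 * t))"
    and x: "x \<in> space M" and h: "r x \<le> h" "h \<le> 1"
  shows "(\<integral>\<^sup>+y. s y * ennreal (max (r y) \<eta> powr (- \<delta>)) * indicator (Q x (96 * h)) y \<partial>M)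
        \<le> ennreal ((1 + q / 2) * h powr (- \<delta>)) * mass s (Q x (96 * h))"
proof -
  define g where "g y = max (r y) \<eta> powr (- \<delta>)" for y
  have [measurable]: "g \<in> borel_measurable M" unfolding g_def by measurable
  define X where "X = Q x (96 * h)"
  define Y where "Y = Q x (1098 * h)"
  define \<kappa> where "\<kappa> = (4 powr \<delta> - 1) / c"
  define P where "P w \<zeta> \<longleftrightarrow> \<rho> w \<zeta> < 24 * r \<zeta> \<and> r \<zeta> < h \<and> \<eta> \<le> 4 * r \<zeta>" for w \<zeta>
  define Z where "Z = {\<zeta> \<in> space M. r \<zeta> < h \<and> \<eta> \<le> 4 * r \<zeta> \<and> \<rho> \<zeta> x < 360 * h}"
  have h0: "0 < h" using h r_pos[OF x] by simp
  have \<kappa>: "0 \<le> \<kappa>" using \<delta> c_pos by (auto simp: \<kappa>_def intro!: divide_nonneg_pos ge_one_powr_ge_zero)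
  have [measurable]: "X \<in> sets M" "Y \<in> sets M" "Z \<in> sets M"
    using x unfolding X_def Y_def Z_def by measurable
  have [measurable]: "Measurable.pred (M \<Otimes>\<^sub>M M) (\<lambda>p. P (fst p) (snd p))"
    unfolding P_def by measurable
  let ?b = "\<lambda>\<zeta>. ennreal (r \<zeta> powr (- real N - \<delta>))"

  have "(\<integral>\<^sup>+w. s w * ennreal (g w) * indicator X w \<partial>M) \<le>
    (\<integral>\<^sup>+w. ennreal (h powr (- \<delta>)) * (s w * indicator X w) + ennreal \<kappa> *
      (\<integral>\<^sup>+\<zeta>. s w * indicator X w * indicator {\<zeta>. P w \<zeta>} \<zeta> * ?b \<zeta> \<partial>M) \<partial>M)"
  proof (intro nn_integral_mono)
    fix w assume w: "w \<in> space M"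
    have [measurable]: "Measurable.pred M (\<lambda>\<zeta>. P w \<zeta>)" unfolding P_def using w by measurable
    have "ennreal (g w) \<le> ennreal (h powr (- \<delta>)) + ennreal \<kappa> *
        (\<integral>\<^sup>+\<zeta>. indicator {\<zeta>\<in>space M. P w \<zeta>} \<zeta> * ?b \<zeta> \<partial>M)"
      using truncated_power_le[OF \<delta> \<eta> w h0 h(2)] by (simp add: g_def \<kappa>_def P_def)
    also have "(\<integral>\<^sup>+\<zeta>. indicator {\<zeta>\<in>space M. P w \<zeta>} \<zeta> * ?b \<zeta> \<partial>M)
        = (\<integral>\<^sup>+\<zeta>. indicator {\<zeta>. P w \<zeta>} \<zeta> * ?b \<zeta> \<partial>M)"
      by (intro nn_integral_cong) (auto simp: indicator_def)
    finally have "(s w * indicator X w) * ennreal (g w) \<le> (s w * indicator X w) *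
        (ennreal (h powr (- \<delta>)) + ennreal \<kappa> * (\<integral>\<^sup>+\<zeta>. indicator {\<zeta>. P w \<zeta>} \<zeta> * ?b \<zeta> \<partial>M))"
      by (intro mult_left_mono) auto
    also have "\<dots> = ennreal (h powr (- \<delta>)) * (s w * indicator X w) + ennreal \<kappa> *
        ((s w * indicator X w) * (\<integral>\<^sup>+\<zeta>. indicator {\<zeta>. P w \<zeta>} \<zeta> * ?b \<zeta> \<partial>M))"
      by (simp add: algebra_simps)
    also have "(s w * indicator X w) * (\<integral>\<^sup>+\<zeta>. indicator {\<zeta>. P w \<zeta>} \<zeta> * ?b \<zeta> \<partial>M)
        = (\<integral>\<^sup>+\<zeta>. s w * indicator X w * indicator {\<zeta>. P w \<zeta>} \<zeta> * ?b \<zeta> \<partial>M)"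
      by (subst nn_integral_cmult[symmetric]) (auto simp: mult_ac)
    finally show "s w * ennreal (g w) * indicator X w \<le> ennreal (h powr (- \<delta>)) * (s w * indicator X w)
        + ennreal \<kappa> * (\<integral>\<^sup>+\<zeta>. s w * indicator X w * indicator {\<zeta>. P w \<zeta>} \<zeta> * ?b \<zeta> \<partial>M)"
      by (simp add: mult_ac)
  qed
  also have "\<dots> = ennreal (h powr (- \<delta>)) * mass s X + ennreal \<kappa> *
      (\<integral>\<^sup>+w. \<integral>\<^sup>+\<zeta>. s w * indicator X w * indicator {\<zeta>. P w \<zeta>} \<zeta> * ?b \<zeta> \<partial>M \<partial>M)"
    by (subst nn_integral_add) (auto simp: nn_integral_cmult)
  also have "(\<integral>\<^sup>+w. \<integral>\<^sup>+\<zeta>. s w * indicator X w * indicator {\<zeta>. P w \<zeta>} \<zeta> * ?b \<zeta> \<partial>M \<partial>M)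
      = (\<integral>\<^sup>+\<zeta>. \<integral>\<^sup>+w. s w * indicator X w * indicator {\<zeta>. P w \<zeta>} \<zeta> * ?b \<zeta> \<partial>M \<partial>M)"
    by (rule nn_integral_swap) (auto simp: split_beta' indicator_def)
  also have "\<dots> \<le> (\<integral>\<^sup>+\<zeta>. ennreal K * (\<integral>\<^sup>+v. indicator Z \<zeta> * ?b \<zeta> * (s v * indicator (E \<zeta> (r \<zeta>)) v) \<partial>M) \<partial>M)"
  proof (intro nn_integral_mono)
    fix \<zeta> assume \<zeta>: "\<zeta> \<in> space M"
    have "(\<integral>\<^sup>+w. s w * indicator X w * indicator {\<zeta>. P w \<zeta>} \<zeta> * ?b \<zeta> \<partial>M)
        \<le> (\<integral>\<^sup>+w. indicator Z \<zeta> * ?b \<zeta> * (s w * indicator (Q \<zeta> (1098 * r \<zeta>)) w) \<partial>M)"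
    proof (intro nn_integral_mono)
      fix w assume w: "w \<in> space M"
      have "\<zeta> \<in> Z \<and> w \<in> Q \<zeta> (1098 * r \<zeta>)" if "w \<in> X" "P w \<zeta>"
      proof -
        have "\<rho> \<zeta> x \<le> 3 * (\<rho> \<zeta> w + \<rho> w x)" by (rule rho_triangle[OF \<zeta> w x])
        then show ?thesis
          using that w \<zeta> x rho_sym[OF w \<zeta>] rho_sym[OF x w] r_pos[OF \<zeta>]
          by (auto simp: X_def Q_def P_def Z_def)
      qed
      then show "s w * indicator X w * indicator {\<zeta>. P w \<zeta>} \<zeta> * ?b \<zeta>
        \<le> indicator Z \<zeta> * ?b \<zeta> * (s w * indicator (Q \<zeta> (1098 * r \<zeta>)) w)"
        by (auto simp: indicator_def mult_ac)
    qed
    also have "\<dots> = indicator Z \<zeta> * ?b \<zeta> * mass s (Q \<zeta> (1098 * r \<zeta>))"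
      using \<zeta> by (subst nn_integral_cmult) auto
    also have "\<dots> \<le> indicator Z \<zeta> * ?b \<zeta> * (ennreal K * mass s (E \<zeta> (r \<zeta>)))"
      using \<zeta> r_le_1[OF \<zeta>] by (intro mult_left_mono vd) auto
    also have "\<dots> = ennreal K * (\<integral>\<^sup>+v. indicator Z \<zeta> * ?b \<zeta> * (s v * indicator (E \<zeta> (r \<zeta>)) v) \<partial>M)"
      using \<zeta> by (subst nn_integral_cmult) (auto simp: mult_ac)
    finally show "(\<integral>\<^sup>+w. s w * indicator X w * indicator {\<zeta>. P w \<zeta>} \<zeta> * ?b \<zeta> \<partial>M) \<le>
      ennreal K * (\<integral>\<^sup>+v. indicator Z \<zeta> * ?b \<zeta> * (s v * indicator (E \<zeta> (r \<zeta>)) v) \<partial>M)" .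
  qed
  also have "\<dots> = ennreal K * (\<integral>\<^sup>+\<zeta>. \<integral>\<^sup>+v. indicator Z \<zeta> * ?b \<zeta> * (s v * indicator (E \<zeta> (r \<zeta>)) v) \<partial>M \<partial>M)"
    by (subst nn_integral_cmult) auto
  also have "(\<integral>\<^sup>+\<zeta>. \<integral>\<^sup>+v. indicator Z \<zeta> * ?b \<zeta> * (s v * indicator (E \<zeta> (r \<zeta>)) v) \<partial>M \<partial>M)
     = (\<integral>\<^sup>+v. \<integral>\<^sup>+\<zeta>. indicator Z \<zeta> * ?b \<zeta> * (s v * indicator (E \<zeta> (r \<zeta>)) v) \<partial>M \<partial>M)"
    by (rule nn_integral_swap) auto
  also have "\<dots> \<le> (\<integral>\<^sup>+v. ennreal (4 powr \<delta> * C * 24 ^ N) * (s v * ennreal (g v) * indicator Y v) \<partial>M)"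
  proof (intro nn_integral_mono)
    fix v assume v: "v \<in> space M"
    note rv = r_pos[OF v]
    let ?a = "r v powr (- real N) * (4 powr \<delta> * g v)"
    have "(\<integral>\<^sup>+\<zeta>. indicator Z \<zeta> * ?b \<zeta> * (s v * indicator (E \<zeta> (r \<zeta>)) v) \<partial>M)
      \<le> (\<integral>\<^sup>+\<zeta>. s v * indicator Y v * ennreal ?a * indicator (Q v (24 * r v)) \<zeta> \<partial>M)"
    proof (intro nn_integral_mono)
      fix \<zeta> assume \<zeta>: "\<zeta> \<in> space M"
      have "?b \<zeta> \<le> ennreal ?a \<and> v \<in> Y \<and> \<zeta> \<in> Q v (24 * r v)" if "\<zeta> \<in> Z" "v \<in> E \<zeta> (r \<zeta>)"
      proof (intro conjI)
        have e: "\<rho> \<zeta> v < 6 * r \<zeta>" "r \<zeta> \<le> 4 * r v" "r v < r \<zeta>" "r \<zeta> < h" "\<eta> \<le> 4 * r \<zeta>" "\<rho> \<zeta> x < 360 * h"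
          using that by (auto simp: E_def Z_def)
        have "r \<zeta> powr (- \<delta>) \<le> (max (r v) \<eta> / 4) powr (- \<delta>)"
          using e rv \<eta> \<delta> by (intro powr_mono2') auto
        also have "\<dots> = 4 powr \<delta> * g v"
          using rv by (simp add: g_def powr_divide powr_minus field_simps)
        finally have "r \<zeta> powr (- real N) * r \<zeta> powr (- \<delta>) \<le> ?a"
          using e rv by (intro mult_mono powr_mono2') auto
        then show "?b \<zeta> \<le> ennreal ?a" by (auto simp: powr_add[symmetric] intro: ennreal_leI)
        have "\<rho> v x \<le> 3 * (\<rho> v \<zeta> + \<rho> \<zeta> x)" by (rule rho_triangle[OF v \<zeta> x])
        then show "v \<in> Y" using e v x \<zeta> rho_sym[OF v \<zeta>] rho_sym[OF x v] by (auto simp: Y_def Q_def)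
        show "\<zeta> \<in> Q v (24 * r v)" using e v \<zeta> rho_sym[OF v \<zeta>] by (auto simp: Q_def)
      qed
      then show "indicator Z \<zeta> * ?b \<zeta> * (s v * indicator (E \<zeta> (r \<zeta>)) v)
         \<le> s v * indicator Y v * ennreal ?a * indicator (Q v (24 * r v)) \<zeta>"
        by (cases "\<zeta> \<in> Z \<and> v \<in> E \<zeta> (r \<zeta>)") (auto simp: indicator_def mult.commute intro: mult_left_mono)
    qed
    also have "\<dots> = s v * indicator Y v * ennreal ?a * emeasure M (Q v (24 * r v))"
      using v by (subst nn_integral_cmult_indicator) auto
    also have "\<dots> \<le> s v * indicator Y v * ennreal ?a * ennreal (C * (24 * r v) ^ N)"
      using v rv by (intro mult_left_mono emeasure_Q_le) auto
    also have "\<dots> = ennreal (?a * (C * (24 * r v) ^ N)) * (s v * indicator Y v)"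
      using C_pos rv by (simp add: ennreal_mult g_def mult_ac)
    also have "?a * (C * (24 * r v) ^ N) = 4 powr \<delta> * C * 24 ^ N * g v"
      using rv by (simp add: powr_minus powr_realpow power_mult_distrib field_simps)
    also have "ennreal (4 powr \<delta> * C * 24 ^ N * g v) * (s v * indicator Y v)
        = ennreal (4 powr \<delta> * C * 24 ^ N) * (s v * ennreal (g v) * indicator Y v)"
      using C_pos by (simp add: ennreal_mult g_def mult_ac)
    finally show "(\<integral>\<^sup>+\<zeta>. indicator Z \<zeta> * ?b \<zeta> * (s v * indicator (E \<zeta> (r \<zeta>)) v) \<partial>M) \<le>
      ennreal (4 powr \<delta> * C * 24 ^ N) * (s v * ennreal (g v) * indicator Y v)" .
  qed
  also have "\<dots> = ennreal (4 powr \<delta> * C * 24 ^ N) * (\<integral>\<^sup>+v. s v * ennreal (g v) * indicator Y v \<partial>M)"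
    by (subst nn_integral_cmult) auto
  also have "(\<integral>\<^sup>+v. s v * ennreal (g v) * indicator Y v \<partial>M) \<le> ennreal (q * h powr (- \<delta>)) * (ennreal K * mass s X)"
  proof -
    \<comment> \<open>The estimate with constant \<open>q\<close> is available for heights up to 1 only; beyond, \<open>Q x (96 * t)\<close> is everything.\<close>
    define t where "t = min 1 (1098 * h / 96)"
    have t: "r x \<le> t" "t \<le> 1" "h \<le> t" "96 * t \<le> 1098 * h"
      using h h0 by (auto simp: t_def)
    have "Y \<subseteq> Q x (96 * t)"
    proof (cases "t = 1")
      case True then show ?thesis using Q_eq_space[OF x, of 96] by (auto simp: Y_def Q_def)
    next
      case False then show ?thesis by (auto simp: t_def Y_def min_def split: if_splits)
    qed
    then have "(\<integral>\<^sup>+v. s v * ennreal (g v) * indicator Y v \<partial>M)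
        \<le> (\<integral>\<^sup>+v. s v * ennreal (g v) * indicator (Q x (96 * t)) v \<partial>M)"
      by (intro nn_integral_mono) (auto simp: indicator_def)
    also have "\<dots> \<le> ennreal (q * t powr (- \<delta>)) * mass s (Q x (96 * t))"
      unfolding g_def using valid[OF x] t by auto
    also have "\<dots> \<le> ennreal (q * h powr (- \<delta>)) * mass s (Q x (1098 * h))"
    proof (rule mult_mono)
      have "q * t powr (- \<delta>) \<le> q * h powr (- \<delta>)"
        using t h0 q \<delta> by (intro mult_left_mono powr_mono2') auto
      then show "ennreal (q * t powr (- \<delta>)) \<le> ennreal (q * h powr (- \<delta>))"
        by (rule ennreal_leI)
    qed (use t in \<open>auto intro!: mass_mono Q_mono\<close>)
    also have "\<dots> \<le> ennreal (q * h powr (- \<delta>)) * (ennreal K * mass s (E x h))"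
      using h x by (intro mult_left_mono vd) auto
    also have "\<dots> \<le> ennreal (q * h powr (- \<delta>)) * (ennreal K * mass s X)"
      unfolding X_def using h0 by (intro mult_left_mono mass_mono E_subset_Q) auto
    finally show ?thesis .
  qed
  finally have "(\<integral>\<^sup>+w. s w * ennreal (g w) * indicator X w \<partial>M) \<le> ennreal (h powr (- \<delta>)) * mass s X +
      ennreal \<kappa> * (ennreal K * (ennreal (4 powr \<delta> * C * 24 ^ N) * (ennreal (q * h powr (- \<delta>)) * (ennreal K * mass s X))))"
    by (simp add: mult_left_mono add_left_mono)
  also have "\<dots> = ennreal (h powr (- \<delta>)) * mass s X +
      ennreal ((\<kappa> * K * (4 powr \<delta> * C * 24 ^ N) * K) * (q * h powr (- \<delta>))) * mass s X"
    using \<kappa> \<open>0 \<le> K\<close> C_pos q by (simp add: ennreal_mult mult_ac)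
  also have "\<dots> \<le> ennreal (h powr (- \<delta>)) * mass s X + ennreal (1 / 2 * (q * h powr (- \<delta>))) * mass s X"
    using small q by (intro add_left_mono mult_right_mono ennreal_leI mult_right_mono) (auto simp: \<kappa>_def)
  also have "\<dots> = ennreal ((1 + q / 2) * h powr (- \<delta>)) * mass s X"
  proof -
    have "ennreal ((1 + q / 2) * h powr (- \<delta>)) = ennreal (h powr (- \<delta>)) + ennreal (1 / 2 * (q * h powr (- \<delta>)))"
      using q by (subst ennreal_plus[symmetric]) (auto simp: algebra_simps)
    then show ?thesis by (simp add: distrib_right)
  qed
  finally show ?thesis by (simp add: X_def g_def)
qed

text \<open>
  A weight whose mass on a quasiball is controlled by its mass on the part at full height cannot
  concentrate near the boundary. The trivial constant \<open>\<eta> powr (-\<delta>)\<close> for the truncated estimate is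
  improved by iterating the previous lemma; the limit no longer depends on \<open>\<eta>\<close>, which then tends to 0.
\<close>

lemma exists_decay:
  assumes [measurable]: "s \<in> borel_measurable M" and K: "0 \<le> K"
    and vd: "\<And>x t. x \<in> space M \<Longrightarrow> r x \<le> t \<Longrightarrow> t \<le> 1 \<Longrightarrow>
      mass s (Q x (1098 * t)) \<le> ennreal K * mass s (E x t)"
  obtains \<delta> where "0 < \<delta>" and "\<And>x t. x \<in> space M \<Longrightarrow> r x \<le> t \<Longrightarrow> t \<le> 1 \<Longrightarrow>
      (\<integral>\<^sup>+y. s y * ennreal (r y powr (- \<delta>)) * indicator (Q x (96 * t)) y \<partial>M)
        \<le> ennreal (3 * t powr (- \<delta>)) * mass s (Q x (96 * t))"
proof -
  define b where "b = K * K * (4 * C * 24 ^ N) / c"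
  have b: "0 \<le> b" using K C_pos c_pos by (simp add: b_def)
  define \<delta> where "\<delta> = min 1 (log 4 (1 + 1 / (2 * (b + 1))))"
  have "0 < log 4 (1 + 1 / (2 * (b + 1)))"
    using b by (subst zero_less_log_cancel_iff) (auto simp: add_pos_pos)
  then have \<delta>: "0 < \<delta>" "\<delta> \<le> 1" by (auto simp: \<delta>_def)
  have "4 powr \<delta> \<le> 4 powr (log 4 (1 + 1 / (2 * (b + 1))))"
    by (intro powr_mono) (auto simp: \<delta>_def)
  also have "\<dots> = 1 + 1 / (2 * (b + 1))" using b by (simp add: add_pos_nonneg)
  finally have 1: "4 powr \<delta> - 1 \<le> 1 / (2 * (b + 1))" by simp
  have 2: "4 powr \<delta> \<le> 4 powr 1" using \<delta> by (intro powr_mono) auto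
  have pos: "0 \<le> 4 powr \<delta> - 1" using \<delta> by (simp add: ge_one_powr_ge_zero)
  have "(4 powr \<delta> - 1) / c * K * (4 powr \<delta> * C * 24 ^ N) * K
      \<le> (4 powr \<delta> - 1) / c * K * (4 * C * 24 ^ N) * K"
    using 2 pos c_pos C_pos K by (intro mult_right_mono mult_left_mono) auto
  also have "\<dots> = (4 powr \<delta> - 1) * b" by (simp add: b_def)
  also have "\<dots> \<le> 1 / (2 * (b + 1)) * b" using 1 b by (intro mult_right_mono)
  also have "\<dots> \<le> 1 / 2" using b by (simp add: field_simps)
  finally have small: "(4 powr \<delta> - 1) / c * K * (4 powr \<delta> * C * 24 ^ N) * K \<le> 1 / 2" .
  have trunc: "(\<integral>\<^sup>+y. s y * ennreal (max (r y) \<eta> powr (- \<delta>)) * indicator (Q x (96 * t)) y \<partial>M)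
        \<le> ennreal (3 * t powr (- \<delta>)) * mass s (Q x (96 * t))"
    if \<eta>: "0 < \<eta>" and x: "x \<in> space M" "r x \<le> t" "t \<le> 1" for \<eta> x t
  proof -
    define q0 where "q0 = \<eta> powr (- \<delta>)"
    have "(\<integral>\<^sup>+y. s y * ennreal (max (r y) \<eta> powr (- \<delta>)) * indicator (Q x (96 * t)) y \<partial>M)
        \<le> ennreal ((2 + q0 / 2 ^ k) * t powr (- \<delta>)) * mass s (Q x (96 * t))"
      if x: "x \<in> space M" "r x \<le> t" "t \<le> 1" for k x t
      using x
    proof (induction k arbitrary: x t)
      case 0
      have t: "0 < t" using 0 r_pos[of x] by auto
      have "1 \<le> t powr (- \<delta>)" using powr_mono2'[of "- \<delta>" t 1] t 0 \<delta> by simp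
      then have le: "q0 \<le> (2 + q0) * t powr (- \<delta>)"
        using mult_mono[of q0 "2 + q0" 1 "t powr (- \<delta>)"] by (simp add: q0_def)
      have "(\<integral>\<^sup>+y. s y * ennreal (max (r y) \<eta> powr (- \<delta>)) * indicator (Q x (96 * t)) y \<partial>M)
         \<le> (\<integral>\<^sup>+y. ennreal q0 * (s y * indicator (Q x (96 * t)) y) \<partial>M)"
        using \<eta> \<delta> by (intro nn_integral_mono)
          (auto simp: q0_def indicator_def mult.commute intro!: mult_left_mono ennreal_leI powr_mono2')
      also have "\<dots> = ennreal q0 * mass s (Q x (96 * t))"
        using 0 by (subst nn_integral_cmult) auto
      also have "\<dots> \<le> ennreal ((2 + q0) * t powr (- \<delta>)) * mass s (Q x (96 * t))"
        using le by (intro mult_right_mono ennreal_leI) auto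
      finally show ?case by simp
    next
      case (Suc k)
      have "0 \<le> 2 + q0 / 2 ^ k" by (simp add: q0_def)
      from truncated_decay_step[OF assms(1) K vd \<delta>(1) \<eta> small this Suc.IH Suc.prems]
      show ?case by (simp add: field_simps)
    qed
    note step = this[OF x]
    obtain k where "q0 < 2 ^ k" using real_arch_pow[of 2] by auto
    then have "q0 / 2 ^ k \<le> 1" by (simp add: field_simps)
    then have "ennreal ((2 + q0 / 2 ^ k) * t powr (- \<delta>)) \<le> ennreal (3 * t powr (- \<delta>))"
      by (intro ennreal_leI mult_right_mono) auto
    then show ?thesis using step[of k] by (meson mult_right_mono order_trans zero_le)
  qed
  show thesis
  proof (rule that[OF \<delta>(1)])
    fix x t assume x: "x \<in> space M" "r x \<le> t" "t \<le> 1"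
    have [measurable]: "Q x (96 * t) \<in> sets M" using x by simp
    show "(\<integral>\<^sup>+y. s y * ennreal (r y powr (- \<delta>)) * indicator (Q x (96 * t)) y \<partial>M)
        \<le> ennreal (3 * t powr (- \<delta>)) * mass s (Q x (96 * t))"
    proof (rule nn_integral_le_of_tendsto)
      show "AE y in M. (\<lambda>n. s y * ennreal (max (r y) (1 / real (Suc n)) powr (- \<delta>)) * indicator (Q x (96 * t)) y)
        \<longlonglongrightarrow> s y * ennreal (r y powr (- \<delta>)) * indicator (Q x (96 * t)) y"
      proof (intro AE_I2 tendsto_eventually)
        fix y assume y: "y \<in> space M"
        have "eventually (\<lambda>n. 1 / real (Suc n) < r y) sequentially"
          using lim_inverse_n'[THEN LIMSEQ_Suc] r_pos[OF y] by (rule order_tendstoD)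
        then show "\<forall>\<^sub>F n in sequentially. s y * ennreal (max (r y) (1 / real (Suc n)) powr (- \<delta>)) * indicator (Q x (96 * t)) y
          = s y * ennreal (r y powr (- \<delta>)) * indicator (Q x (96 * t)) y"
          by eventually_elim (simp add: max_def)
      qed
    qed (use trunc[OF _ x] in auto)
  qed
qed

section \<open>The strong-type inequality\<close>

definition bergman :: "('a \<Rightarrow> ennreal) \<Rightarrow> 'a \<Rightarrow> ennreal"
  where "bergman f z = (\<integral>\<^sup>+w. ennreal (1 / \<rho> z w ^ N) * f w \<partial>M)"

lemma measurable_bergman [measurable]:
  assumes [measurable]: "f \<in> borel_measurable M"
  shows "bergman f \<in> borel_measurable M"
  unfolding bergman_def by measurable

lemma sets_D [measurable]: "x \<in> space M \<Longrightarrow> D x \<in> sets M"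
  unfolding D_def by simp

lemma sets_D' [measurable]: "z \<in> space M \<Longrightarrow> {\<zeta> \<in> space M. z \<in> D \<zeta>} \<in> sets M"
  unfolding D_def Q_def by simp

text \<open>
  The operator as the adjoint of averaging over tents, applied to averages over tents.
\<close>

lemma bergman_le_tent_average:
  assumes [measurable]: "f \<in> borel_measurable M" and z: "z \<in> space M"
  shows "bergman f z \<le> ennreal (1 / c) *
    (\<integral>\<^sup>+\<zeta>. ennreal (r \<zeta> powr (- 2 * real N)) * mass f (D \<zeta>) * indicator {\<zeta> \<in> space M. z \<in> D \<zeta>} \<zeta> \<partial>M)"
proof -
  let ?b = "\<lambda>\<zeta>. ennreal (r \<zeta> powr (- 2 * real N))"
  have "bergman f z \<le> (\<integral>\<^sup>+w. ennreal (1 / c) * (\<integral>\<^sup>+\<zeta>. indicator (D \<zeta>) z * indicator (D \<zeta>) w * ?b \<zeta> * f w \<partial>M) \<partial>M)"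
    unfolding bergman_def
  proof (intro nn_integral_mono)
    fix w assume w: "w \<in> space M"
    have "ennreal (1 / \<rho> z w ^ N) * f w
        \<le> ennreal (1 / c) * (\<integral>\<^sup>+\<zeta>. indicator (D \<zeta>) z * indicator (D \<zeta>) w * ?b \<zeta> \<partial>M) * f w"
      by (intro mult_right_mono kernel_le_tent_integral z w) auto
    also have "\<dots> = ennreal (1 / c) * (\<integral>\<^sup>+\<zeta>. indicator (D \<zeta>) z * indicator (D \<zeta>) w * ?b \<zeta> * f w \<partial>M)"
      using w z by (subst nn_integral_multc) (auto simp: mult.assoc)
    finally show "ennreal (1 / \<rho> z w ^ N) * f w \<le> \<dots>" .
  qed
  also have "\<dots> = ennreal (1 / c) *
      (\<integral>\<^sup>+w. \<integral>\<^sup>+\<zeta>. indicator (D \<zeta>) z * indicator (D \<zeta>) w * ?b \<zeta> * f w \<partial>M \<partial>M)"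
    using z by (subst nn_integral_cmult) auto
  also have "(\<integral>\<^sup>+w. \<integral>\<^sup>+\<zeta>. indicator (D \<zeta>) z * indicator (D \<zeta>) w * ?b \<zeta> * f w \<partial>M \<partial>M)
      = (\<integral>\<^sup>+\<zeta>. \<integral>\<^sup>+w. indicator (D \<zeta>) z * indicator (D \<zeta>) w * ?b \<zeta> * f w \<partial>M \<partial>M)"
    using z by (intro nn_integral_swap) auto
  also have "\<dots> = (\<integral>\<^sup>+\<zeta>. ?b \<zeta> * mass f (D \<zeta>) * indicator {\<zeta> \<in> space M. z \<in> D \<zeta>} \<zeta> \<partial>M)"
  proof (intro nn_integral_cong)
    fix \<zeta> assume \<zeta>: "\<zeta> \<in> space M"
    have "(\<integral>\<^sup>+w. indicator (D \<zeta>) z * indicator (D \<zeta>) w * ?b \<zeta> * f w \<partial>M)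
        = (\<integral>\<^sup>+w. (?b \<zeta> * indicator (D \<zeta>) z) * (f w * indicator (D \<zeta>) w) \<partial>M)"
      by (simp add: mult_ac)
    also have "\<dots> = (?b \<zeta> * indicator (D \<zeta>) z) * mass f (D \<zeta>)"
      using \<zeta> by (subst nn_integral_cmult) auto
    also have "\<dots> = (?b \<zeta> * indicator {\<zeta> \<in> space M. z \<in> D \<zeta>} \<zeta>) * mass f (D \<zeta>)"
      using \<zeta> by (auto simp: indicator_def)
    finally show "(\<integral>\<^sup>+w. indicator (D \<zeta>) z * indicator (D \<zeta>) w * ?b \<zeta> * f w \<partial>M)
        = ?b \<zeta> * mass f (D \<zeta>) * indicator {\<zeta> \<in> space M. z \<in> D \<zeta>} \<zeta>" by (simp add: mult_ac)
  qed
  finally show ?thesis .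
qed

context
  fixes p :: real and \<sigma> :: "'a \<Rightarrow> real" and K :: real
  assumes p: "1 < p" and sigma_measurable [measurable]: "\<sigma> \<in> borel_measurable M"
    and sigma_pos: "AE x in M. 0 < \<sigma> x" and K: "0 < K"
    and Bp: "\<And>x t. x \<in> space M \<Longrightarrow> r x \<le> t \<Longrightarrow>
      mass (\<lambda>y. ennreal (\<sigma> y)) (Q x t) *
      ennreal_powr (mass (\<lambda>y. ennreal (\<sigma> y powr (1 - p / (p - 1)))) (Q x t)) (p - 1)
        \<le> ennreal (K * t powr (real N * p))"
begin

private abbreviation "s \<equiv> (\<lambda>y. ennreal (\<sigma> y))"
private abbreviation "s' \<equiv> (\<lambda>y. ennreal (\<sigma> y powr (1 - p / (p - 1))))"

text \<open>
  Sets of large volume have large mass. Applied to \<open>E x t\<close>, whose volume is comparable to that of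
  the surrounding quasiballs, this turns the \<open>B_p\<close> condition into the doubling property of both the
  weight and its dual.
\<close>

private lemma emeasure_le_masses:
  assumes [measurable]: "A \<in> sets M"
  shows "ennreal_powr (emeasure M A) p \<le> mass s A * ennreal_powr (mass s' A) (p - 1)"
proof -
  have "ennreal_powr (\<integral>\<^sup>+x. 1 * indicator A x \<partial>M) p \<le>
    (\<integral>\<^sup>+x. ennreal_powr 1 p * ennreal (\<sigma> x) * indicator A x \<partial>M) * ennreal_powr (mass s' A) (p - 1)"
    by (intro weighted_Holder p sigma_pos) auto
  then show ?thesis by simp
qed

private lemma one_le_constant:
  assumes "x \<in> space M" "r x \<le> t" "t \<le> 1"
  shows "1 \<le> ennreal (1 / (c powr p * t powr (real N * p))) * (mass s (E x t) * ennreal_powr (mass s' (E x t)) (p - 1))"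
proof -
  have t: "0 < t" using assms r_pos[of x] by simp
  have "ennreal_powr (ennreal (c * t ^ N)) p \<le> ennreal_powr (emeasure M (E x t)) p"
    using assms p by (intro ennreal_powr_mono emeasure_E_ge) auto
  also have "\<dots> \<le> mass s (E x t) * ennreal_powr (mass s' (E x t)) (p - 1)"
    using assms by (intro emeasure_le_masses) auto
  finally have le: "ennreal (c powr p * t powr (real N * p)) \<le> mass s (E x t) * ennreal_powr (mass s' (E x t)) (p - 1)"
    using t c_pos by (simp add: ennreal_powr_ennreal powr_mult powr_realpow[symmetric] powr_powr)
  have "1 = ennreal (1 / (c powr p * t powr (real N * p))) * ennreal (c powr p * t powr (real N * p))"
    using t c_pos by (simp add: ennreal_mult[symmetric])
  also have "\<dots> \<le> ennreal (1 / (c powr p * t powr (real N * p))) * (mass s (E x t) * ennreal_powr (mass s' (E x t)) (p - 1))"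
    by (intro mult_left_mono le) auto
  finally show ?thesis .
qed

private lemma constant_bound:
  assumes "0 < t"
  shows "ennreal (1 / (c powr p * t powr (real N * p))) * ennreal (K * (1098 * t) powr (real N * p))
    = ennreal (K * 1098 powr (real N * p) / c powr p)"
  using assms c_pos K by (simp add: ennreal_mult[symmetric] powr_mult field_simps)

lemma mass_sigma_doubling:
  assumes x: "x \<in> space M" "r x \<le> t" "t \<le> 1"
  shows "mass s (Q x (1098 * t)) \<le> ennreal (K * 1098 powr (real N * p) / c powr p) * mass s (E x t)"
proof -
  have t: "0 < t" using x r_pos[of x] by simp
  let ?k = "ennreal (1 / (c powr p * t powr (real N * p)))"
  have "mass s (Q x (1098 * t)) * 1
      \<le> mass s (Q x (1098 * t)) * (?k * (mass s (E x t) * ennreal_powr (mass s' (E x t)) (p - 1)))"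
    by (intro mult_left_mono one_le_constant x) auto
  also have "\<dots> \<le> mass s (Q x (1098 * t)) * (?k * (mass s (E x t) * ennreal_powr (mass s' (Q x (1098 * t))) (p - 1)))"
    using t p by (intro mult_left_mono ennreal_powr_mono mass_mono E_subset_Q) auto
  also have "\<dots> = ?k * mass s (E x t) * (mass s (Q x (1098 * t)) * ennreal_powr (mass s' (Q x (1098 * t))) (p - 1))"
    by (simp add: mult_ac)
  also have "\<dots> \<le> ?k * mass s (E x t) * ennreal (K * (1098 * t) powr (real N * p))"
    using x t by (intro mult_left_mono Bp) auto
  also have "\<dots> = (?k * ennreal (K * (1098 * t) powr (real N * p))) * mass s (E x t)"
    by (simp only: mult_ac)
  finally show ?thesis unfolding constant_bound[OF t] by simp
qed

lemma mass_dual_doubling: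
  assumes x: "x \<in> space M" "r x \<le> t" "t \<le> 1"
  shows "mass s' (Q x (1098 * t))
    \<le> ennreal ((K * 1098 powr (real N * p) / c powr p) powr (1 / (p - 1))) * mass s' (E x t)"
proof -
  have t: "0 < t" using x r_pos[of x] by simp
  let ?k = "ennreal (1 / (c powr p * t powr (real N * p)))"
  let ?X = "ennreal_powr (mass s' (Q x (1098 * t))) (p - 1)"
  have "?X * 1 \<le> ?X * (?k * (mass s (E x t) * ennreal_powr (mass s' (E x t)) (p - 1)))"
    by (intro mult_left_mono one_le_constant x) auto
  also have "\<dots> \<le> ?X * (?k * (mass s (Q x (1098 * t)) * ennreal_powr (mass s' (E x t)) (p - 1)))"
    using t p by (intro mult_left_mono mult_right_mono mass_mono E_subset_Q) auto
  also have "\<dots> = ?k * ennreal_powr (mass s' (E x t)) (p - 1) * (mass s (Q x (1098 * t)) * ?X)"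
    by (simp add: mult_ac)
  also have "\<dots> \<le> ?k * ennreal_powr (mass s' (E x t)) (p - 1) * ennreal (K * (1098 * t) powr (real N * p))"
    using x t by (intro mult_left_mono Bp) auto
  also have "\<dots> = (?k * ennreal (K * (1098 * t) powr (real N * p))) * ennreal_powr (mass s' (E x t)) (p - 1)"
    by (simp only: mult_ac)
  finally have "?X \<le> ennreal (K * 1098 powr (real N * p) / c powr p) * ennreal_powr (mass s' (E x t)) (p - 1)"
    unfolding constant_bound[OF t] by simp
  then have "ennreal_powr ?X (1 / (p - 1))
      \<le> ennreal_powr (ennreal (K * 1098 powr (real N * p) / c powr p) * ennreal_powr (mass s' (E x t)) (p - 1)) (1 / (p - 1))"
    using p by (intro ennreal_powr_mono) auto
  then show ?thesis
    using p K by (simp add: ennreal_powr_mult ennreal_powr_inverse ennreal_powr_ennreal)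
qed

text \<open>
  Two applications of Hoelder's inequality, with \<open>F \<zeta>\<close> the integral of \<open>f\<close> over \<open>D \<zeta>\<close>. The first, in
  the variable \<open>\<zeta>\<close>, has the test function \<open>r powr ((N + a) * (p - 1))\<close> and is paid for by the decay of
  the weight; the second, inside \<open>D \<zeta>\<close>, has the test function \<open>r powr b\<close> and is paid for by the decay
  of the dual weight. The resulting product of the two masses of \<open>D \<zeta>\<close> is bounded by the \<open>B_p\<close>
  condition, and what is left is integrated over \<open>\<zeta>\<close> by \<open>tent_integral_le\<close>.
\<close>

lemma bergman_strong_bound:
  obtains B where "0 < B" and "\<And>f. f \<in> borel_measurable M \<Longrightarrow>
    (\<integral>\<^sup>+z. ennreal_powr (bergman f z) p * s z \<partial>M) \<le> ennreal B * (\<integral>\<^sup>+z. ennreal_powr (f z) p * s z \<partial>M)"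
proof -
  have Kpos: "0 \<le> K * 1098 powr (real N * p) / c powr p" using K by simp
  obtain \<delta>1 where \<delta>1: "0 < \<delta>1" "\<And>x t. x \<in> space M \<Longrightarrow> r x \<le> t \<Longrightarrow> t \<le> 1 \<Longrightarrow>
      (\<integral>\<^sup>+y. s y * ennreal (r y powr (- \<delta>1)) * indicator (Q x (96 * t)) y \<partial>M)
        \<le> ennreal (3 * t powr (- \<delta>1)) * mass s (Q x (96 * t))"
    by (rule exists_decay[OF _ Kpos mass_sigma_doubling]) auto
  obtain \<delta>2 where \<delta>2: "0 < \<delta>2" "\<And>x t. x \<in> space M \<Longrightarrow> r x \<le> t \<Longrightarrow> t \<le> 1 \<Longrightarrow>
      (\<integral>\<^sup>+y. s' y * ennreal (r y powr (- \<delta>2)) * indicator (Q x (96 * t)) y \<partial>M)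
        \<le> ennreal (3 * t powr (- \<delta>2)) * mass s' (Q x (96 * t))"
    by (rule exists_decay[OF _ _ mass_dual_doubling]) auto
  define a where "a = \<delta>1 / (p - 1)"
  have a: "0 < a" "a * (p - 1) = \<delta>1" using p \<delta>1 by (auto simp: a_def)
  define b where "b = \<delta>2 * (p - 1)"
  have b: "0 < b" using p \<delta>2 by (auto simp: b_def)
  obtain K1 where K1: "0 < K1" "\<And>w. w \<in> space M \<Longrightarrow>
      (\<integral>\<^sup>+\<zeta>. indicator (D \<zeta>) w * ennreal (r \<zeta> powr (- real N - a)) \<partial>M) \<le> ennreal (K1 * r w powr (- a))"
    using tent_integral_le[OF a(1)] by blast
  obtain K2 where K2: "0 < K2" "\<And>w. w \<in> space M \<Longrightarrow>
      (\<integral>\<^sup>+\<zeta>. indicator (D \<zeta>) w * ennreal (r \<zeta> powr (- real N - b)) \<partial>M) \<le> ennreal (K2 * r w powr (- b))"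
    using tent_integral_le[OF b] by blast
  define A1 where "A1 = (1 / c) powr p * K1 powr (p - 1)"
  define A2 where "A2 = 3 * (3 powr (p - 1) * (K * 96 powr (real N * p)))"
  have A12: "0 < A1" "0 < A2" using c_pos K1 K by (auto simp: A1_def A2_def)
  show thesis
  proof (rule that)
    show "0 < A1 * A2 * K2" using A12 K2 by simp
    fix f :: "'a \<Rightarrow> ennreal" assume [measurable]: "f \<in> borel_measurable M"
    define F where "F \<zeta> = mass f (D \<zeta>)" for \<zeta>
    have [measurable]: "F \<in> borel_measurable M" unfolding F_def by measurable
    define G where "G \<zeta> = ennreal_powr (F \<zeta>) p * ennreal (r \<zeta> powr (- real N * (p + 1) + \<delta>1))" for \<zeta>
    have [measurable]: "G \<in> borel_measurable M" unfolding G_def by measurable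

    \<comment> \<open>The exponent of \<open>W\<close> makes the dual factor exactly the integral in \<open>tent_integral_le\<close>.\<close>
    have pointwise: "ennreal_powr (bergman f z) p \<le>
        ennreal A1 * ennreal (r z powr (- \<delta>1)) * (\<integral>\<^sup>+\<zeta>. G \<zeta> * indicator (D \<zeta>) z \<partial>M)"
      if z: "z \<in> space M" for z
    proof -
      define Z where "Z = {\<zeta> \<in> space M. z \<in> D \<zeta>}"
      have [measurable]: "Z \<in> sets M" unfolding Z_def using z by simp
      define W where "W \<zeta> = r \<zeta> powr ((real N + a) * (p - 1))" for \<zeta>
      have [measurable]: "W \<in> borel_measurable M" unfolding W_def by measurable
      have Z: "indicator Z \<zeta> = (indicator (D \<zeta>) z :: ennreal)" if "\<zeta> \<in> space M" for \<zeta>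
        using that by (auto simp: Z_def indicator_def)
      let ?I = "\<integral>\<^sup>+\<zeta>. ennreal (r \<zeta> powr (- 2 * real N)) * F \<zeta> * indicator Z \<zeta> \<partial>M"
      have "bergman f z \<le> ennreal (1 / c) * ?I"
        using bergman_le_tent_average[OF _ z, of f] by (simp add: F_def Z_def)
      then have "ennreal_powr (bergman f z) p \<le> ennreal_powr (ennreal (1 / c) * ?I) p"
        using p by (intro ennreal_powr_mono) auto
      also have "\<dots> = ennreal ((1 / c) powr p) * ennreal_powr ?I p"
        using p c_pos by (simp add: ennreal_powr_mult ennreal_powr_ennreal)
      also have "ennreal_powr ?I p \<le>
          (\<integral>\<^sup>+\<zeta>. ennreal_powr (ennreal (r \<zeta> powr (- 2 * real N)) * F \<zeta>) p * ennreal (W \<zeta>) * indicator Z \<zeta> \<partial>M) *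
          ennreal_powr (\<integral>\<^sup>+\<zeta>. ennreal (W \<zeta> powr (1 - p / (p - 1))) * indicator Z \<zeta> \<partial>M) (p - 1)"
      proof (rule weighted_Holder[OF p])
        show "AE \<zeta> in M. 0 < W \<zeta>" using r_pos by (intro AE_I2) (auto simp: W_def less_le)
      qed measurable
      also have "(\<integral>\<^sup>+\<zeta>. ennreal_powr (ennreal (r \<zeta> powr (- 2 * real N)) * F \<zeta>) p * ennreal (W \<zeta>) * indicator Z \<zeta> \<partial>M)
          = (\<integral>\<^sup>+\<zeta>. G \<zeta> * indicator (D \<zeta>) z \<partial>M)"
      proof (intro nn_integral_cong)
        fix \<zeta> assume \<zeta>: "\<zeta> \<in> space M"
        note rz = r_pos[OF \<zeta>]
        have e: "- 2 * real N * p + (real N + a) * (p - 1) = - real N * (p + 1) + \<delta>1"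
          using a by (simp add: algebra_simps)
        have "ennreal_powr (ennreal (r \<zeta> powr (- 2 * real N)) * F \<zeta>) p * ennreal (W \<zeta>)
            = ennreal_powr (F \<zeta>) p * (ennreal (r \<zeta> powr (- 2 * real N * p)) * ennreal (W \<zeta>))"
          using rz p by (simp only: ennreal_powr_mult ennreal_powr_real_power mult_ac)
        also have "ennreal (r \<zeta> powr (- 2 * real N * p)) * ennreal (W \<zeta>)
            = ennreal (r \<zeta> powr (- real N * (p + 1) + \<delta>1))"
          using e by (simp add: W_def ennreal_mult[symmetric] powr_add[symmetric])
        finally show "ennreal_powr (ennreal (r \<zeta> powr (- 2 * real N)) * F \<zeta>) p * ennreal (W \<zeta>) * indicator Z \<zeta>
            = G \<zeta> * indicator (D \<zeta>) z" by (simp only: G_def Z[OF \<zeta>])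
      qed
      also have "(\<integral>\<^sup>+\<zeta>. ennreal (W \<zeta> powr (1 - p / (p - 1))) * indicator Z \<zeta> \<partial>M)
          = (\<integral>\<^sup>+\<zeta>. indicator (D \<zeta>) z * ennreal (r \<zeta> powr (- real N - a)) \<partial>M)"
      proof (intro nn_integral_cong)
        fix \<zeta> assume \<zeta>: "\<zeta> \<in> space M"
        have "(real N + a) * (p - 1) * (1 - p / (p - 1)) = - real N - a"
          using p by (simp add: field_simps)
        then show "ennreal (W \<zeta> powr (1 - p / (p - 1))) * indicator Z \<zeta>
            = indicator (D \<zeta>) z * ennreal (r \<zeta> powr (- real N - a))"
          by (simp only: W_def powr_powr Z[OF \<zeta>] mult.commute)
      qed
      also have "ennreal_powr \<dots> (p - 1) \<le> ennreal_powr (ennreal (K1 * r z powr (- a))) (p - 1)"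
        using p by (intro ennreal_powr_mono K1 z) auto
      also have "\<dots> = ennreal (K1 powr (p - 1) * r z powr (- \<delta>1))"
        using K1 a by (simp add: ennreal_powr_ennreal powr_mult powr_powr)
      finally have "ennreal_powr (bergman f z) p \<le> ennreal ((1 / c) powr p) *
          ((\<integral>\<^sup>+\<zeta>. G \<zeta> * indicator (D \<zeta>) z \<partial>M) * ennreal (K1 powr (p - 1) * r z powr (- \<delta>1)))"
        by (simp add: mult_left_mono)
      then show ?thesis
        by (simp add: A1_def ennreal_mult mult_ac)
    qed

    \<comment> \<open>Here \<open>b = \<delta>2 * (p - 1)\<close> makes the dual factor the decaying integral of the dual weight.\<close>
    have F_bound: "ennreal_powr (F \<zeta>) p * mass s (D \<zeta>) \<le>
        ennreal (3 powr (p - 1) * (K * 96 powr (real N * p))) * ennreal (r \<zeta> powr (real N * p - b)) *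
        (\<integral>\<^sup>+w. ennreal_powr (f w) p * s w * ennreal (r w powr b) * indicator (D \<zeta>) w \<partial>M)"
      (is "_ \<le> _ * _ * ?J") if \<zeta>: "\<zeta> \<in> space M" for \<zeta>
    proof -
      note rz = r_pos[OF \<zeta>]
      define W where "W w = \<sigma> w * r w powr b" for w
      have [measurable]: "W \<in> borel_measurable M" unfolding W_def by measurable
      have "ennreal_powr (F \<zeta>) p \<le>
          (\<integral>\<^sup>+w. ennreal_powr (f w) p * ennreal (W w) * indicator (D \<zeta>) w \<partial>M) *
          ennreal_powr (\<integral>\<^sup>+w. ennreal (W w powr (1 - p / (p - 1))) * indicator (D \<zeta>) w \<partial>M) (p - 1)"
        unfolding F_def
      proof (rule weighted_Holder[OF p])
        show "AE w in M. 0 < W w"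
          using sigma_pos AE_space by eventually_elim (use r_pos in \<open>auto simp: W_def less_le\<close>)
      qed (use \<zeta> in measurable)
      also have "(\<integral>\<^sup>+w. ennreal_powr (f w) p * ennreal (W w) * indicator (D \<zeta>) w \<partial>M) = ?J"
        by (simp add: W_def ennreal_mult'' mult_ac)
      also have "(\<integral>\<^sup>+w. ennreal (W w powr (1 - p / (p - 1))) * indicator (D \<zeta>) w \<partial>M)
          = (\<integral>\<^sup>+w. s' w * ennreal (r w powr (- \<delta>2)) * indicator (Q \<zeta> (96 * r \<zeta>)) w \<partial>M)"
      proof (rule nn_integral_cong_AE, use sigma_pos AE_space in eventually_elim)
        fix w assume w: "0 < \<sigma> w" "w \<in> space M"
        have "b * (1 - p / (p - 1)) = - \<delta>2" using p by (simp add: b_def field_simps)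
        then have "W w powr (1 - p / (p - 1)) = \<sigma> w powr (1 - p / (p - 1)) * r w powr (- \<delta>2)"
          using w by (simp only: W_def) (simp add: powr_mult powr_powr)
        then show "ennreal (W w powr (1 - p / (p - 1))) * indicator (D \<zeta>) w
            = s' w * ennreal (r w powr (- \<delta>2)) * indicator (Q \<zeta> (96 * r \<zeta>)) w"
          by (simp add: ennreal_mult D_def)
      qed
      also have "ennreal_powr \<dots> (p - 1) \<le> ennreal_powr (ennreal (3 * r \<zeta> powr (- \<delta>2)) * mass s' (D \<zeta>)) (p - 1)"
        using p \<delta>2(2)[of \<zeta> "r \<zeta>"] \<zeta> r_le_1[OF \<zeta>] by (intro ennreal_powr_mono) (auto simp: D_def)
      also have "\<dots> = ennreal (3 powr (p - 1) * r \<zeta> powr (- b)) * ennreal_powr (mass s' (D \<zeta>)) (p - 1)"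
        using p by (simp add: ennreal_powr_mult ennreal_powr_ennreal powr_mult powr_powr b_def)
      finally have "ennreal_powr (F \<zeta>) p * mass s (D \<zeta>)
          \<le> ?J * (ennreal (3 powr (p - 1) * r \<zeta> powr (- b)) * ennreal_powr (mass s' (D \<zeta>)) (p - 1)) * mass s (D \<zeta>)"
        by (simp add: mult_left_mono mult_right_mono)
      also have "\<dots> = ?J * ennreal (3 powr (p - 1) * r \<zeta> powr (- b)) *
          (mass s (D \<zeta>) * ennreal_powr (mass s' (D \<zeta>)) (p - 1))" by (simp only: mult_ac)
      also have "\<dots> \<le> ?J * ennreal (3 powr (p - 1) * r \<zeta> powr (- b)) * ennreal (K * (96 * r \<zeta>) powr (real N * p))"
        unfolding D_def using \<zeta> rz by (intro mult_left_mono Bp) auto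
      also have "\<dots> = ?J * ennreal (3 powr (p - 1) * r \<zeta> powr (- b) * (K * (96 * r \<zeta>) powr (real N * p)))"
        using K by (simp add: ennreal_mult mult.assoc)
      also have "3 powr (p - 1) * r \<zeta> powr (- b) * (K * (96 * r \<zeta>) powr (real N * p))
          = (3 powr (p - 1) * (K * 96 powr (real N * p))) * r \<zeta> powr (real N * p - b)"
      proof -
        have "r \<zeta> powr (- b) * r \<zeta> powr (real N * p) = r \<zeta> powr (real N * p - b)"
          by (simp add: powr_add[symmetric])
        then show ?thesis using rz by (simp add: powr_mult mult_ac)
      qed
      finally show ?thesis using K by (simp add: ennreal_mult mult_ac)
    qed

    have "(\<integral>\<^sup>+z. ennreal_powr (bergman f z) p * s z \<partial>M)
        \<le> (\<integral>\<^sup>+z. ennreal A1 * (\<integral>\<^sup>+\<zeta>. G \<zeta> * (s z * ennreal (r z powr (- \<delta>1)) * indicator (D \<zeta>) z) \<partial>M) \<partial>M)"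
    proof (intro nn_integral_mono)
      fix z assume z: "z \<in> space M"
      have "ennreal_powr (bergman f z) p * s z \<le>
          (ennreal A1 * ennreal (r z powr (- \<delta>1)) * (\<integral>\<^sup>+\<zeta>. G \<zeta> * indicator (D \<zeta>) z \<partial>M)) * s z"
        by (intro mult_right_mono pointwise z) auto
      also have "\<dots> = ennreal A1 * ((s z * ennreal (r z powr (- \<delta>1))) * (\<integral>\<^sup>+\<zeta>. G \<zeta> * indicator (D \<zeta>) z \<partial>M))"
        by (simp only: mult_ac)
      also have "(s z * ennreal (r z powr (- \<delta>1))) * (\<integral>\<^sup>+\<zeta>. G \<zeta> * indicator (D \<zeta>) z \<partial>M)
          = (\<integral>\<^sup>+\<zeta>. G \<zeta> * (s z * ennreal (r z powr (- \<delta>1)) * indicator (D \<zeta>) z) \<partial>M)"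
        using z by (subst nn_integral_cmult[symmetric]) (auto simp: mult_ac)
      finally show "ennreal_powr (bergman f z) p * s z \<le>
        ennreal A1 * (\<integral>\<^sup>+\<zeta>. G \<zeta> * (s z * ennreal (r z powr (- \<delta>1)) * indicator (D \<zeta>) z) \<partial>M)" .
    qed
    also have "\<dots> = ennreal A1 * (\<integral>\<^sup>+z. \<integral>\<^sup>+\<zeta>. G \<zeta> * (s z * ennreal (r z powr (- \<delta>1)) * indicator (D \<zeta>) z) \<partial>M \<partial>M)"
      by (subst nn_integral_cmult) auto
    also have "(\<integral>\<^sup>+z. \<integral>\<^sup>+\<zeta>. G \<zeta> * (s z * ennreal (r z powr (- \<delta>1)) * indicator (D \<zeta>) z) \<partial>M \<partial>M)
        = (\<integral>\<^sup>+\<zeta>. \<integral>\<^sup>+z. G \<zeta> * (s z * ennreal (r z powr (- \<delta>1)) * indicator (D \<zeta>) z) \<partial>M \<partial>M)"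
      by (rule nn_integral_swap) auto
    also have "\<dots> \<le> (\<integral>\<^sup>+\<zeta>. ennreal A2 * (\<integral>\<^sup>+w. ennreal (r \<zeta> powr (- real N - b)) *
        (ennreal_powr (f w) p * s w * ennreal (r w powr b) * indicator (D \<zeta>) w) \<partial>M) \<partial>M)"
    proof (intro nn_integral_mono)
      fix \<zeta> assume \<zeta>: "\<zeta> \<in> space M"
      note rz = r_pos[OF \<zeta>]
      let ?J = "\<integral>\<^sup>+w. ennreal_powr (f w) p * s w * ennreal (r w powr b) * indicator (D \<zeta>) w \<partial>M"
      have "(\<integral>\<^sup>+z. G \<zeta> * (s z * ennreal (r z powr (- \<delta>1)) * indicator (D \<zeta>) z) \<partial>M)
          = G \<zeta> * (\<integral>\<^sup>+z. s z * ennreal (r z powr (- \<delta>1)) * indicator (D \<zeta>) z \<partial>M)"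
        using \<zeta> by (subst nn_integral_cmult) auto
      also have "\<dots> \<le> G \<zeta> * (ennreal (3 * r \<zeta> powr (- \<delta>1)) * mass s (D \<zeta>))"
        unfolding D_def using \<zeta> r_le_1[OF \<zeta>] by (intro mult_left_mono \<delta>1) auto
      also have "\<dots> = ennreal (r \<zeta> powr (- real N * (p + 1) + \<delta>1)) * ennreal (3 * r \<zeta> powr (- \<delta>1)) *
          (ennreal_powr (F \<zeta>) p * mass s (D \<zeta>))"
        by (simp only: G_def mult_ac)
      also have "ennreal (r \<zeta> powr (- real N * (p + 1) + \<delta>1)) * ennreal (3 * r \<zeta> powr (- \<delta>1))
          = ennreal (3 * r \<zeta> powr (- real N * (p + 1)))"
      proof -
        have "r \<zeta> powr (- real N * (p + 1) + \<delta>1) * r \<zeta> powr (- \<delta>1) = r \<zeta> powr (- real N * (p + 1))"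
          by (simp only: powr_add[symmetric]) simp
        then show ?thesis by (subst ennreal_mult[symmetric]) (auto simp: mult_ac)
      qed
      also have "\<dots> * (ennreal_powr (F \<zeta>) p * mass s (D \<zeta>)) \<le> \<dots> *
          (ennreal (3 powr (p - 1) * (K * 96 powr (real N * p))) * ennreal (r \<zeta> powr (real N * p - b)) * ?J)"
        by (intro mult_left_mono F_bound \<zeta>) auto
      also have "\<dots> = ennreal (3 * r \<zeta> powr (- real N * (p + 1)) *
          ((3 powr (p - 1) * (K * 96 powr (real N * p))) * r \<zeta> powr (real N * p - b))) * ?J"
        using K by (simp add: ennreal_mult mult.assoc)
      also have "3 * r \<zeta> powr (- real N * (p + 1)) *
          ((3 powr (p - 1) * (K * 96 powr (real N * p))) * r \<zeta> powr (real N * p - b))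
          = A2 * r \<zeta> powr (- real N - b)"
      proof -
        have "r \<zeta> powr (- real N * (p + 1)) * r \<zeta> powr (real N * p - b) = r \<zeta> powr (- real N - b)"
          by (subst powr_add[symmetric], rule arg_cong[where f="\<lambda>e. r \<zeta> powr e"])
            (simp add: algebra_simps)
        then show ?thesis by (simp add: A2_def)
      qed
      also have "ennreal (A2 * r \<zeta> powr (- real N - b)) * ?J = ennreal A2 * (ennreal (r \<zeta> powr (- real N - b)) * ?J)"
        using A12 by (simp add: ennreal_mult mult.assoc)
      also have "ennreal (r \<zeta> powr (- real N - b)) * ?J = (\<integral>\<^sup>+w. ennreal (r \<zeta> powr (- real N - b)) *
          (ennreal_powr (f w) p * s w * ennreal (r w powr b) * indicator (D \<zeta>) w) \<partial>M)"
        using \<zeta> by (subst nn_integral_cmult) auto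
      finally show "(\<integral>\<^sup>+z. G \<zeta> * (s z * ennreal (r z powr (- \<delta>1)) * indicator (D \<zeta>) z) \<partial>M) \<le>
        ennreal A2 * (\<integral>\<^sup>+w. ennreal (r \<zeta> powr (- real N - b)) *
          (ennreal_powr (f w) p * s w * ennreal (r w powr b) * indicator (D \<zeta>) w) \<partial>M)" .
    qed
    also have "\<dots> = ennreal A2 * (\<integral>\<^sup>+\<zeta>. \<integral>\<^sup>+w. ennreal (r \<zeta> powr (- real N - b)) *
          (ennreal_powr (f w) p * s w * ennreal (r w powr b) * indicator (D \<zeta>) w) \<partial>M \<partial>M)"
      by (subst nn_integral_cmult) auto
    also have "(\<integral>\<^sup>+\<zeta>. \<integral>\<^sup>+w. ennreal (r \<zeta> powr (- real N - b)) *
          (ennreal_powr (f w) p * s w * ennreal (r w powr b) * indicator (D \<zeta>) w) \<partial>M \<partial>M)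
        = (\<integral>\<^sup>+w. \<integral>\<^sup>+\<zeta>. ennreal (r \<zeta> powr (- real N - b)) *
          (ennreal_powr (f w) p * s w * ennreal (r w powr b) * indicator (D \<zeta>) w) \<partial>M \<partial>M)"
      by (rule nn_integral_swap) auto
    also have "\<dots> \<le> (\<integral>\<^sup>+w. ennreal K2 * (ennreal_powr (f w) p * s w) \<partial>M)"
    proof (intro nn_integral_mono)
      fix w assume w: "w \<in> space M"
      note rw = r_pos[OF w]
      have "(\<integral>\<^sup>+\<zeta>. ennreal (r \<zeta> powr (- real N - b)) *
          (ennreal_powr (f w) p * s w * ennreal (r w powr b) * indicator (D \<zeta>) w) \<partial>M)
        = (ennreal_powr (f w) p * s w * ennreal (r w powr b)) *
          (\<integral>\<^sup>+\<zeta>. indicator (D \<zeta>) w * ennreal (r \<zeta> powr (- real N - b)) \<partial>M)"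
        using w by (subst nn_integral_cmult[symmetric]) (auto simp: mult_ac)
      also have "\<dots> \<le> (ennreal_powr (f w) p * s w * ennreal (r w powr b)) * ennreal (K2 * r w powr (- b))"
        by (intro mult_left_mono K2 w) auto
      also have "\<dots> = (ennreal (r w powr b) * ennreal (K2 * r w powr (- b))) * (ennreal_powr (f w) p * s w)"
        by (simp only: mult_ac)
      also have "ennreal (r w powr b) * ennreal (K2 * r w powr (- b)) = ennreal K2"
        using rw K2 by (subst ennreal_mult[symmetric]) (auto simp: powr_minus)
      finally show "(\<integral>\<^sup>+\<zeta>. ennreal (r \<zeta> powr (- real N - b)) *
          (ennreal_powr (f w) p * s w * ennreal (r w powr b) * indicator (D \<zeta>) w) \<partial>M)
        \<le> ennreal K2 * (ennreal_powr (f w) p * s w)" .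
    qed
    also have "\<dots> = ennreal K2 * (\<integral>\<^sup>+w. ennreal_powr (f w) p * s w \<partial>M)"
      by (subst nn_integral_cmult) auto
    finally have "(\<integral>\<^sup>+z. ennreal_powr (bergman f z) p * s z \<partial>M) \<le>
        ennreal A1 * (ennreal A2 * (ennreal K2 * (\<integral>\<^sup>+w. ennreal_powr (f w) p * s w \<partial>M)))"
      by (simp add: mult_left_mono)
    then show "(\<integral>\<^sup>+z. ennreal_powr (bergman f z) p * s z \<partial>M) \<le>
        ennreal (A1 * A2 * K2) * (\<integral>\<^sup>+z. ennreal_powr (f z) p * s z \<partial>M)"
      using A12 K2 by (simp add: ennreal_mult mult.assoc)
  qed
qed

end

section \<open>The weak-type inequality\<close>

lemma quasiball_subset:
  assumes "x \<in> space M" "v \<in> space M" and v: "v \<in> Q x a" and "3 * (a + b) \<le> t"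
  shows "Q x b \<subseteq> Q v t"
proof
  fix y assume y: "y \<in> Q x b"
  then have "\<rho> v y \<le> 3 * (\<rho> v x + \<rho> x y)" using assms by (intro rho_triangle) (auto simp: Q_def)
  then show "y \<in> Q v t" using assms y rho_sym[of x v] by (auto simp: Q_def)
qed

text \<open>
  Quasiballs are open and the topology has a countable base, hence arbitrary unions of quasiballs
  are measurable.
\<close>

lemma UN_Q_countable:
  assumes "I \<subseteq> space M \<times> UNIV"
  obtains J where "countable J" "J \<subseteq> I" "(\<Union>(x,t)\<in>J. Q x t) = (\<Union>(x,t)\<in>I. Q x t)"
proof -
  have "\<And>S. S \<in> (\<lambda>(x,t). Q x t) ` I \<Longrightarrow> open S"
    using assms open_quasiball by (auto simp: Q_def)
  from Lindelof[OF this] obtain F where F: "F \<subseteq> (\<lambda>(x,t). Q x t) ` I" "countable F" "\<Union>F = (\<Union>(x,t)\<in>I. Q x t)"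
    by metis
  then obtain J where "countable J" "J \<subseteq> I" "F = (\<lambda>(x,t). Q x t) ` J"
    using countable_subset_image[of F "\<lambda>(x,t). Q x t" I] by auto
  then show thesis using F that by auto
qed

lemma sets_UN_Q:
  assumes "I \<subseteq> space M \<times> UNIV"
  shows "(\<Union>(x,t)\<in>I. Q x t) \<in> sets M"
proof -
  obtain J where J: "countable J" "J \<subseteq> I" "(\<Union>(x,t)\<in>J. Q x t) = (\<Union>(x,t)\<in>I. Q x t)"
    using UN_Q_countable[OF assms] .
  have "(\<Union>(x,t)\<in>J. Q x t) \<in> sets M"
    using J assms by (intro sets.countable_UN'') auto
  then show ?thesis using J by simp
qed

text \<open>
  The greedy choice: take a quasiball of largest radius and discard those that meet it. They lie in
  its dilate by \<open>21 = 3 * (1 + 6)\<close>, because a smaller quasiball of radius \<open>t\<close> has quasi-diameter \<open>6 t\<close>.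
\<close>

lemma Vitali_finite:
  assumes "finite I" "I \<subseteq> space M \<times> UNIV"
  obtains J where "J \<subseteq> I" "disjoint_family_on (\<lambda>(x,t). Q x t) J"
    "(\<Union>(x,t)\<in>I. Q x t) \<subseteq> (\<Union>(x,t)\<in>J. Q x (21 * t))"
proof -
  have "\<exists>J. J \<subseteq> I \<and> disjoint_family_on (\<lambda>(x,t). Q x t) J \<and>
    (\<Union>(x,t)\<in>I. Q x t) \<subseteq> (\<Union>(x,t)\<in>J. Q x (21 * t))"
    using assms
  proof (induction I rule: finite_psubset_induct)
    case (psubset I)
    show ?case
    proof (cases "I = {}")
      case True then show ?thesis by (intro exI[of _ "{}"]) (auto simp: disjoint_family_on_def)
    next
      case False
      have "Max (snd ` I) \<in> snd ` I" using psubset False by (intro Max_in) auto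
      then obtain y u where yu: "(y, u) \<in> I" "u = Max (snd ` I)" by auto
      have umax: "t \<le> u" if "(x, t) \<in> I" for x t
        unfolding yu(2) using psubset that by (intro Max_ge) force+
      define I' where "I' = {i \<in> I - {(y, u)}. (case i of (x, t) \<Rightarrow> Q x t) \<inter> Q y u = {}}"
      have "I' \<subset> I" using yu by (auto simp: I'_def)
      then obtain J where J: "J \<subseteq> I'" "disjoint_family_on (\<lambda>(x,t). Q x t) J"
        "(\<Union>(x,t)\<in>I'. Q x t) \<subseteq> (\<Union>(x,t)\<in>J. Q x (21 * t))"
        using psubset.IH[of I'] psubset.prems by auto
      have disj: "disjoint_family_on (\<lambda>(x,t). Q x t) (insert (y, u) J)"
        using J(1,2) by (auto simp: disjoint_family_on_def I'_def)
      have sub: "Q x t \<subseteq> (\<Union>(x,t)\<in>insert (y, u) J. Q x (21 * t))" if xt: "(x, t) \<in> I" for x t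
      proof (cases "(x, t) \<in> I'")
        case True then show ?thesis using J(3) by auto
      next
        case nI: False
        have "Q x t \<subseteq> Q y (21 * u)"
        proof
          fix w assume w: "w \<in> Q x t"
          have sp: "x \<in> space M" "y \<in> space M" "w \<in> space M" using psubset.prems xt yu w by (auto simp: Q_def)
          have u0: "0 < u" using umax[OF xt] w rho_pos[of x w] sp by (auto simp: Q_def)
          show "w \<in> Q y (21 * u)"
          proof (cases "(x, t) = (y, u)")
            case True then show ?thesis using w u0 by (auto simp: Q_def)
          next
            case False
            then obtain v where v: "v \<in> Q x t" "v \<in> Q y u" using nI xt by (auto simp: I'_def)
            then have "v \<in> space M" by (simp add: Q_def)
            then have "\<rho> y w \<le> 3 * (\<rho> y v + \<rho> v w)" "\<rho> v w \<le> 3 * (\<rho> v x + \<rho> x w)"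
              using sp by (blast intro: rho_triangle)+
            then show ?thesis using v w sp umax[OF xt] rho_sym[of x v] by (auto simp: Q_def)
          qed
        qed
        then show ?thesis by auto
      qed
      show ?thesis
      proof (intro exI conjI)
        show "insert (y, u) J \<subseteq> I" using J yu by (auto simp: I'_def)
        show "(\<Union>(x,t)\<in>I. Q x t) \<subseteq> (\<Union>(x,t)\<in>insert (y, u) J. Q x (21 * t))"
          using sub by blast
      qed (rule disj)
    qed
  qed
  then show thesis using that by blast
qed

context
  fixes \<sigma> :: "'a \<Rightarrow> real" and K :: real
  assumes sigma_measurable [measurable]: "\<sigma> \<in> borel_measurable M"
    and sigma_pos: "AE x in M. 0 < \<sigma> x" and K: "0 < K"
    and B1: "AE v in M. \<forall>t\<ge>r v. (\<integral>\<^sup>+y. ennreal (\<sigma> y) * indicator (Q v t) y \<partial>M) \<le> ennreal (K * t ^ N * \<sigma> v)"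
begin

private abbreviation "ws \<equiv> (\<lambda>y. ennreal (\<sigma> y))"

text \<open>
  The \<open>B_1\<close> condition is assumed for quasiballs centred at almost every point \<open>v\<close>, for all radii at
  once; a quasiball that contains \<open>v\<close> lies in one centred at \<open>v\<close>.
\<close>

lemma B1_uncentred:
  assumes x: "x \<in> space M" and "1 \<le> b"
  shows "AE v in M. v \<in> Q x t \<longrightarrow> mass ws (Q x (b * t)) \<le> ennreal (K * (3 * (1 + b) * t) ^ N * \<sigma> v)"
  using B1 AE_space
proof eventually_elim
  fix v assume v: "\<forall>t\<ge>r v. mass ws (Q v t) \<le> ennreal (K * t ^ N * \<sigma> v)" "v \<in> space M"
  show "v \<in> Q x t \<longrightarrow> mass ws (Q x (b * t)) \<le> ennreal (K * (3 * (1 + b) * t) ^ N * \<sigma> v)"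
  proof
    assume vQ: "v \<in> Q x t"
    have rt: "r v \<le> t" "0 < t" using vQ r_le_rho'[of x v] r_pos[of v] v x by (auto simp: Q_def)
    have "1 * t \<le> 3 * (1 + b) * t" using rt assms by (intro mult_right_mono) auto
    then have "r v \<le> 3 * (1 + b) * t" using rt by linarith
    have "mass ws (Q x (b * t)) \<le> mass ws (Q v (3 * (1 + b) * t))"
      using x v vQ by (intro mass_mono quasiball_subset[where a=t]) (auto simp: algebra_simps)
    also have "\<dots> \<le> ennreal (K * (3 * (1 + b) * t) ^ N * \<sigma> v)" using v \<open>r v \<le> 3 * (1 + b) * t\<close> by blast
    finally show "mass ws (Q x (b * t)) \<le> ennreal (K * (3 * (1 + b) * t) ^ N * \<sigma> v)" .
  qed
qed

text \<open>
  The weak-type argument ends with an \<open>L^2\<close> estimate, for which the weight has to be in \<open>B_2\<close>; the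
  exponents are left in the form in which the strong bound expects them.
\<close>

lemma B1_imp_B2:
  assumes x: "x \<in> space M" and t: "r x \<le> t"
  shows "mass ws (Q x t) * ennreal_powr (mass (\<lambda>y. ennreal (\<sigma> y powr (1 - 2 / (2 - 1)))) (Q x t)) (2 - 1)
    \<le> ennreal (K * 6 ^ N * C * t powr (real N * 2))"
proof -
  have t0: "0 < t" using t r_pos[OF x] by simp
  have "mass ws (Q x t) * ennreal_powr (mass (\<lambda>y. ennreal (\<sigma> y powr (1 - 2 / (2 - 1)))) (Q x t)) (2 - 1)
      = (\<integral>\<^sup>+v. mass ws (Q x t) * (ennreal (\<sigma> v powr (- 1)) * indicator (Q x t) v) \<partial>M)"
    using x by (simp add: nn_integral_cmult)
  also have "\<dots> \<le> (\<integral>\<^sup>+v. ennreal (K * (6 * t) ^ N) * indicator (Q x t) v \<partial>M)"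
  proof (rule nn_integral_mono_AE, use B1_uncentred[OF x order_refl, of t] sigma_pos in eventually_elim)
    fix v assume v: "v \<in> Q x t \<longrightarrow> mass ws (Q x (1 * t)) \<le> ennreal (K * (3 * (1 + 1) * t) ^ N * \<sigma> v)" "0 < \<sigma> v"
    show "mass ws (Q x t) * (ennreal (\<sigma> v powr (- 1)) * indicator (Q x t) v)
        \<le> ennreal (K * (6 * t) ^ N) * indicator (Q x t) v"
    proof (cases "v \<in> Q x t")
      case True
      then have "mass ws (Q x t) * ennreal (\<sigma> v powr (- 1))
          \<le> ennreal (K * (6 * t) ^ N * \<sigma> v) * ennreal (\<sigma> v powr (- 1))"
        using v by (intro mult_right_mono) auto
      also have "\<dots> = ennreal (K * (6 * t) ^ N)"
        using v K t0 by (simp add: ennreal_mult[symmetric] powr_minus)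
      finally show ?thesis using True by simp
    qed simp
  qed
  also have "\<dots> = ennreal (K * (6 * t) ^ N) * emeasure M (Q x t)"
    using x by (simp add: nn_integral_cmult_indicator)
  also have "\<dots> \<le> ennreal (K * (6 * t) ^ N) * ennreal (C * t ^ N)"
    using x t0 by (intro mult_left_mono emeasure_Q_le) auto
  also have "\<dots> = ennreal (K * 6 ^ N * C * t powr (real N * 2))"
  proof -
    have "t powr (real N * 2) = t ^ N * t ^ N"
      using t0 by (simp add: powr_realpow[symmetric] powr_add[symmetric] mult.commute)
    then show ?thesis using K C_pos t0
      by (subst ennreal_mult[symmetric]) (auto simp: power_mult_distrib mult_ac)
  qed
  finally show ?thesis .
qed

text \<open>
  On each selected quasiball, the \<open>B_1\<close> condition lets the mass of the dilate be compared with the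
  weight at almost every point of it, so that it can be moved under the integral of \<open>f\<close>. The union of
  all the quasiballs is exhausted by finite unions.
\<close>

lemma maximal_set_weak_bound:
  fixes f :: "'a \<Rightarrow> ennreal" and l :: real
  assumes [measurable]: "f \<in> borel_measurable M" and l: "0 < l"
  defines "I \<equiv> {(x, t). x \<in> space M \<and> 0 < t \<and> ennreal (l * t ^ N) < mass f (Q x t)}"
  shows "mass ws (\<Union>(x,t)\<in>I. Q x t) \<le> ennreal (K * 66 ^ N / l) * (\<integral>\<^sup>+v. f v * ws v \<partial>M)"
proof -
  have I: "I \<subseteq> space M \<times> UNIV" by (auto simp: I_def)
  have single: "mass ws (Q x (21 * t)) \<le> ennreal (K * 66 ^ N / l) * (\<integral>\<^sup>+v. f v * ws v * indicator (Q x t) v \<partial>M)"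
    if "(x, t) \<in> I" for x t
  proof -
    have x: "x \<in> space M" "0 < t" "ennreal (l * t ^ N) \<le> mass f (Q x t)" using that by (auto simp: I_def)
    have [measurable]: "Q x t \<in> sets M" using x by simp
    have "(3 * (1 + 21) * t) = 66 * t" by simp
    with B1_uncentred[OF x(1), of 21 t]
    have enlarged: "AE v in M. v \<in> Q x t \<longrightarrow> mass ws (Q x (21 * t)) \<le> ennreal (K * (66 * t) ^ N * \<sigma> v)"
      by (simp only:)
    have "ennreal (l * t ^ N) * mass ws (Q x (21 * t)) \<le> mass f (Q x t) * mass ws (Q x (21 * t))"
      by (intro mult_right_mono x) auto
    also have "\<dots> = (\<integral>\<^sup>+v. f v * indicator (Q x t) v * mass ws (Q x (21 * t)) \<partial>M)"
      by (subst nn_integral_multc) auto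
    also have "\<dots> \<le> (\<integral>\<^sup>+v. ennreal (K * (66 * t) ^ N) * (f v * ws v * indicator (Q x t) v) \<partial>M)"
    proof (rule nn_integral_mono_AE, use enlarged in eventually_elim)
      fix v assume v: "v \<in> Q x t \<longrightarrow> mass ws (Q x (21 * t)) \<le> ennreal (K * (66 * t) ^ N * \<sigma> v)"
      show "f v * indicator (Q x t) v * mass ws (Q x (21 * t)) \<le> ennreal (K * (66 * t) ^ N) * (f v * ws v * indicator (Q x t) v)"
      proof (cases "v \<in> Q x t")
        case True
        then have "f v * mass ws (Q x (21 * t)) \<le> f v * ennreal (K * (66 * t) ^ N * \<sigma> v)"
          using v by (intro mult_left_mono) auto
        also have "\<dots> = ennreal (K * (66 * t) ^ N) * (f v * ws v)"
          using K x by (subst ennreal_mult') (auto simp: mult_ac)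
        finally show ?thesis using True by simp
      qed simp
    qed
    also have "\<dots> = ennreal (K * (66 * t) ^ N) * (\<integral>\<^sup>+v. f v * ws v * indicator (Q x t) v \<partial>M)"
      by (subst nn_integral_cmult) auto
    finally have "ennreal (1 / (l * t ^ N)) * (ennreal (l * t ^ N) * mass ws (Q x (21 * t)))
        \<le> ennreal (1 / (l * t ^ N)) * (ennreal (K * (66 * t) ^ N) * (\<integral>\<^sup>+v. f v * ws v * indicator (Q x t) v \<partial>M))"
      by (intro mult_left_mono) auto
    also have "\<dots> = (ennreal (1 / (l * t ^ N)) * ennreal (K * (66 * t) ^ N)) * (\<integral>\<^sup>+v. f v * ws v * indicator (Q x t) v \<partial>M)"
      by (simp only: mult.assoc)
    also have "ennreal (1 / (l * t ^ N)) * ennreal (K * (66 * t) ^ N) = ennreal (K * 66 ^ N / l)"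
      using x l K by (subst ennreal_mult[symmetric]) (auto simp: power_mult_distrib)
    also have "ennreal (1 / (l * t ^ N)) * (ennreal (l * t ^ N) * mass ws (Q x (21 * t))) = mass ws (Q x (21 * t))"
      using x l by (simp add: mult.assoc[symmetric] ennreal_mult[symmetric])
    finally show ?thesis .
  qed
  have finite_bound: "mass ws (\<Union>(x,t)\<in>I'. Q x t) \<le> ennreal (K * 66 ^ N / l) * (\<integral>\<^sup>+v. f v * ws v \<partial>M)"
    if "finite I'" "I' \<subseteq> I" for I'
  proof -
    obtain J where J: "J \<subseteq> I'" "disjoint_family_on (\<lambda>(x,t). Q x t) J"
      "(\<Union>(x,t)\<in>I'. Q x t) \<subseteq> (\<Union>(x,t)\<in>J. Q x (21 * t))"
      using Vitali_finite[OF \<open>finite I'\<close> subset_trans[OF \<open>I' \<subseteq> I\<close> I]] .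
    have fin: "finite J" using J that finite_subset by blast
    have "J \<subseteq> space M \<times> UNIV" using J(1) \<open>I' \<subseteq> I\<close> I by (meson order_trans)
    then have JM: "fst i \<in> space M" if "i \<in> J" for i using that by (auto simp: mem_Times_iff)
    then have [measurable]: "i \<in> J \<Longrightarrow> Q (fst i) t \<in> sets M" for i t by simp
    have "mass ws (\<Union>(x,t)\<in>I'. Q x t) \<le> mass ws (\<Union>i\<in>J. Q (fst i) (21 * snd i))"
      using J(3) by (intro mass_mono) (auto simp: split_beta)
    also have "\<dots> \<le> (\<integral>\<^sup>+y. (\<Sum>i\<in>J. ws y * indicator (Q (fst i) (21 * snd i)) y) \<partial>M)"
    proof (intro nn_integral_mono)
      fix y
      show "ws y * indicator (\<Union>i\<in>J. Q (fst i) (21 * snd i)) y \<le> (\<Sum>i\<in>J. ws y * indicator (Q (fst i) (21 * snd i)) y)"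
      proof (cases "y \<in> (\<Union>i\<in>J. Q (fst i) (21 * snd i))")
        case True
        then obtain i where i: "i \<in> J" "y \<in> Q (fst i) (21 * snd i)" by blast
        have "ws y * indicator (Q (fst i) (21 * snd i)) y \<le> (\<Sum>i\<in>J. ws y * indicator (Q (fst i) (21 * snd i)) y)"
          using fin i by (intro member_le_sum) auto
        then show ?thesis using True i by (simp del: sum_mult_indicator)
      qed simp
    qed
    also have "\<dots> = (\<Sum>i\<in>J. mass ws (Q (fst i) (21 * snd i)))"
      by (rule nn_integral_sum) auto
    also have "\<dots> \<le> (\<Sum>i\<in>J. ennreal (K * 66 ^ N / l) * (\<integral>\<^sup>+v. f v * ws v * indicator (Q (fst i) (snd i)) v \<partial>M))"
      using J \<open>I' \<subseteq> I\<close> by (intro sum_mono single) auto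
    also have "\<dots> = ennreal (K * 66 ^ N / l) * (\<integral>\<^sup>+v. (\<Sum>i\<in>J. f v * ws v * indicator (Q (fst i) (snd i)) v) \<partial>M)"
      by (subst nn_integral_sum) (auto simp: sum_distrib_left)
    also have "\<dots> \<le> ennreal (K * 66 ^ N / l) * (\<integral>\<^sup>+v. f v * ws v \<partial>M)"
    proof (intro mult_left_mono nn_integral_mono)
      fix v
      have "(\<Sum>i\<in>J. indicator (Q (fst i) (snd i)) v) = (indicator (\<Union>i\<in>J. Q (fst i) (snd i)) v :: ennreal)"
        by (rule indicator_UN_disjoint[symmetric]) (use fin J(2)[unfolded case_prod_unfold] in auto)
      then have "(\<Sum>i\<in>J. indicator (Q (fst i) (snd i)) v) \<le> (1::ennreal)" by (simp add: indicator_def)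
      then have "f v * ws v * (\<Sum>i\<in>J. indicator (Q (fst i) (snd i)) v) \<le> f v * ws v * 1"
        by (intro mult_left_mono) auto
      then show "(\<Sum>i\<in>J. f v * ws v * indicator (Q (fst i) (snd i)) v) \<le> f v * ws v"
        by (simp only: sum_distrib_left mult_1_right)
    qed auto
    finally show ?thesis .
  qed
  obtain J where J: "countable J" "J \<subseteq> I" "(\<Union>(x,t)\<in>J. Q x t) = (\<Union>(x,t)\<in>I. Q x t)"
    using UN_Q_countable[OF I] .
  show ?thesis
  proof (cases "J = {}")
    case True then show ?thesis using J by simp
  next
    case False
    define A where "A n = (\<Union>(x,t)\<in>from_nat_into J ` {..n}. Q x t)" for n
    have AI: "from_nat_into J ` {..n} \<subseteq> I" for n using from_nat_into[OF False] J by auto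
    have [measurable]: "A n \<in> sets M" for n unfolding A_def using AI I by (intro sets_UN_Q) blast
    have UA: "(\<Union>(x,t)\<in>I. Q x t) = (\<Union>n. A n)"
    proof -
      have "(\<Union>n. A n) = (\<Union>(x,t)\<in>(\<Union>n. from_nat_into J ` {..n}). Q x t)"
        by (simp only: A_def UN_UN_flatten)
      also have "(\<Union>n. from_nat_into J ` {..n}) = range (from_nat_into J)" by auto
      finally have "(\<Union>n. A n) = (\<Union>(x,t)\<in>range (from_nat_into J). Q x t)" .
      then show ?thesis using range_from_nat_into[OF False J(1)] J(3) by simp
    qed
    show ?thesis unfolding UA
    proof (rule nn_integral_le_of_tendsto)
      show "mass ws (A n) \<le> ennreal (K * 66 ^ N / l) * (\<integral>\<^sup>+v. f v * ws v \<partial>M)" for n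
        unfolding A_def by (intro finite_bound AI) auto
      show "AE y in M. (\<lambda>n. ws y * indicator (A n) y) \<longlonglongrightarrow> ws y * indicator (\<Union>n. A n) y"
      proof (intro AE_I2 tendsto_eventually)
        fix y
        show "\<forall>\<^sub>F n in sequentially. ws y * indicator (A n) y = ws y * indicator (\<Union>n. A n) y"
        proof (cases "y \<in> (\<Union>n. A n)")
          case True
          then obtain m where "y \<in> A m" by blast
          moreover have "A m \<subseteq> A n" if "m \<le> n" for n
            unfolding A_def by (intro UN_mono image_mono) (use that in auto)
          ultimately have "y \<in> A n" if "m \<le> n" for n using that by blast
          then show ?thesis using True by (auto simp: eventually_sequentially intro!: exI[of _ m])
        qed auto
      qed
    qed auto
  qed
qed

text \<open>
  \<open>S v\<close> is the distance to the complement of \<open>\<Omega>\<close>, cut off at 1, and \<open>F\<close> is \<open>f\<close> with the mass at \<open>v\<close>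
  spread over \<open>E v (S v)\<close>. That distance is at least \<open>r v\<close>, so \<open>E v (S v)\<close> has its full share of
  volume. Outside \<open>\<Omega>\<close> it is comparable to \<open>r v\<close>, and \<open>F\<close> averages \<open>f\<close> at the scale of the height.
\<close>

lemma bergman_weak_bound:
  obtains B where "0 < B" and "\<And>f l. f \<in> borel_measurable M \<Longrightarrow> 0 < l \<Longrightarrow>
    ennreal l * mass ws {z \<in> space M. ennreal l < bergman f z} \<le> ennreal B * (\<integral>\<^sup>+z. f z * ws z \<partial>M)"
proof -
  have K2: "0 < K * 6 ^ N * C" using K C_pos by simp
  obtain B0 where B0: "0 < B0" "\<And>f. f \<in> borel_measurable M \<Longrightarrow>
    (\<integral>\<^sup>+z. ennreal_powr (bergman f z) 2 * ws z \<partial>M) \<le> ennreal B0 * (\<integral>\<^sup>+z. ennreal_powr (f z) 2 * ws z \<partial>M)"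
    by (rule bergman_strong_bound[OF _ sigma_measurable sigma_pos K2 B1_imp_B2]) auto
  define c1 where "c1 = 21 ^ N / c"
  have c1: "0 < c1" using c_pos by (simp add: c1_def)
  define B where "B = K * 66 ^ N + c1\<^sup>2 * (B0 * (721 ^ N * (K * 6 ^ N)))"
  show thesis
  proof (rule that)
    show "0 < B" using K c1 B0 by (simp add: B_def add_pos_pos)
    fix f :: "'a \<Rightarrow> ennreal" and l :: real
    assume f [measurable]: "f \<in> borel_measurable M" and l: "0 < l"
    define I where "I = {(x, t). x \<in> space M \<and> 0 < t \<and> ennreal (l * t ^ N) < mass f (Q x t)}"
    define \<Omega> where "\<Omega> = (\<Union>(x,t)\<in>I. Q x t)"
    have \<Omega>_bound: "mass ws \<Omega> \<le> ennreal (K * 66 ^ N / l) * (\<integral>\<^sup>+v. f v * ws v \<partial>M)"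
      unfolding \<Omega>_def I_def by (rule maximal_set_weak_bound[OF f l])
    have [measurable]: "\<Omega> \<in> sets M" unfolding \<Omega>_def by (rule sets_UN_Q) (auto simp: I_def)
    show "ennreal l * mass ws {z \<in> space M. ennreal l < bergman f z} \<le> ennreal B * (\<integral>\<^sup>+z. f z * ws z \<partial>M)"
    proof (cases "space M \<subseteq> \<Omega>")
      case True
      have "mass ws {z \<in> space M. ennreal l < bergman f z} \<le> mass ws \<Omega>" using True by (intro mass_mono) auto
      also note \<Omega>_bound
      finally have "ennreal l * mass ws {z \<in> space M. ennreal l < bergman f z} \<le>
          ennreal l * (ennreal (K * 66 ^ N / l) * (\<integral>\<^sup>+v. f v * ws v \<partial>M))"
        by (intro mult_left_mono) auto
      also have "\<dots> = ennreal (K * 66 ^ N) * (\<integral>\<^sup>+v. f v * ws v \<partial>M)"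
        using l K by (simp add: mult.assoc[symmetric] ennreal_mult[symmetric])
      also have "\<dots> \<le> ennreal B * (\<integral>\<^sup>+v. f v * ws v \<partial>M)"
        using K B0 by (intro mult_right_mono ennreal_leI) (auto simp: B_def)
      finally show ?thesis .
    next
      case False
      define d where "d v = (INF u\<in>space M - \<Omega>. \<rho> v u)" for v
      define S where "S v = min 1 (d v)" for v
      have ne: "space M - \<Omega> \<noteq> {}" using False by blast
      have bdd: "bdd_below ((\<lambda>u. \<rho> v u) ` (space M - \<Omega>))" if "v \<in> space M" for v
        using r_le_rho[OF that] by (auto intro!: bdd_belowI[of _ "r v"])
      have d_less: "d v < a \<longleftrightarrow> (\<exists>u\<in>space M - \<Omega>. \<rho> v u < a)" if "v \<in> space M" for v a
        unfolding d_def using cINF_less_iff[OF ne bdd[OF that]] .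
      have d_le: "d v \<le> \<rho> v u" if "v \<in> space M" "u \<in> space M - \<Omega>" for v u
        unfolding d_def using that by (intro cINF_lower bdd) auto
      have r_le_d: "r v \<le> d v" if "v \<in> space M" for v
        unfolding d_def using ne that by (intro cINF_greatest r_le_rho) auto
      have d_le_2: "d v \<le> 2" if "v \<in> space M" for v
        using ne d_le[OF that] rho_le_2[OF that] by (metis DiffE all_not_in_conv order_trans)
      have [measurable]: "d \<in> borel_measurable M"
      proof (rule borel_measurableI_less)
        fix a
        have "{v \<in> space M. d v < a} = (\<Union>(u,t)\<in>(space M - \<Omega>) \<times> {a}. Q u t)"
          using d_less rho_sym by (auto simp: Q_def)
        moreover have "\<dots> \<in> sets M" by (rule sets_UN_Q) auto
        ultimately show "{v \<in> space M. d v < a} \<in> sets M" by simp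
      qed
      have [measurable]: "S \<in> borel_measurable M" unfolding S_def by measurable
      have S: "r v \<le> S v" "S v \<le> 1" "S v \<le> d v" "d v \<le> 2 * S v" "0 < S v" if "v \<in> space M" for v
        using r_le_d[OF that] r_le_1[OF that] d_le_2[OF that] r_pos[OF that] by (auto simp: S_def)
      define F where "F w = (\<integral>\<^sup>+v. f v * ennreal (1 / S v ^ N) * indicator (E v (S v)) w \<partial>M)" for w
      have [measurable]: "F \<in> borel_measurable M" unfolding F_def by measurable

      \<comment> \<open>If mass from \<open>v\<close> reaches \<open>w\<close>, then \<open>S v\<close> is comparable to \<open>r w\<close>; so all of it comes from one
        quasiball of radius \<open>721 * r w\<close> around a point \<open>u\<close> outside \<open>\<Omega>\<close>, where averages are small. The radius
        exceeds \<open>720 * r w\<close>, a bound for \<open>\<rho> u u\<close>, in order that the quasiball contain \<open>u\<close>.\<close>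
      have F_le: "F w \<le> ennreal (721 ^ N * l)" if w: "w \<in> space M" for w
      proof (cases "\<exists>v\<in>space M. w \<in> E v (S v)")
        case False
        then have "F w = (\<integral>\<^sup>+v. 0 \<partial>M)" unfolding F_def by (intro nn_integral_cong) auto
        then show ?thesis by simp
      next
        case True
        note rw = r_pos[OF w]
        have E: "\<rho> v w < 24 * r w" "S v \<le> 4 * r w" "r w < S v" if "w \<in> E v (S v)" for v
          using that by (auto simp: E_def)
        obtain v0 where v0: "v0 \<in> space M" "w \<in> E v0 (S v0)" using True by blast
        have "d v0 < 16 * r w" using S[OF v0(1)] E[OF v0(2)] rw by linarith
        then obtain u where u: "u \<in> space M" "u \<notin> \<Omega>" "\<rho> v0 u < 16 * r w"
          using d_less[OF v0(1)] by blast
        have "\<rho> w v0 < 24 * r w" using E(1)[OF v0(2)] rho_sym[OF w v0(1)] by simp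
        then have "3 * (\<rho> w v0 + \<rho> v0 u) < 3 * (24 * r w + 16 * r w)"
          using u(3) by (intro mult_strict_left_mono add_strict_mono) auto
        then have wu: "\<rho> w u < 120 * r w"
          using rho_triangle[OF w v0(1) u(1)] by simp
        have uw: "\<rho> u w < 120 * r w" using wu rho_sym[OF w u(1)] by simp
        have "\<rho> u u < 721 * r w" using rho_triangle[OF u(1) w u(1)] wu uw rw by argo
        then have "u \<in> Q u (721 * r w)" using u by (auto simp: Q_def)
        then have "(u, 721 * r w) \<notin> I" using u by (auto simp: \<Omega>_def)
        then have avg: "mass f (Q u (721 * r w)) \<le> ennreal (l * (721 * r w) ^ N)"
          using u rw by (auto simp: I_def not_less)
        have [measurable]: "Q u (721 * r w) \<in> sets M" using u by simp
        have "F w \<le> (\<integral>\<^sup>+v. ennreal (1 / r w ^ N) * (f v * indicator (Q u (721 * r w)) v) \<partial>M)"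
          unfolding F_def
        proof (intro nn_integral_mono)
          fix v assume v: "v \<in> space M"
          show "f v * ennreal (1 / S v ^ N) * indicator (E v (S v)) w
             \<le> ennreal (1 / r w ^ N) * (f v * indicator (Q u (721 * r w)) v)"
          proof (cases "w \<in> E v (S v)")
            case True
            have "\<rho> u v < 721 * r w"
              using rho_triangle[OF u(1) w v] uw E(1)[OF True] rho_sym[OF w v] rw by argo
            moreover have "1 / S v ^ N \<le> 1 / r w ^ N"
              using E[OF True] rw by (intro divide_left_mono power_mono mult_pos_pos zero_less_power) auto
            ultimately show ?thesis
              using v True by (auto simp: Q_def mult.commute intro!: mult_left_mono ennreal_leI)
          qed simp
        qed
        also have "\<dots> = ennreal (1 / r w ^ N) * mass f (Q u (721 * r w))"
          by (subst nn_integral_cmult) auto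
        also have "\<dots> \<le> ennreal (1 / r w ^ N) * ennreal (l * (721 * r w) ^ N)"
          by (intro mult_left_mono avg) auto
        also have "\<dots> = ennreal (721 ^ N * l)"
          using rw l by (simp add: ennreal_mult[symmetric] power_mult_distrib)
        finally show ?thesis .
      qed

      have F_mass: "(\<integral>\<^sup>+w. F w * ws w \<partial>M) \<le> ennreal (K * 6 ^ N) * (\<integral>\<^sup>+v. f v * ws v \<partial>M)"
      proof -
        have "(\<integral>\<^sup>+w. F w * ws w \<partial>M)
            = (\<integral>\<^sup>+w. \<integral>\<^sup>+v. f v * ennreal (1 / S v ^ N) * (ws w * indicator (E v (S v)) w) \<partial>M \<partial>M)"
        proof (intro nn_integral_cong)
          fix w assume "w \<in> space M"
          then have "F w * ws w = (\<integral>\<^sup>+v. f v * ennreal (1 / S v ^ N) * indicator (E v (S v)) w * ws w \<partial>M)"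
            unfolding F_def by (subst nn_integral_multc) auto
          then show "F w * ws w = (\<integral>\<^sup>+v. f v * ennreal (1 / S v ^ N) * (ws w * indicator (E v (S v)) w) \<partial>M)"
            by (simp add: mult_ac)
        qed
        also have "\<dots> = (\<integral>\<^sup>+v. \<integral>\<^sup>+w. f v * ennreal (1 / S v ^ N) * (ws w * indicator (E v (S v)) w) \<partial>M \<partial>M)"
          by (rule nn_integral_swap) auto
        also have "\<dots> \<le> (\<integral>\<^sup>+v. ennreal (K * 6 ^ N) * (f v * ws v) \<partial>M)"
        proof (rule nn_integral_mono_AE, use B1 AE_space in eventually_elim)
          fix v assume v: "\<forall>t\<ge>r v. mass ws (Q v t) \<le> ennreal (K * t ^ N * \<sigma> v)" "v \<in> space M"
          note Sv = S[OF v(2)]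
          have "(\<integral>\<^sup>+w. f v * ennreal (1 / S v ^ N) * (ws w * indicator (E v (S v)) w) \<partial>M)
              = f v * ennreal (1 / S v ^ N) * mass ws (E v (S v))"
            using v(2) by (subst nn_integral_cmult) auto
          also have "\<dots> \<le> f v * ennreal (1 / S v ^ N) * mass ws (Q v (6 * S v))"
            by (intro mult_left_mono mass_mono E_subset_Q) auto
          also have "\<dots> \<le> f v * ennreal (1 / S v ^ N) * ennreal (K * (6 * S v) ^ N * \<sigma> v)"
            using v(1)[rule_format, of "6 * S v"] Sv by (intro mult_left_mono) auto
          also have "ennreal (K * (6 * S v) ^ N * \<sigma> v) = ennreal (K * (6 * S v) ^ N) * ws v"
            using K Sv by (intro ennreal_mult') auto
          also have "f v * ennreal (1 / S v ^ N) * (ennreal (K * (6 * S v) ^ N) * ws v)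
              = f v * (ennreal (1 / S v ^ N) * ennreal (K * (6 * S v) ^ N)) * ws v"
            by (simp only: mult.assoc)
          also have "ennreal (1 / S v ^ N) * ennreal (K * (6 * S v) ^ N) = ennreal (K * 6 ^ N)"
            using K Sv by (subst ennreal_mult[symmetric]) (auto simp: power_mult_distrib)
          finally show "(\<integral>\<^sup>+w. f v * ennreal (1 / S v ^ N) * (ws w * indicator (E v (S v)) w) \<partial>M)
            \<le> ennreal (K * 6 ^ N) * (f v * ws v)" by (simp add: mult_ac)
        qed
        also have "\<dots> = ennreal (K * 6 ^ N) * (\<integral>\<^sup>+v. f v * ws v \<partial>M)" by (subst nn_integral_cmult) auto
        finally show ?thesis .
      qed

      \<comment> \<open>Since \<open>z\<close> is outside \<open>\<Omega>\<close>, \<open>S v \<le> \<rho> z v\<close>; so \<open>\<rho> z\<close> grows by at most the factor 21 on \<open>E v (S v)\<close>.\<close>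
      have dominate: "bergman f z \<le> ennreal c1 * bergman F z" if z: "z \<in> space M" "z \<notin> \<Omega>" for z
      proof -
        have "bergman f z \<le> (\<integral>\<^sup>+v. ennreal c1 *
            (\<integral>\<^sup>+w. ennreal (1 / \<rho> z w ^ N) * (f v * ennreal (1 / S v ^ N) * indicator (E v (S v)) w) \<partial>M) \<partial>M)"
          unfolding bergman_def
        proof (intro nn_integral_mono)
          fix v assume v: "v \<in> space M"
          note Sv = S[OF v]
          note pos = rho_pos[OF z(1) v]
          have Srho: "S v \<le> \<rho> z v" using Sv d_le[OF v, of z] z rho_sym[OF z(1) v] by simp
          have [measurable]: "E v (S v) \<in> sets M" using v by simp
          have "1 / \<rho> z v ^ N = c1 * (1 / (21 * \<rho> z v) ^ N * (1 / S v ^ N) * (c * S v ^ N))"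
            using Sv pos c_pos by (simp add: c1_def power_mult_distrib)
          moreover have "ennreal (c1 * (a * b * e)) = ennreal c1 * (ennreal a * ennreal b * ennreal e)"
            if "0 \<le> a" "0 \<le> b" "0 \<le> e" for a b e
            using that c1 by (simp add: ennreal_mult)
          ultimately have "ennreal (1 / \<rho> z v ^ N) * f v
              = ennreal c1 * (ennreal (1 / (21 * \<rho> z v) ^ N) * ennreal (1 / S v ^ N) * ennreal (c * S v ^ N)) * f v"
            using Sv pos c_pos by (metis divide_nonneg_nonneg less_imp_le mult_nonneg_nonneg zero_le_numeral
                zero_le_one zero_le_power)
          also have "\<dots> \<le> ennreal c1 * (ennreal (1 / (21 * \<rho> z v) ^ N) * ennreal (1 / S v ^ N) * emeasure M (E v (S v))) * f v"
            using v Sv by (intro mult_right_mono mult_left_mono emeasure_E_ge) auto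
          also have "\<dots> = ennreal c1 * ((ennreal (1 / (21 * \<rho> z v) ^ N) * (f v * ennreal (1 / S v ^ N))) * emeasure M (E v (S v)))"
            by (simp only: mult_ac)
          also have "(ennreal (1 / (21 * \<rho> z v) ^ N) * (f v * ennreal (1 / S v ^ N))) * emeasure M (E v (S v))
              = (\<integral>\<^sup>+w. (ennreal (1 / (21 * \<rho> z v) ^ N) * (f v * ennreal (1 / S v ^ N))) * indicator (E v (S v)) w \<partial>M)"
            by (subst nn_integral_cmult_indicator) auto
          also have "\<dots> \<le> (\<integral>\<^sup>+w. ennreal (1 / \<rho> z w ^ N) * (f v * ennreal (1 / S v ^ N) * indicator (E v (S v)) w) \<partial>M)"
          proof (intro nn_integral_mono)
            fix w assume w: "w \<in> space M"
            show "(ennreal (1 / (21 * \<rho> z v) ^ N) * (f v * ennreal (1 / S v ^ N))) * indicator (E v (S v)) w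
              \<le> ennreal (1 / \<rho> z w ^ N) * (f v * ennreal (1 / S v ^ N) * indicator (E v (S v)) w)"
            proof (cases "w \<in> E v (S v)")
              case True
              then have "\<rho> v w < 6 * S v" by (simp add: E_def)
              then have "\<rho> z w \<le> 21 * \<rho> z v" using rho_triangle[OF z(1) v w] Srho by argo
              then have "1 / (21 * \<rho> z v) ^ N \<le> 1 / \<rho> z w ^ N"
                using rho_pos[OF z(1) w] pos by (intro divide_left_mono power_mono mult_pos_pos zero_less_power) auto
              then show ?thesis using True by (auto intro!: mult_right_mono ennreal_leI)
            qed simp
          qed
          finally show "ennreal (1 / \<rho> z v ^ N) * f v \<le> ennreal c1 *
            (\<integral>\<^sup>+w. ennreal (1 / \<rho> z w ^ N) * (f v * ennreal (1 / S v ^ N) * indicator (E v (S v)) w) \<partial>M)"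
            by (simp add: mult_left_mono)
        qed
        also have "\<dots> = ennreal c1 * (\<integral>\<^sup>+v. \<integral>\<^sup>+w. ennreal (1 / \<rho> z w ^ N) *
            (f v * ennreal (1 / S v ^ N) * indicator (E v (S v)) w) \<partial>M \<partial>M)"
          using z by (subst nn_integral_cmult) auto
        also have "(\<integral>\<^sup>+v. \<integral>\<^sup>+w. ennreal (1 / \<rho> z w ^ N) *
            (f v * ennreal (1 / S v ^ N) * indicator (E v (S v)) w) \<partial>M \<partial>M)
          = (\<integral>\<^sup>+w. \<integral>\<^sup>+v. ennreal (1 / \<rho> z w ^ N) *
            (f v * ennreal (1 / S v ^ N) * indicator (E v (S v)) w) \<partial>M \<partial>M)"
          using z by (intro nn_integral_swap) auto
        also have "\<dots> = bergman F z"
          unfolding bergman_def F_def using z by (intro nn_integral_cong, subst nn_integral_cmult) auto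
        finally show ?thesis .
      qed

      let ?T = "{z \<in> space M. ennreal (l / c1) < bergman F z}"
      have "mass ws ?T \<le> ennreal ((c1 / l)\<^sup>2) * (\<integral>\<^sup>+z. ennreal_powr (bergman F z) 2 * ws z \<partial>M)"
      proof -
        have "mass ws ?T \<le> (\<integral>\<^sup>+z. ennreal ((c1 / l)\<^sup>2) * (ennreal_powr (bergman F z) 2 * ws z) \<partial>M)"
        proof (intro nn_integral_mono)
          fix z assume z: "z \<in> space M"
          show "ws z * indicator ?T z \<le> ennreal ((c1 / l)\<^sup>2) * (ennreal_powr (bergman F z) 2 * ws z)"
          proof (cases "z \<in> ?T")
            case True
            then have "ennreal_powr (ennreal (l / c1)) 2 \<le> ennreal_powr (bergman F z) 2"
              by (intro ennreal_powr_mono) auto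
            then have "ennreal ((c1 / l)\<^sup>2) * ennreal ((l / c1)\<^sup>2) \<le> ennreal ((c1 / l)\<^sup>2) * ennreal_powr (bergman F z) 2"
              using l c1 by (intro mult_left_mono) (auto simp: ennreal_powr_ennreal)
            also have "ennreal ((c1 / l)\<^sup>2) * ennreal ((l / c1)\<^sup>2) = 1"
              using l c1 by (simp add: ennreal_mult[symmetric] power_divide)
            finally have "1 * ws z \<le> (ennreal ((c1 / l)\<^sup>2) * ennreal_powr (bergman F z) 2) * ws z"
              by (intro mult_right_mono) auto
            then show ?thesis using True by (simp add: mult.assoc)
          qed simp
        qed
        also have "\<dots> = ennreal ((c1 / l)\<^sup>2) * (\<integral>\<^sup>+z. ennreal_powr (bergman F z) 2 * ws z \<partial>M)"
          by (subst nn_integral_cmult) auto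
        finally show ?thesis .
      qed
      also have "\<dots> \<le> ennreal ((c1 / l)\<^sup>2) * (ennreal B0 * (\<integral>\<^sup>+z. ennreal_powr (F z) 2 * ws z \<partial>M))"
        by (intro mult_left_mono B0) auto
      also have "\<dots> \<le> ennreal ((c1 / l)\<^sup>2) * (ennreal B0 * (\<integral>\<^sup>+z. ennreal (721 ^ N * l) * (F z * ws z) \<partial>M))"
      proof (intro mult_left_mono nn_integral_mono)
        fix w assume w: "w \<in> space M"
        have "ennreal_powr (F w) 2 = ennreal_powr (F w) 1 * ennreal_powr (F w) 1"
          using ennreal_powr_add[of 1 1 "F w"] by simp
        then have "ennreal_powr (F w) 2 * ws w = F w * (F w * ws w)" by (simp add: mult.assoc)
        also have "\<dots> \<le> ennreal (721 ^ N * l) * (F w * ws w)" by (intro mult_right_mono F_le w) auto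
        finally show "ennreal_powr (F w) 2 * ws w \<le> ennreal (721 ^ N * l) * (F w * ws w)" .
      qed auto
      also have "\<dots> = ennreal ((c1 / l)\<^sup>2) * (ennreal B0 * (ennreal (721 ^ N * l) * (\<integral>\<^sup>+z. F z * ws z \<partial>M)))"
        by (subst nn_integral_cmult) auto
      also have "\<dots> \<le> ennreal ((c1 / l)\<^sup>2) * (ennreal B0 * (ennreal (721 ^ N * l) *
          (ennreal (K * 6 ^ N) * (\<integral>\<^sup>+v. f v * ws v \<partial>M))))"
        by (intro mult_left_mono F_mass) auto
      also have "\<dots> = ennreal ((c1 / l)\<^sup>2 * (B0 * ((721 ^ N * l) * (K * 6 ^ N)))) * (\<integral>\<^sup>+v. f v * ws v \<partial>M)"
        using B0 l K by (simp add: ennreal_mult mult.assoc)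
      finally have T: "mass ws ?T \<le> ennreal ((c1 / l)\<^sup>2 * (B0 * ((721 ^ N * l) * (K * 6 ^ N)))) * (\<integral>\<^sup>+v. f v * ws v \<partial>M)" .

      have "{z \<in> space M. ennreal l < bergman f z} \<subseteq> \<Omega> \<union> ?T"
      proof
        fix z assume z: "z \<in> {z \<in> space M. ennreal l < bergman f z}"
        show "z \<in> \<Omega> \<union> ?T"
        proof (cases "z \<in> \<Omega>")
          case False
          then have "ennreal l < ennreal c1 * bergman F z" using z dominate[of z] by (auto intro: less_le_trans)
          moreover have "ennreal c1 * bergman F z \<le> ennreal c1 * ennreal (l / c1)" if "bergman F z \<le> ennreal (l / c1)"
            using that by (intro mult_left_mono) auto
          moreover have "ennreal c1 * ennreal (l / c1) = ennreal l"
            using c1 l by (simp add: ennreal_mult[symmetric])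
          ultimately show ?thesis using z by (auto simp: not_le[symmetric])
        qed simp
      qed
      then have "mass ws {z \<in> space M. ennreal l < bergman f z} \<le> mass ws (\<Omega> \<union> ?T)" by (rule mass_mono)
      also have "\<dots> \<le> (\<integral>\<^sup>+y. ws y * indicator \<Omega> y + ws y * indicator ?T y \<partial>M)"
        by (intro nn_integral_mono) (auto simp: indicator_def)
      also have "\<dots> = mass ws \<Omega> + mass ws ?T" by (rule nn_integral_add) auto
      also have "\<dots> \<le> ennreal (K * 66 ^ N / l) * (\<integral>\<^sup>+v. f v * ws v \<partial>M) +
          ennreal ((c1 / l)\<^sup>2 * (B0 * ((721 ^ N * l) * (K * 6 ^ N)))) * (\<integral>\<^sup>+v. f v * ws v \<partial>M)"
        by (intro add_mono \<Omega>_bound T)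
      also have "\<dots> = ennreal (K * 66 ^ N / l + (c1 / l)\<^sup>2 * (B0 * ((721 ^ N * l) * (K * 6 ^ N)))) * (\<integral>\<^sup>+v. f v * ws v \<partial>M)"
        using K l B0 by (subst ennreal_plus) (auto simp: distrib_right)
      also have "K * 66 ^ N / l + (c1 / l)\<^sup>2 * (B0 * ((721 ^ N * l) * (K * 6 ^ N))) = B / l"
        using l by (simp add: B_def field_simps power2_eq_square)
      finally have "ennreal l * mass ws {z \<in> space M. ennreal l < bergman f z} \<le>
          ennreal l * (ennreal (B / l) * (\<integral>\<^sup>+v. f v * ws v \<partial>M))"
        by (intro mult_left_mono) auto
      also have "\<dots> = ennreal B * (\<integral>\<^sup>+v. f v * ws v \<partial>M)"
        using l \<open>0 < B\<close> by (simp add: mult.assoc[symmetric] ennreal_mult[symmetric])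
      finally show ?thesis .
    qed
  qed
qed

end

end

section \<open>The Hermitian product and the volume of caps\<close>

lemma herm_add_left: "herm (x + y) z = herm x z + herm y z"
  by (simp add: herm_def distrib_right sum.distrib)

lemma herm_diff_left: "herm (x - y) z = herm x z - herm y z"
  by (simp add: herm_def left_diff_distrib sum_subtractf)

lemma herm_diff_right: "herm x (y - z) = herm x y - herm x z"
  by (simp add: herm_def right_diff_distrib sum_subtractf)

lemma herm_smult_left: "herm (a *s x) y = a * herm x y"
  by (simp add: herm_def sum_distrib_left mult.assoc)

lemma herm_smult_right: "herm x (a *s y) = cnj a * herm x y"
  by (simp add: herm_def sum_distrib_left mult_ac)

lemma herm_scaleR_left: "herm (a *\<^sub>R x) y = of_real a * herm x y"
proof -
  have "herm (a *\<^sub>R x) y = a *\<^sub>R herm x y" by (simp add: herm_def scaleR_sum_right)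
  then show ?thesis by (simp add: scaleR_conv_of_real)
qed

lemma herm_commute: "herm y x = cnj (herm x y)"
  by (simp add: herm_def mult.commute)

lemma herm_self: "herm x x = of_real ((norm x)\<^sup>2)"
  by (simp add: herm_def norm_vec_def L2_set_def sum_nonneg complex_norm_square[symmetric])

lemma Re_herm: "Re (herm x y) = x \<bullet> y"
  by (simp add: herm_def inner_vec_def inner_complex_def)

lemma norm_herm_le: "norm (herm x y) \<le> norm x * norm y"
proof -
  have "norm (herm x y) \<le> (\<Sum>j\<in>UNIV. norm (x $ j) * norm (y $ j))"
    unfolding herm_def by (rule order_trans[OF norm_sum]) (simp add: norm_mult)
  also have "\<dots> \<le> norm x * norm y"
    using L2_set_mult_ineq[of "\<lambda>j. norm (x $ j)" "\<lambda>j. norm (y $ j)" UNIV]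
    by (simp add: norm_vec_def)
  finally show ?thesis .
qed

lemma herm_axis: "herm x (axis k 1) = x $ k"
proof -
  have "herm x (axis k 1) = (\<Sum>j\<in>UNIV. if j = k then x $ j else 0)"
    unfolding herm_def by (intro sum.cong) (auto simp: axis_def)
  then show ?thesis by simp
qed

text \<open>
  Not a metric: \<open>qdist z z = 1 - (norm z)^2\<close>, so this measures distance only down to the scale of the
  distance to the sphere.
\<close>

definition qdist :: "complex ^ 'n \<Rightarrow> complex ^ 'n \<Rightarrow> real"
  where "qdist z w = norm (1 - herm z w)"

lemma qdist_commute: "qdist z w = qdist w z"
proof -
  have "1 - herm w z = cnj (1 - herm z w)" by (simp add: herm_commute[of w z])
  then show ?thesis unfolding qdist_def by (simp only: complex_mod_cnj)
qed

lemma qdist_ge: "1 - norm z * norm w \<le> qdist z w"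
  using norm_triangle_ineq2[of 1 "herm z w"] norm_herm_le[of z w] by (simp add: qdist_def)

lemma qdist_ge_left: "norm z \<le> 1 \<Longrightarrow> norm w \<le> 1 \<Longrightarrow> 1 - norm z \<le> qdist z w"
  using qdist_ge[of z w] mult_left_mono[of "norm w" 1 "norm z"] by simp

lemma qdist_le_2: "norm z \<le> 1 \<Longrightarrow> norm w \<le> 1 \<Longrightarrow> qdist z w \<le> 2"
  using norm_triangle_ineq4[of 1 "herm z w"] norm_herm_le[of z w]
    mult_mono[of "norm z" 1 "norm w" 1] by (simp add: qdist_def)

text \<open>
  The square root of \<open>qdist\<close> dominates the Euclidean distance, which is what bounds the cross term in
  the quasi-triangle inequality.
\<close>

lemma norm_diff_le_qdist:
  assumes "norm a \<le> 1" "norm b \<le> 1"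
  shows "(norm (a - b))\<^sup>2 \<le> 2 * qdist a b"
proof -
  have "(norm (a - b))\<^sup>2 = (norm a)\<^sup>2 + (norm b)\<^sup>2 - 2 * (a \<bullet> b)"
    by (simp add: power2_norm_eq_inner inner_diff_left inner_diff_right inner_commute)
  also have "\<dots> \<le> 2 * Re (1 - herm a b)"
    using assms by (simp add: Re_herm power_le_one)
      (use assms in \<open>smt (verit) norm_ge_zero power_le_one\<close>)
  also have "Re (1 - herm a b) \<le> qdist a b" unfolding qdist_def by (rule complex_Re_le_cmod)
  finally show ?thesis by simp
qed

text \<open>
  From \<open>1 - <a,b> = (1 - <a,z>) + (1 - <z,b>) - (1 - <z,z>) + <a - z, z - b>\<close>, where each of the last
  two terms is at most \<open>qdist a z + qdist z b\<close> in modulus.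
\<close>

lemma qdist_triangle:
  assumes "norm a \<le> 1" "norm b \<le> 1" "norm z \<le> 1"
  shows "qdist a b \<le> 3 * (qdist a z + qdist z b)"
proof -
  have "herm a z + herm z b - herm a b - herm z z = herm (a - z) (z - b)"
    by (simp add: herm_diff_left herm_diff_right)
  then have "1 - herm a b = (1 - herm a z) + (1 - herm z b) - (1 - herm z z) + herm (a - z) (z - b)"
    by (simp add: algebra_simps)
  then have "qdist a b \<le> qdist a z + qdist z b + norm (1 - herm z z) + norm (herm (a - z) (z - b))"
    unfolding qdist_def by (smt (verit) norm_triangle_ineq norm_triangle_ineq4)
  moreover have "norm (1 - herm z z) \<le> qdist a z + qdist z b"
  proof -
    have "1 - herm z z = of_real (1 - (norm z)\<^sup>2)" by (simp add: herm_self)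
    then have "norm (1 - herm z z) = \<bar>1 - (norm z)\<^sup>2\<bar>" by (simp only: norm_of_real)
    also have "\<dots> = (1 - norm z) * (1 + norm z)"
      using power_le_one[OF norm_ge_zero assms(3), of 2] by (simp add: power2_eq_square algebra_simps)
    also have "\<dots> \<le> (1 - norm z) * 2" using assms by (intro mult_left_mono) auto
    also have "\<dots> \<le> qdist a z + qdist z b"
      using qdist_ge_left[of z a] qdist_ge_left[of z b] assms by (simp add: qdist_commute)
    finally show ?thesis .
  qed
  moreover have "norm (herm (a - z) (z - b)) \<le> qdist a z + qdist z b"
  proof -
    have "norm (herm (a - z) (z - b)) \<le> norm (a - z) * norm (z - b)" by (rule norm_herm_le)
    also have "\<dots> \<le> ((norm (a - z))\<^sup>2 + (norm (z - b))\<^sup>2) / 2"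
      using sum_squares_bound[of "norm (a - z)" "norm (z - b)"] by simp
    also have "\<dots> \<le> qdist a z + qdist z b"
      using norm_diff_le_qdist[of a z] norm_diff_le_qdist[of z b] assms by simp
    finally show ?thesis .
  qed
  ultimately show ?thesis by argo
qed

lemma continuous_on_herm [continuous_intros]:
  "continuous_on S f \<Longrightarrow> continuous_on S g \<Longrightarrow> continuous_on S (\<lambda>x. herm (f x) (g x))"
  unfolding herm_def by (intro continuous_intros) auto

text \<open>
  The image \<open>\<mu>\<close> of Lebesgue measure under a linear isometry is translation invariant. Integrating
  \<open>1_A(x) 1_B(y - x)\<close> in the two possible orders shows that \<open>\<mu>\<close> is proportional to Lebesgue measure,
  and the constant is 1 because both give the same measure to the unit ball \<open>B\<close>.
\<close>

lemma distr_lborel_linear_isometry: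
  fixes U :: "'a::euclidean_space \<Rightarrow> 'a"
  assumes U: "linear U" and iso: "\<And>x. norm (U x) = norm x"
  shows "distr lborel borel U = lborel"
proof -
  have inj: "inj U"
  proof (rule injI)
    fix x y assume "U x = U y"
    then have "norm (x - y) = 0" using iso[of "x - y"] U by (simp add: linear_diff)
    then show "x = y" by simp
  qed
  then have surj: "surj U" using U linear_injective_imp_surjective by blast
  have U_meas [measurable]: "U \<in> borel_measurable borel"
    using U by (intro borel_measurable_continuous_onI linear_continuous_on linear_conv_bounded_linear[THEN iffD1])
  define \<mu> where "\<mu> = distr lborel borel U"
  have sets_mu [measurable_cong]: "sets \<mu> = sets borel" by (simp add: \<mu>_def)
  have space_mu [simp]: "space \<mu> = UNIV" by (simp add: \<mu>_def)
  have ball: "emeasure \<mu> (ball 0 R) = emeasure lborel (ball (0::'a) R)" for R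
  proof -
    have "U -` ball 0 R = ball 0 R" using iso by auto
    then show ?thesis by (simp add: \<mu>_def emeasure_distr)
  qed
  have finite_ball: "emeasure lborel (ball (0::'a) R) \<noteq> top" for R
    using emeasure_lborel_ball_finite[of "0::'a" R] by (simp add: less_top)
  interpret mu: sigma_finite_measure \<mu>
  proof
    show "\<exists>A. countable A \<and> A \<subseteq> sets \<mu> \<and> \<Union> A = space \<mu> \<and> (\<forall>a\<in>A. emeasure \<mu> a \<noteq> \<infinity>)"
    proof (intro exI conjI)
      show "\<Union> (range (\<lambda>n::nat. ball (0::'a) (real n))) = space \<mu>"
        using reals_Archimedean2 by auto
    qed (auto simp: ball finite_ball sets_mu)
  qed
  interpret pair_sigma_finite lborel \<mu> ..
  have transl: "emeasure \<mu> {x. x + t \<in> A} = emeasure \<mu> A" if A [measurable]: "A \<in> sets borel" for A t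
  proof -
    obtain y where y: "t = U y" using surj by blast
    have "emeasure \<mu> {x. x + t \<in> A} = emeasure lborel {x. U (y + x) \<in> A}"
      using U by (simp add: \<mu>_def emeasure_distr y linear_add vimage_def add.commute)
    also have "\<dots> = emeasure (distr lborel borel ((+) y)) (U -` A)"
      by (subst emeasure_distr) (auto simp: vimage_def intro!: measurable_sets_borel[OF U_meas, simplified vimage_def])
    also have "\<dots> = emeasure \<mu> A"
      using measurable_sets_borel[OF U_meas A] by (simp add: lborel_distr_plus \<mu>_def emeasure_distr)
    finally show ?thesis .
  qed
  have shift: "{x. x + t \<in> A} \<in> sets \<mu>" if "A \<in> sets borel" for A and t :: 'a
    using measurable_sets_borel[of "\<lambda>x. x + t" borel A] that by (simp add: sets_mu vimage_def)
  have reflect: "(\<integral>\<^sup>+x. g x \<partial>lborel) = (\<integral>\<^sup>+x. g (y - x) \<partial>lborel)"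
    if [measurable]: "g \<in> borel_measurable borel" for g :: "'a \<Rightarrow> ennreal" and y
    by (subst lborel_affine[of "-1" y])
      (simp_all add: nn_integral_density nn_integral_distr)
  have "lborel = \<mu>"
  proof (rule measure_eqI)
    fix A :: "'a set" assume "A \<in> sets lborel"
    then have A [measurable]: "A \<in> sets borel" by simp
    define B where "B = ball (0::'a) 1"
    have B [measurable]: "B \<in> sets borel" by (simp add: B_def)
    have "emeasure lborel A * emeasure \<mu> B = (\<integral>\<^sup>+x. indicator A x * emeasure \<mu> B \<partial>lborel)"
      by (subst nn_integral_multc) auto
    also have "\<dots> = (\<integral>\<^sup>+x. \<integral>\<^sup>+y. indicator A x * indicator B (y - x) \<partial>\<mu> \<partial>lborel)"
    proof (rule nn_integral_cong)
      fix x
      have "(\<integral>\<^sup>+y. indicator A x * indicator B (y - x) \<partial>\<mu>)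
          = (\<integral>\<^sup>+y. indicator A x * indicator {y. y + (- x) \<in> B} y \<partial>\<mu>)"
        by (intro nn_integral_cong arg_cong2[where f="(*)"]) (auto simp: indicator_def)
      also have "\<dots> = indicator A x * (\<integral>\<^sup>+y. indicator {y. y + (- x) \<in> B} y \<partial>\<mu>)"
        by (intro nn_integral_cmult borel_measurable_indicator shift) auto
      also have "(\<integral>\<^sup>+y. indicator {y. y + (- x) \<in> B} y \<partial>\<mu>) = emeasure \<mu> {y. y + (- x) \<in> B}"
        by (intro nn_integral_indicator shift) auto
      also have "\<dots> = emeasure \<mu> B" by (intro transl A B)
      finally show "indicator A x * emeasure \<mu> B = (\<integral>\<^sup>+y. indicator A x * indicator B (y - x) \<partial>\<mu>)"
        by (rule sym)
    qed
    also have "\<dots> = (\<integral>\<^sup>+y. \<integral>\<^sup>+x. indicator A x * indicator B (y - x) \<partial>lborel \<partial>\<mu>)"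
      by (rule Fubini'[symmetric]) measurable
    also have "\<dots> = (\<integral>\<^sup>+y. \<integral>\<^sup>+x. indicator A (y - x) * indicator B x \<partial>lborel \<partial>\<mu>)"
    proof (rule nn_integral_cong)
      fix y
      show "(\<integral>\<^sup>+x. indicator A x * indicator B (y - x) \<partial>lborel) = (\<integral>\<^sup>+x. indicator A (y - x) * indicator B x \<partial>lborel)"
        using reflect[of "\<lambda>x. indicator A x * indicator B (y - x)" y] by simp
    qed
    also have "\<dots> = (\<integral>\<^sup>+x. \<integral>\<^sup>+y. indicator A (y - x) * indicator B x \<partial>\<mu> \<partial>lborel)"
      by (rule Fubini') measurable
    also have "\<dots> = (\<integral>\<^sup>+x. emeasure \<mu> A * indicator B x \<partial>lborel)"
    proof (rule nn_integral_cong)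
      fix x
      have "(\<integral>\<^sup>+y. indicator A (y - x) * indicator B x \<partial>\<mu>)
          = (\<integral>\<^sup>+y. indicator {y. y + (- x) \<in> A} y * indicator B x \<partial>\<mu>)"
        by (intro nn_integral_cong arg_cong2[where f="(*)"]) (auto simp: indicator_def)
      also have "\<dots> = (\<integral>\<^sup>+y. indicator {y. y + (- x) \<in> A} y \<partial>\<mu>) * indicator B x"
        by (intro nn_integral_multc borel_measurable_indicator shift) auto
      also have "(\<integral>\<^sup>+y. indicator {y. y + (- x) \<in> A} y \<partial>\<mu>) = emeasure \<mu> {y. y + (- x) \<in> A}"
        by (intro nn_integral_indicator shift) auto
      also have "\<dots> = emeasure \<mu> A" by (intro transl A B)
      finally show "(\<integral>\<^sup>+y. indicator A (y - x) * indicator B x \<partial>\<mu>) = emeasure \<mu> A * indicator B x" .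
    qed
    also have "\<dots> = emeasure \<mu> A * emeasure lborel B" by (subst nn_integral_cmult) auto
    finally have eq: "emeasure lborel A * emeasure lborel B = emeasure \<mu> A * emeasure lborel B"
      by (simp add: ball B_def)
    have "emeasure lborel B \<noteq> 0" "emeasure lborel B \<noteq> \<infinity>"
      using finite_ball[of 1] content_ball_pos[of 1 "0::'a"] by (auto simp: measure_def B_def)
    then show "emeasure lborel A = emeasure \<mu> A"
      using eq by (metis ennreal_mult_divide_eq infinity_ennreal_def)
  qed (simp add: sets_mu)
  then show ?thesis by (simp add: \<mu>_def)
qed

text \<open>
  A complex Householder reflection \<open>H\<close> exchanges two unit vectors whose Hermitian product is real. This
  is arranged by multiplying the axis vector \<open>a\<close> by the phase \<open>c\<close> of the \<open>k\<close>-th coordinate of \<open>e\<close>. If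
  \<open>q = 0\<close>, the two vectors agree and the reflection degenerates to the identity, thanks to division
  by 0 being 0.
\<close>

lemma exists_unitary:
  fixes e :: "complex ^ 'n"
  assumes e: "norm e = 1"
  obtains U :: "complex ^ 'n \<Rightarrow> complex ^ 'n" where "linear U"
    "\<And>x y. herm (U x) (U y) = herm x y" "U (axis k 1) = e"
proof -
  define a where "a = (axis k 1 :: complex ^ 'n)"
  define c where "c = (if e $ k = 0 then 1 else sgn (e $ k))"
  have c: "norm c = 1" "cnj c * e $ k = of_real (norm (e $ k))"
  proof -
    show "norm c = 1" by (simp add: c_def norm_sgn)
    have "cnj (sgn z) * z = of_real (norm z)" for z :: complex
      by (cases "z = 0") (simp_all add: sgn_div_norm scaleR_conv_of_real complex_norm_square[symmetric] mult.assoc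
          mult.commute[of "cnj z"] power2_eq_square field_simps)
    then show "cnj c * e $ k = of_real (norm (e $ k))" by (simp add: c_def)
  qed
  have cc: "c * cnj c = 1" using complex_norm_square[of c] c by simp
  define t where "t = norm (e $ k)"
  define v where "v = e - c *s a"
  have a_self: "herm a a = 1" by (simp add: a_def herm_axis)
  have ea: "herm e a = e $ k" by (simp add: a_def herm_axis)
  have ae: "herm a e = cnj (e $ k)" using herm_commute[of a e] ea by simp
  have e_self: "herm e e = 1" using e by (simp add: herm_self)
  have ca_e: "herm (c *s a) e = of_real t"
  proof -
    have "herm (c *s a) e = cnj (cnj c * e $ k)"
      by (simp add: herm_smult_left ae)
    then show ?thesis using c(2) by (simp add: t_def)
  qed
  have e_ca: "herm e (c *s a) = of_real t"
    using herm_commute[of e "c *s a"] ca_e by simp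
  have ca_self: "herm (c *s a) (c *s a) = 1" using cc by (simp add: herm_smult_left herm_smult_right a_self mult.commute)
  have vv: "herm v v = of_real (2 - 2 * t)"
    by (simp add: v_def herm_diff_left herm_diff_right e_self ca_e e_ca ca_self)
  define q where "q = 2 - 2 * t"
  define H where "H x = x - (2 * herm x v / of_real q) *s v" for x
  define U where "U x = H (c *s x)" for x
  have smult_linear: "linear (\<lambda>x::complex^'n. d *s x)" for d
    by (rule linearI) (simp_all add: vec_eq_iff algebra_simps scaleR_conv_of_real)
  have "linear H"
    by (rule linearI) (simp_all add: H_def herm_add_left herm_scaleR_left vec_eq_iff scaleR_conv_of_real[where 'a=complex]
        algebra_simps add_divide_distrib)
  then have "linear U" unfolding U_def using linear_compose[OF smult_linear[of c]] by (simp add: o_def)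
  moreover have "herm (U x) (U y) = herm x y" for x y
  proof -
    have H: "herm (H x) (H y) = herm x y" for x y
    proof (cases "q = 0")
      case True then show ?thesis by (simp add: H_def herm_diff_left herm_diff_right herm_smult_left herm_smult_right)
    next
      case False
      have "herm (H x) (H y) = herm x y - cnj (2 * herm y v / of_real q) * herm x v
          - (2 * herm x v / of_real q) * herm v y
          + (2 * herm x v / of_real q) * cnj (2 * herm y v / of_real q) * herm v v"
        by (simp add: H_def herm_diff_left herm_diff_right herm_smult_left herm_smult_right algebra_simps)
      also have "herm v y = cnj (herm y v)" by (rule herm_commute)
      finally show ?thesis using False by (simp add: vv q_def[symmetric])
    qed
    have "herm (U x) (U y) = (c * cnj c) * herm x y"
      by (simp add: U_def H herm_smult_left herm_smult_right)
    then show ?thesis using cc by simp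
  qed
  moreover have "U a = e"
  proof (cases "q = 0")
    case True
    then have "herm v v = 0" using vv by (simp add: q_def)
    then have "v = 0" by (simp add: herm_self)
    then show ?thesis by (simp add: U_def H_def v_def)
  next
    case False
    have "herm (c *s a) v = of_real (t - 1)"
      by (simp add: v_def herm_diff_right ca_e ca_self)
    then have "2 * herm (c *s a) v = - of_real q" by (simp add: q_def)
    then have "2 * herm (c *s a) v / of_real q = -1"
      using False by simp
    then have "U a = c *s a - (-1) *s v" unfolding U_def H_def by simp
    also have "\<dots> = c *s a + v" by (simp add: vec_eq_iff)
    finally show ?thesis by (simp add: v_def)
  qed
  ultimately show thesis using that[of U] by (simp add: a_def)
qed

lemma coordinate_box_eq_box:
  fixes l u :: "complex ^ 'n"
  shows "{w :: complex ^ 'n. \<forall>j. Re (l $ j) < Re (w $ j) \<and> Re (w $ j) < Re (u $ j) \<and>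
      Im (l $ j) < Im (w $ j) \<and> Im (w $ j) < Im (u $ j)} = box l u"
  by (auto simp: box_def Basis_vec_def inner_axis Basis_complex_def)

lemma emeasure_coordinate_box:
  fixes l u :: "complex ^ 'n"
  assumes "\<And>j. Re (l $ j) \<le> Re (u $ j)" "\<And>j. Im (l $ j) \<le> Im (u $ j)"
  shows "emeasure lborel {w :: complex ^ 'n. \<forall>j. Re (l $ j) < Re (w $ j) \<and> Re (w $ j) < Re (u $ j) \<and>
      Im (l $ j) < Im (w $ j) \<and> Im (w $ j) < Im (u $ j)}
    = ennreal (\<Prod>j\<in>UNIV. (Re (u $ j) - Re (l $ j)) * (Im (u $ j) - Im (l $ j)))"
proof -
  have "{w :: complex ^ 'n. \<forall>j. Re (l $ j) < Re (w $ j) \<and> Re (w $ j) < Re (u $ j) \<and>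
      Im (l $ j) < Im (w $ j) \<and> Im (w $ j) < Im (u $ j)} = box l u"
    by (rule coordinate_box_eq_box)
  moreover have "emeasure lborel (box l u) = ennreal (\<Prod>b\<in>Basis. (u - l) \<bullet> b)"
    using assms by (intro emeasure_lborel_box) (auto simp: Basis_vec_def inner_axis Basis_complex_def)
  moreover have "(\<Prod>b\<in>Basis. (u - l) \<bullet> b) = (\<Prod>j\<in>UNIV. \<Prod>b\<in>Basis. (u - l) \<bullet> axis j b)"
    unfolding Basis_vec_def
    by (subst prod.UNION_disjoint) (auto simp: axis_eq_axis prod.UNION_disjoint)
  moreover have "(\<Prod>b\<in>Basis. (u - l) \<bullet> axis j b) = (Re (u $ j) - Re (l $ j)) * (Im (u $ j) - Im (l $ j))" for j
    by (simp add: inner_axis Basis_complex_def complex_eq_iff)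
  ultimately show ?thesis by simp
qed

lemma norm_vec_split:
  fixes w :: "complex ^ 'n"
  shows "(norm w)\<^sup>2 = (norm (w $ k))\<^sup>2 + (\<Sum>j\<in>UNIV - {k}. (norm (w $ j))\<^sup>2)"
proof -
  have "(norm w)\<^sup>2 = (\<Sum>j\<in>UNIV. (norm (w $ j))\<^sup>2)"
    by (simp add: norm_vec_def L2_set_def sum_nonneg)
  then show ?thesis by (simp add: sum.remove[of UNIV k])
qed

lemma qdist_axis: "qdist (axis k 1) w = norm (1 - w $ k)"
  by (subst qdist_commute) (simp add: qdist_def herm_axis)

lemma prod_distinguished:
  fixes k :: "'n::finite" and a b :: "'a::comm_monoid_mult"
  shows "(\<Prod>j\<in>UNIV. if j = k then a else b) = a * b ^ (CARD('n) - 1)"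
proof -
  have "(\<Prod>j\<in>UNIV. if j = k then a else b) = a * (\<Prod>j\<in>UNIV - {k}. if j = k then a else b)"
    by (subst prod.remove[of _ k]) auto
  also have "(\<Prod>j\<in>UNIV - {k}. if j = k then a else b) = (\<Prod>j\<in>UNIV - {k}. b)"
    by (intro prod.cong) auto
  finally show ?thesis by (simp add: card_Diff_singleton)
qed

lemma power_card_Suc: "0 < CARD('n::finite) \<Longrightarrow> (s::real) * s * s ^ (CARD('n) - 1) = s ^ (CARD('n) + 1)"
  by (cases "CARD('n)") auto

text \<open>
  For a unit vector \<open>e\<close> and \<open>0 < s < 1\<close>, \<open>cap e s\<close> is the Carleson tent over the point \<open>(1 - s) e\<close>, and \<open>cap_top e s\<close> is
  its part at height at least \<open>s / 4\<close>.
\<close>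

definition cap :: "complex ^ 'n \<Rightarrow> real \<Rightarrow> (complex ^ 'n) set"
  where "cap e s = {w \<in> ball 0 1. qdist e w < s}"

definition cap_top :: "complex ^ 'n \<Rightarrow> real \<Rightarrow> (complex ^ 'n) set"
  where "cap_top e s = {w \<in> ball 0 1. qdist e w < s \<and> s / 4 \<le> 1 - norm w}"

lemma continuous_qdist: "continuous_on S (qdist e)"
  unfolding qdist_def by (intro continuous_intros)

lemma borel_cap [measurable]: "cap e s \<in> sets borel"
proof -
  have [measurable]: "qdist e \<in> borel_measurable borel"
    by (intro borel_measurable_continuous_onI continuous_qdist)
  show ?thesis unfolding cap_def by measurable
qed

lemma borel_cap_top [measurable]: "cap_top e s \<in> sets borel"
proof -
  have [measurable]: "qdist e \<in> borel_measurable borel"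
    by (intro borel_measurable_continuous_onI continuous_qdist)
  show ?thesis unfolding cap_top_def by measurable
qed

lemma emeasure_cap_rotate:
  fixes e :: "complex ^ 'n" and k :: 'n
  assumes "norm e = 1"
  shows "emeasure lborel (cap e s) = emeasure lborel (cap (axis k 1) s)"
    and "emeasure lborel (cap_top e s) = emeasure lborel (cap_top (axis k 1) s)"
proof -
  obtain U :: "complex ^ 'n \<Rightarrow> complex ^ 'n" where U: "linear U"
    "\<And>x y. herm (U x) (U y) = herm x y" "U (axis k 1) = e" using exists_unitary[OF assms] by blast
  have norm: "norm (U x) = norm x" for x
  proof -
    have "complex_of_real ((norm (U x))\<^sup>2) = of_real ((norm x)\<^sup>2)"
      unfolding herm_self[symmetric] by (rule U)
    then show ?thesis by (simp only: of_real_eq_iff power2_eq_iff_nonneg norm_ge_zero)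
  qed
  have qd: "qdist e (U x) = qdist (axis k 1) x" for x
    using U(2)[of "axis k 1" x] U(3) by (simp add: qdist_def)
  have [measurable]: "U \<in> borel_measurable borel"
    using U by (intro borel_measurable_continuous_onI linear_continuous_on linear_conv_bounded_linear[THEN iffD1])
  have "emeasure lborel A = emeasure lborel (U -` A)" if "A \<in> sets borel" for A
  proof -
    have "emeasure lborel A = emeasure (distr lborel borel U) A"
      using distr_lborel_linear_isometry[OF U(1) norm] by simp
    then show ?thesis using that by (simp add: emeasure_distr)
  qed
  note this[OF borel_cap] this[OF borel_cap_top]
  moreover have "U -` cap e s = cap (axis k 1) s" "U -` cap_top e s = cap_top (axis k 1) s"
    by (auto simp: cap_def cap_top_def norm qd)
  ultimately show "emeasure lborel (cap e s) = emeasure lborel (cap (axis k 1) s)"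
    "emeasure lborel (cap_top e s) = emeasure lborel (cap_top (axis k 1) s)" by metis+
qed

text \<open>
  In a cap around the \<open>k\<close>-th axis the \<open>k\<close>-th coordinate lies within \<open>s\<close> of 1. By
  \<open>norm w < 1\<close>, the other coordinates are then at most \<open>sqrt (2 s)\<close>. The corresponding box has a volume of
  order \<open>s^2 * s^(n-1)\<close>.
\<close>

lemma emeasure_cap_le:
  fixes e :: "complex ^ 'n"
  assumes e: "norm e = 1" and s: "0 < s"
  shows "emeasure lborel (cap e s) \<le> ennreal (4 * 8 ^ (CARD('n) - 1) * s ^ (CARD('n) + 1))"
proof -
  obtain k :: 'n where True by blast
  define m where "m = sqrt (2 * s)"
  have m: "0 \<le> m" "m * m = 2 * s" using s by (auto simp: m_def)
  define l :: "complex ^ 'n" where "l = (\<chi> j. if j = k then Complex (1 - s) (- s) else Complex (- m) (- m))"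
  define u :: "complex ^ 'n" where "u = (\<chi> j. if j = k then Complex (1 + s) s else Complex m m)"
  let ?B = "{w :: complex ^ 'n. \<forall>j. Re (l $ j) < Re (w $ j) \<and> Re (w $ j) < Re (u $ j) \<and>
      Im (l $ j) < Im (w $ j) \<and> Im (w $ j) < Im (u $ j)}"
  have "cap (axis k 1) s \<subseteq> ?B"
  proof
    fix w :: "complex ^ 'n" assume w: "w \<in> cap (axis k 1) s"
    then have w1: "norm w < 1" and w2: "norm (1 - w $ k) < s" by (auto simp: cap_def qdist_axis)
    have k1: "\<bar>1 - Re (w $ k)\<bar> < s" "\<bar>Im (w $ k)\<bar> < s"
      using abs_Re_le_cmod[of "1 - w $ k"] abs_Im_le_cmod[of "1 - w $ k"] w2 by auto
    have j1: "\<bar>Re (w $ j)\<bar> < m" "\<bar>Im (w $ j)\<bar> < m" if "j \<noteq> k" for j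
    proof -
      have "(norm (w $ j))\<^sup>2 \<le> (\<Sum>j\<in>UNIV - {k}. (norm (w $ j))\<^sup>2)"
        using that by (intro member_le_sum) auto
      also have "\<dots> = (norm w)\<^sup>2 - (norm (w $ k))\<^sup>2" by (simp add: norm_vec_split[of w k])
      also have "\<dots> \<le> 1 - (norm (w $ k))\<^sup>2" using w1 by (simp add: power_le_one)
      also have "\<dots> \<le> 2 * (1 - norm (w $ k))"
        using zero_le_power2[of "1 - norm (w $ k)"] by (simp add: power2_eq_square algebra_simps)
      also have "\<dots> \<le> 2 * norm (1 - w $ k)"
        using norm_triangle_ineq2[of 1 "w $ k"] by simp
      also have "\<dots> < m\<^sup>2" using w2 m by (simp add: power2_eq_square)
      finally have "norm (w $ j) < m" using m by (simp add: power_less_imp_less_base)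
      then show "\<bar>Re (w $ j)\<bar> < m" "\<bar>Im (w $ j)\<bar> < m"
        using abs_Re_le_cmod[of "w $ j"] abs_Im_le_cmod[of "w $ j"] by linarith+
    qed
    have j2: "- m < Re (w $ j)" "Re (w $ j) < m" "- m < Im (w $ j)" "Im (w $ j) < m" if "j \<noteq> k" for j
      using j1[OF that] by linarith+
    have k2: "1 - s < Re (w $ k)" "Re (w $ k) < 1 + s" "- s < Im (w $ k)" "Im (w $ k) < s"
      using k1 by linarith+
    show "w \<in> ?B" using k2 j2 by (auto simp: l_def u_def)
  qed
  then have "emeasure lborel (cap (axis k 1) s) \<le> emeasure lborel ?B"
    by (rule emeasure_mono) (simp add: coordinate_box_eq_box)
  also have "\<dots> = ennreal (\<Prod>j\<in>UNIV. (Re (u $ j) - Re (l $ j)) * (Im (u $ j) - Im (l $ j)))"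
    by (rule emeasure_coordinate_box) (use s m in \<open>auto simp: l_def u_def\<close>)
  also have "(\<Prod>j\<in>UNIV. (Re (u $ j) - Re (l $ j)) * (Im (u $ j) - Im (l $ j)))
      = (\<Prod>j\<in>(UNIV::'n set). if j = k then 4 * (s * s) else 8 * s)"
    using m by (intro prod.cong) (auto simp: l_def u_def)
  also have "\<dots> = 4 * 8 ^ (CARD('n) - 1) * (s * s * s ^ (CARD('n) - 1))"
    by (simp add: prod_distinguished power_mult_distrib)
  also have "s * s * s ^ (CARD('n) - 1) = s ^ (CARD('n) + 1)" by (rule power_card_Suc) simp
  finally show ?thesis using emeasure_cap_rotate(1)[OF e] by metis
qed

text \<open>
  The box of the points whose \<open>k\<close>-th coordinate has real part between \<open>1 - 3s/4\<close> and \<open>1 - s/2\<close> and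
  imaginary part below \<open>\<delta> s\<close>, and whose other coordinates are below \<open>\<delta> sqrt s\<close>, lies in the upper part
  of the cap: \<open>\<delta>\<close> is chosen to satisfy \<open>2 n \<delta>^2 \<le> 1/8\<close>, which keeps \<open>norm w \<le> 1 - s/4\<close>.
\<close>

lemma emeasure_cap_top_ge:
  fixes e :: "complex ^ 'n"
  assumes e: "norm e = 1" and s: "0 < s" "s \<le> 1"
  defines "\<delta> \<equiv> 1 / (4 * real CARD('n))"
  shows "ennreal (\<delta> / 2 * (4 * \<delta>\<^sup>2) ^ (CARD('n) - 1) * s ^ (CARD('n) + 1)) \<le> emeasure lborel (cap_top e s)"
proof -
  obtain k :: 'n where True by blast
  define n where "n = real CARD('n)"
  have n: "1 \<le> n" using zero_less_card_finite[where 'a='n] by (simp add: n_def Suc_le_eq)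
  have \<delta>: "0 < \<delta>" "\<delta> \<le> 1 / 4" "2 * n * \<delta>\<^sup>2 \<le> 1 / 8"
    using n by (auto simp: \<delta>_def n_def[symmetric] field_simps power2_eq_square)
  define m where "m = \<delta> * sqrt s"
  have m: "0 \<le> m" "m * m = \<delta>\<^sup>2 * s" using s \<delta> by (auto simp: m_def power2_eq_square)
  define l :: "complex ^ 'n" where "l = (\<chi> j. if j = k then Complex (1 - 3 * s / 4) (- \<delta> * s) else Complex (- m) (- m))"
  define u :: "complex ^ 'n" where "u = (\<chi> j. if j = k then Complex (1 - s / 2) (\<delta> * s) else Complex m m)"
  let ?B = "{w :: complex ^ 'n. \<forall>j. Re (l $ j) < Re (w $ j) \<and> Re (w $ j) < Re (u $ j) \<and>
      Im (l $ j) < Im (w $ j) \<and> Im (w $ j) < Im (u $ j)}"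
  have sub: "?B \<subseteq> cap_top (axis k 1) s"
  proof
    fix w assume w: "w \<in> ?B"
    have k1: "1 - 3 * s / 4 < Re (w $ k)" "Re (w $ k) < 1 - s / 2" "\<bar>Im (w $ k)\<bar> < \<delta> * s"
      using w[simplified, rule_format, of k] by (auto simp: l_def u_def abs_less_iff)
    have j1: "(norm (w $ j))\<^sup>2 \<le> 2 * (\<delta>\<^sup>2 * s)" if "j \<noteq> k" for j
    proof -
      have "\<bar>Re (w $ j)\<bar> \<le> m" "\<bar>Im (w $ j)\<bar> \<le> m"
        using w[simplified, rule_format, of j] that by (auto simp: l_def u_def abs_le_iff)
      then have "(Re (w $ j))\<^sup>2 \<le> m\<^sup>2" "(Im (w $ j))\<^sup>2 \<le> m\<^sup>2" by (auto intro: power2_le_iff_abs_le[THEN iffD2] simp: m abs_le_square_iff)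
      moreover have "m\<^sup>2 = \<delta>\<^sup>2 * s" using m by (simp add: power2_eq_square)
      ultimately show ?thesis by (simp add: cmod_power2)
    qed
    have "norm (1 - w $ k) \<le> \<bar>Re (1 - w $ k)\<bar> + \<bar>Im (1 - w $ k)\<bar>" by (rule cmod_le)
    also have "\<dots> < 3 * s / 4 + \<delta> * s" using k1 s by simp
    also have "\<dots> \<le> 3 * s / 4 + 1 / 4 * s" using \<delta> s by (intro add_left_mono mult_right_mono) auto
    finally have q: "qdist (axis k 1) w < s" by (simp add: qdist_axis)
    have "\<bar>Im (w $ k)\<bar>\<^sup>2 \<le> (\<delta> * s)\<^sup>2" using k1 by (intro power_mono) auto
    moreover have "(Re (w $ k))\<^sup>2 \<le> (1 - s / 2)\<^sup>2" using k1 s by (intro power_mono) auto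
    ultimately have "(norm (w $ k))\<^sup>2 \<le> (1 - s / 2)\<^sup>2 + (\<delta> * s)\<^sup>2"
      by (simp add: cmod_power2)
    moreover have "(\<delta> * s)\<^sup>2 \<le> 2 * (\<delta>\<^sup>2 * s)"
      using s \<delta> by (simp add: power_mult_distrib power2_eq_square)
    moreover have "(\<Sum>j\<in>UNIV - {k}. (norm (w $ j))\<^sup>2) \<le> (\<Sum>j\<in>UNIV - {k}. 2 * (\<delta>\<^sup>2 * s))"
      using j1 by (intro sum_mono) auto
    moreover have "(\<Sum>j\<in>UNIV - {k}. 2 * (\<delta>\<^sup>2 * s)) = (n - 1) * (2 * (\<delta>\<^sup>2 * s))"
      by (simp add: card_Diff_singleton n_def of_nat_diff)
    ultimately have "(norm w)\<^sup>2 \<le> (1 - s / 2)\<^sup>2 + 2 * (\<delta>\<^sup>2 * s) + (n - 1) * (2 * (\<delta>\<^sup>2 * s))"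
      unfolding norm_vec_split[of w k] by linarith
    also have "\<dots> = (1 - s / 2)\<^sup>2 + 2 * n * \<delta>\<^sup>2 * s" by (simp add: algebra_simps)
    also have "\<dots> \<le> (1 - s / 2)\<^sup>2 + 1 / 8 * s"
      using \<delta> s by (intro add_left_mono mult_right_mono) auto
    also have "\<dots> \<le> (1 - s / 4)\<^sup>2"
    proof -
      have "s * s \<le> s * 1" using s by (intro mult_left_mono) auto
      moreover have "(1 - s / 4)\<^sup>2 - ((1 - s / 2)\<^sup>2 + 1 / 8 * s) = 3 / 8 * s - 3 / 16 * (s * s)"
        by (simp add: power2_eq_square algebra_simps)
      ultimately show ?thesis using s by linarith
    qed
    finally have "norm w \<le> 1 - s / 4" by (rule power2_le_imp_le) (use s in simp)
    then show "w \<in> cap_top (axis k 1) s" using q s by (auto simp: cap_top_def)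
  qed
  have "\<delta> / 2 * (4 * \<delta>\<^sup>2) ^ (CARD('n) - 1) * s ^ (CARD('n) + 1)
      = (\<delta> / 2) * (4 * \<delta>\<^sup>2) ^ (CARD('n) - 1) * (s * s * s ^ (CARD('n) - 1))"
    by (simp only: power_card_Suc[OF zero_less_card_finite])
  also have "\<dots> = (\<Prod>j\<in>(UNIV::'n set). if j = k then \<delta> / 2 * (s * s) else 4 * (\<delta>\<^sup>2 * s))"
    by (simp add: prod_distinguished power_mult_distrib)
  also have "\<dots> = (\<Prod>j\<in>UNIV. (Re (u $ j) - Re (l $ j)) * (Im (u $ j) - Im (l $ j)))"
    using m by (intro prod.cong) (auto simp: l_def u_def field_simps)
  also have "ennreal \<dots> = emeasure lborel ?B"
    by (rule emeasure_coordinate_box[symmetric]) (use s m \<delta> in \<open>auto simp: l_def u_def\<close>)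
  also have "\<dots> \<le> emeasure lborel (cap_top (axis k 1) s)" by (intro emeasure_mono sub) simp
  finally show ?thesis using emeasure_cap_rotate(2)[OF e] by metis
qed

section \<open>The unit ball as a tent geometry\<close>

definition ball_volume :: "'n::finite itself \<Rightarrow> real"
  where "ball_volume _ = measure lborel (ball (0 :: complex ^ 'n) 1)"

lemma ball_volume_pos: "0 < ball_volume TYPE('n::finite)"
  using content_ball_pos[of 1 "0 :: complex ^ 'n"] by (simp add: ball_volume_def)

lemma emeasure_unit_ball: "emeasure lborel (ball (0 :: complex ^ 'n) 1) = ennreal (ball_volume TYPE('n))"
  using emeasure_lborel_ball_finite[of "0 :: complex ^ 'n" 1]
  by (simp add: ball_volume_def emeasure_eq_ennreal_measure less_top)

lemma space_V [simp]: "space V = ball 0 1"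
  by (simp add: V_def)

lemma sets_V: "sets V = sets (lebesgue_on (ball 0 1))"
  by (simp add: V_def)

lemma borel_imp_sets_V: "A \<in> sets borel \<Longrightarrow> A \<subseteq> ball 0 1 \<Longrightarrow> A \<in> sets V"
  by (auto simp: sets_V sets_restrict_space)

lemma emeasure_V:
  fixes A :: "(complex ^ 'n) set"
  assumes "A \<in> sets borel" "A \<subseteq> ball 0 1"
  shows "emeasure V A = emeasure lborel A / ennreal (ball_volume TYPE('n))"
proof -
  have "A \<in> sets (lebesgue_on (ball 0 1))" using borel_imp_sets_V[OF assms] by (simp add: sets_V)
  then have "emeasure V A = emeasure (lebesgue_on (ball 0 1)) (ball 0 1 \<inter> A) / emeasure (lebesgue_on (ball 0 1)) (ball (0 :: complex ^ 'n) 1)"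
    unfolding V_def by (intro emeasure_uniform_measure) (auto simp: sets_restrict_space)
  also have "ball 0 1 \<inter> A = A" using assms by blast
  finally show ?thesis
    using assms by (simp add: emeasure_restrict_space emeasure_unit_ball)
qed

lemma emeasure_V_space: "emeasure V (ball (0 :: complex ^ 'n) 1) = 1"
  using ball_volume_pos[where 'n='n]
  by (simp add: emeasure_V emeasure_unit_ball divide_ennreal)

lemma finite_measure_V: "finite_measure (V :: (complex ^ 'n) measure)"
  by (rule finite_measureI) (simp add: emeasure_V_space)

lemma emeasure_V_le_1: "emeasure V A \<le> 1"
  using emeasure_space[of V A] by (simp add: emeasure_V_space)

lemma measurable_V_borel [measurable]: "(\<lambda>x. x) \<in> V \<rightarrow>\<^sub>M borel"
proof (rule measurableI)
  fix A :: "(complex ^ 'n) set" assume "A \<in> sets borel"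
  then show "(\<lambda>x. x) -` A \<inter> space V \<in> sets V" by (intro borel_imp_sets_V) auto
qed simp

lemma borel_measurable_V: "f \<in> borel_measurable borel \<Longrightarrow> f \<in> borel_measurable V"
  using measurable_compose[OF measurable_V_borel] by simp

text \<open>
  The constants of \<open>emeasure_cap_top_ge\<close> and \<open>emeasure_cap_le\<close>, normalised. The power of 6 is there
  because a quasiball of radius \<open>s\<close> around an interior point lies in a cap of radius \<open>6 s\<close>.
\<close>

definition lower_const :: "'n::finite itself \<Rightarrow> real"
  where "lower_const _ = 1 / (4 * real CARD('n)) / 2 * (4 * (1 / (4 * real CARD('n)))\<^sup>2) ^ (CARD('n) - 1)
    / ball_volume TYPE('n)"

definition upper_const :: "'n::finite itself \<Rightarrow> real"
  where "upper_const _ = 4 * 8 ^ (CARD('n) - 1) * 6 ^ (CARD('n) + 1) / ball_volume TYPE('n)"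

text \<open>
  Polar coordinates that also cover the origin, for which any unit vector will do.
\<close>

lemma exists_direction:
  fixes x :: "complex ^ 'n"
  assumes "norm x < 1"
  obtains e :: "complex ^ 'n" where "norm e = 1" "x = norm x *\<^sub>R e" "qdist e x = 1 - norm x"
proof -
  define e where "e = (if x = 0 then axis undefined 1 else x /\<^sub>R norm x)"
  have e: "norm e = 1" "x = norm x *\<^sub>R e" by (auto simp: e_def norm_axis_1)
  have "herm e x = of_real (norm x) * herm e e"
    by (subst e(2), subst herm_commute) (simp add: herm_scaleR_left herm_self)
  then have "qdist e x = norm (complex_of_real (1 - norm x))" using e by (simp add: qdist_def herm_self)
  also have "\<dots> = \<bar>1 - norm x\<bar>" by (rule norm_of_real)
  finally show thesis using e that assms by auto
qed

lemma emeasure_V_cap_le: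
  fixes e :: "complex ^ 'n"
  assumes "norm e = 1" "0 < s"
  shows "emeasure V (cap e s) \<le> ennreal (4 * 8 ^ (CARD('n) - 1) / ball_volume TYPE('n) * s ^ (CARD('n) + 1))"
proof -
  have "emeasure V (cap e s) = emeasure lborel (cap e s) / ennreal (ball_volume TYPE('n))"
    by (rule emeasure_V[OF borel_cap]) (auto simp: cap_def)
  also have "\<dots> \<le> ennreal (4 * 8 ^ (CARD('n) - 1) * s ^ (CARD('n) + 1)) / ennreal (ball_volume TYPE('n))"
    by (intro divide_right_mono_ennreal emeasure_cap_le assms)
  also have "\<dots> = ennreal (4 * 8 ^ (CARD('n) - 1) / ball_volume TYPE('n) * s ^ (CARD('n) + 1))"
    using assms ball_volume_pos[where 'n='n] by (simp add: divide_ennreal)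
  finally show ?thesis .
qed

lemma quasiball_subset_cap:
  assumes x: "norm x < 1" and e: "norm e = 1" "qdist e x = 1 - norm x" and s: "1 - norm x \<le> s"
  shows "{y \<in> ball 0 1. qdist x y < s} \<subseteq> cap e (6 * s)"
proof
  fix y assume y: "y \<in> {y \<in> ball 0 1. qdist x y < s}"
  then have "qdist e y \<le> 3 * (qdist e x + qdist x y)" using x e by (intro qdist_triangle) auto
  then show "y \<in> cap e (6 * s)" using y e s by (auto simp: cap_def)
qed

text \<open>
  An interior point \<open>x\<close> with \<open>1 - norm x \<le> s\<close> is within \<open>qdist\<close>-distance \<open>s\<close> of its radial projection
  \<open>e\<close> to the sphere, so quasiballs around \<open>x\<close> are comparable to caps around \<open>e\<close>.
\<close>

interpretation ball: tent_geometry "V :: (complex ^ 'n) measure" qdist "\<lambda>z. 1 - norm z" "CARD('n) + 1"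
  "lower_const TYPE('n)" "upper_const TYPE('n)"
proof -
  interpret finite_measure "V :: (complex ^ 'n) measure" by (rule finite_measure_V)
  show "tent_geometry (V :: (complex ^ 'n) measure) qdist (\<lambda>z. 1 - norm z) (CARD('n) + 1)
    (lower_const TYPE('n)) (upper_const TYPE('n))"
  proof
    have "continuous_on UNIV (\<lambda>x::(complex^'n) \<times> (complex^'n). qdist (fst x) (snd x))"
      unfolding qdist_def by (intro continuous_intros)
    then have "(\<lambda>x::(complex^'n) \<times> (complex^'n). qdist (fst x) (snd x)) \<in> borel_measurable (borel \<Otimes>\<^sub>M borel)"
      unfolding borel_prod by (rule borel_measurable_continuous_onI)
    moreover have "(\<lambda>x. (fst x, snd x)) \<in> (V :: (complex^'n) measure) \<Otimes>\<^sub>M (V :: (complex^'n) measure) \<rightarrow>\<^sub>M borel \<Otimes>\<^sub>M borel"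
      by (intro measurable_Pair measurable_compose[OF measurable_fst measurable_V_borel]
          measurable_compose[OF measurable_snd measurable_V_borel])
    ultimately show "(\<lambda>x. qdist (fst x) (snd x)) \<in> borel_measurable ((V :: (complex^'n) measure) \<Otimes>\<^sub>M V)"
      using measurable_compose by fastforce
    show "(\<lambda>z. 1 - norm z) \<in> borel_measurable (V :: (complex^'n) measure)" by measurable
    fix x y z :: "complex ^ 'n" and s :: real
    have "{y \<in> space V. qdist x y < s} = ball 0 1 \<inter> {y. qdist x y < s}" by auto
    then show "open {y \<in> space V. qdist x y < s}"
      by (simp add: open_Int open_Collect_less continuous_qdist)
    show "0 < lower_const TYPE('n)" "0 < upper_const TYPE('n)"
      using ball_volume_pos[where 'n='n] by (simp_all add: lower_const_def upper_const_def)
    show "1 - norm x \<le> 1" by simp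
    assume x: "x \<in> space V"
    show "0 < 1 - norm x" using x by simp
    obtain e where e: "norm e = 1" "x = norm x *\<^sub>R e" "qdist e x = 1 - norm x"
      using exists_direction[of x] x by auto
    have cap_sub: "{y \<in> ball 0 1. qdist x y < s} \<subseteq> cap e (6 * s)" if "1 - norm x \<le> s"
      using x e that by (intro quasiball_subset_cap) auto
    show "emeasure V {y \<in> space V. qdist x y < s} \<le> ennreal (upper_const TYPE('n) * s ^ (CARD('n) + 1))" if s: "0 < s"
    proof (cases "1 - norm x \<le> s")
      case True
      have "emeasure V {y \<in> space V. qdist x y < s} \<le> emeasure V (cap e (6 * s))"
        using cap_sub[OF True]
        by (intro emeasure_mono borel_imp_sets_V[OF borel_cap]) (simp, auto simp: cap_def)
      also have "\<dots> \<le> ennreal (4 * 8 ^ (CARD('n) - 1) / ball_volume TYPE('n) * (6 * s) ^ (CARD('n) + 1))"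
        using e s by (intro emeasure_V_cap_le) auto
      also have "4 * 8 ^ (CARD('n) - 1) / ball_volume TYPE('n) * (6 * s) ^ (CARD('n) + 1)
          = upper_const TYPE('n) * s ^ (CARD('n) + 1)"
        by (simp only: upper_const_def power_mult_distrib) simp
      finally show ?thesis .
    next
      case False
      then have "s \<le> qdist x y" if "norm y < 1" for y
        using qdist_ge_left[of x y] that x by simp
      then have "{y \<in> space V. qdist x y < s} = {}" by (auto simp: not_less[symmetric])
      then show ?thesis by (simp only: emeasure_empty zero_le)
    qed
    show "ennreal (lower_const TYPE('n) * s ^ (CARD('n) + 1))
        \<le> emeasure V {y \<in> space V. qdist x y < 6 * s \<and> s / 4 \<le> 1 - norm y \<and> 1 - norm y < s}"
      if s: "1 - norm x \<le> s" "s \<le> 1"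
    proof -
      have s0: "0 < s" using s x by simp
      have "lower_const TYPE('n) * s ^ (CARD('n) + 1) = 1 / (4 * real CARD('n)) / 2 *
          (4 * (1 / (4 * real CARD('n)))\<^sup>2) ^ (CARD('n) - 1) * s ^ (CARD('n) + 1) / ball_volume TYPE('n)"
        by (simp add: lower_const_def)
      then have "ennreal (lower_const TYPE('n) * s ^ (CARD('n) + 1)) = ennreal (1 / (4 * real CARD('n)) / 2 *
          (4 * (1 / (4 * real CARD('n)))\<^sup>2) ^ (CARD('n) - 1) * s ^ (CARD('n) + 1)) / ennreal (ball_volume TYPE('n))"
        using s0 ball_volume_pos[where 'n='n] by (simp only:) (subst divide_ennreal, auto)
      also have "\<dots> \<le> emeasure lborel (cap_top e s) / ennreal (ball_volume TYPE('n))"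
        using e s s0 by (intro divide_right_mono_ennreal emeasure_cap_top_ge) auto
      also have "\<dots> = emeasure V (cap_top e s)"
        by (rule emeasure_V[OF borel_cap_top, symmetric]) (auto simp: cap_top_def)
      also have "\<dots> \<le> emeasure V {y \<in> space V. qdist x y < 6 * s \<and> s / 4 \<le> 1 - norm y \<and> 1 - norm y < s}"
      proof (rule emeasure_mono)
        show "cap_top e s \<subseteq> {y \<in> space V. qdist x y < 6 * s \<and> s / 4 \<le> 1 - norm y \<and> 1 - norm y < s}"
        proof
          fix y assume y: "y \<in> cap_top e s"
          then have "qdist x y \<le> 3 * (qdist x e + qdist e y)"
            using x e by (intro qdist_triangle) (auto simp: cap_top_def)
          moreover have "1 - norm y \<le> qdist e y"
            using y e qdist_ge_left[of y e] by (auto simp: cap_top_def qdist_commute)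
          ultimately show "y \<in> {y \<in> space V. qdist x y < 6 * s \<and> s / 4 \<le> 1 - norm y \<and> 1 - norm y < s}"
            using y e s by (auto simp: cap_top_def qdist_commute[of x e])
        qed
        have [measurable]: "qdist x \<in> borel_measurable V"
          by (intro borel_measurable_V borel_measurable_continuous_onI continuous_qdist)
        show "{y \<in> space V. qdist x y < 6 * s \<and> s / 4 \<le> 1 - norm y \<and> 1 - norm y < s} \<in> sets V"
          by measurable
      qed
      finally show ?thesis .
    qed
    assume y: "y \<in> space V"
    show "1 - norm x \<le> qdist x y" "qdist x y \<le> 2"
      using x y by (auto intro!: qdist_ge_left qdist_le_2)
    show "qdist x y = qdist y x" by (rule qdist_commute)
    assume "z \<in> space V"
    then show "qdist x z \<le> 3 * (qdist x y + qdist y z)" using x y by (intro qdist_triangle) auto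
  qed
qed

section \<open>Averages over tents and over quasiballs\<close>

lemma tent_eq_cap: "z \<noteq> 0 \<Longrightarrow> tent z = cap (z /\<^sub>R norm z) (1 - norm z)"
  by (simp add: tent_def cap_def qdist_def)

lemma sets_tent [measurable]: "tent z \<in> sets V"
proof (cases "z = 0")
  case True
  then have "tent z = space V" by (simp add: tent_def)
  then show ?thesis by (metis sets.top)
next
  case False
  have "cap (z /\<^sub>R norm z) (1 - norm z) \<in> sets V"
    by (rule borel_imp_sets_V[OF borel_cap]) (auto simp: cap_def)
  then show ?thesis using False by (simp add: tent_eq_cap)
qed

definition tent_const :: "'n::finite itself \<Rightarrow> real"
  where "tent_const _ = max 1 (4 * 8 ^ (CARD('n) - 1) / ball_volume TYPE('n))"

lemma tent_const_ge_1: "1 \<le> tent_const TYPE('n::finite)"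
  by (simp add: tent_const_def)

lemma emeasure_tent_le:
  fixes z :: "complex ^ 'n"
  assumes "norm z < 1"
  shows "emeasure V (tent z) \<le> ennreal (tent_const TYPE('n) * (1 - norm z) ^ (CARD('n) + 1))"
proof (cases "z = 0")
  case True
  have "emeasure V (tent z) \<le> 1" by (rule emeasure_V_le_1)
  also have "\<dots> \<le> ennreal (tent_const TYPE('n))" using tent_const_ge_1[where 'n='n] by simp
  finally show ?thesis using True by simp
next
  case False
  have "emeasure V (tent z) \<le> ennreal (4 * 8 ^ (CARD('n) - 1) / ball_volume TYPE('n) * (1 - norm z) ^ (CARD('n) + 1))"
    unfolding tent_eq_cap[OF False] using assms False by (intro emeasure_V_cap_le) auto
  also have "\<dots> \<le> ennreal (tent_const TYPE('n) * (1 - norm z) ^ (CARD('n) + 1))"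
    using assms by (intro ennreal_leI mult_right_mono) (auto simp: tent_const_def)
  finally show ?thesis .
qed

lemma mass_le_average:
  assumes "A \<in> sets V"
  shows "(\<integral>\<^sup>+w. ennreal (f w) * indicator A w \<partial>V) \<le> average f A * emeasure V A"
proof (cases "emeasure V A = 0")
  case True
  then have "AE w in V. w \<notin> A" using assms by (intro AE_not_in) (auto simp: null_sets_def)
  then have "AE w in V. ennreal (f w) * indicator A w = 0" by eventually_elim simp
  from nn_integral_cong_AE[OF this] show ?thesis by simp
next
  case False
  moreover have "emeasure V A \<noteq> \<infinity>"
    using emeasure_V_le_1[of A] by (auto simp: top_unique)
  ultimately show ?thesis
    by (simp add: average_def ennreal_divide_times ennreal_divide_self less_top)
qed

text \<open>
  Once the radius \<open>6 t\<close> of the cap reaches 1, the tent over the origin, which is the whole ball, takes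
  its place.
\<close>

lemma quasiball_subset_tent:
  assumes x: "x \<in> ball 0 1" and t: "1 - norm x \<le> t"
  obtains z where "z \<in> ball 0 1" "ball.Q x t \<subseteq> tent z" "1 - norm z \<le> 6 * t"
proof (cases "6 * t < 1")
  case True
  have t0: "0 < t" using x t by simp
  obtain e where e: "norm e = 1" "x = norm x *\<^sub>R e" "qdist e x = 1 - norm x"
    using exists_direction[of x] x by auto
  define z where "z = (1 - 6 * t) *\<^sub>R e"
  have z: "norm z = 1 - 6 * t" "z \<noteq> 0" using True e by (auto simp: z_def)
  then have "z /\<^sub>R norm z = e" using True by (simp add: z_def)
  then have "tent z = cap e (6 * t)" using z by (simp add: tent_eq_cap)
  moreover have "ball.Q x t \<subseteq> cap e (6 * t)"
    unfolding ball.Q_def space_V by (rule quasiball_subset_cap) (use x e t in auto)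
  ultimately show thesis using z t0 that[of z] by auto
next
  case False
  then show thesis by (intro that[of 0]) (auto simp: tent_def ball.Q_def)
qed

lemma Bp_class_quasiballs:
  fixes \<sigma> :: "complex ^ 'n \<Rightarrow> real"
  assumes p: "1 < p" and \<sigma>: "\<sigma> \<in> Bp_class p"
  obtains K where "0 < K" and "\<And>x t. x \<in> space V \<Longrightarrow> 1 - norm x \<le> t \<Longrightarrow>
      ball.mass (\<lambda>y. ennreal (\<sigma> y)) (ball.Q x t) *
      ennreal_powr (ball.mass (\<lambda>y. ennreal (\<sigma> y powr (1 - p / (p - 1)))) (ball.Q x t)) (p - 1)
        \<le> ennreal (K * t powr (real (CARD('n) + 1) * p))"
proof -
  define N where "N = CARD('n) + 1"
  define s' where "s' w = \<sigma> w powr (1 - p / (p - 1))" for w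
  have "Bp_const p \<sigma> < \<infinity>" using \<sigma> by (simp add: Bp_class_def)
  then obtain k where k: "0 < k" "Bp_const p \<sigma> \<le> ennreal k" by (rule ennreal_less_top_obtain)
  define T where "T = tent_const TYPE('n)"
  have T: "0 < T" using tent_const_ge_1[where 'n='n] by (simp add: T_def)
  show thesis
  proof (rule that)
    show "0 < k * (T * 6 ^ N) powr p" using k T by simp
    fix x :: "complex ^ 'n" and t assume x: "x \<in> space V" "1 - norm x \<le> t"
    then have t: "0 < t" by simp
    obtain z where z: "z \<in> ball 0 1" "ball.Q x t \<subseteq> tent z" "1 - norm z \<le> 6 * t"
      using quasiball_subset_tent[of x t] x by auto
    let ?m = "ball.mass (\<lambda>y. ennreal (\<sigma> y))" and ?m' = "ball.mass (\<lambda>y. ennreal (s' y))"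
    have "?m (ball.Q x t) * ennreal_powr (?m' (ball.Q x t)) (p - 1)
        \<le> ?m (tent z) * ennreal_powr (?m' (tent z)) (p - 1)"
      using p by (intro mult_mono ennreal_powr_mono ball.mass_mono z) auto
    also have "\<dots> \<le> (average \<sigma> (tent z) * emeasure V (tent z)) *
        ennreal_powr (average s' (tent z) * emeasure V (tent z)) (p - 1)"
      using p by (intro mult_mono ennreal_powr_mono mass_le_average) auto
    also have "\<dots> = (average \<sigma> (tent z) * ennreal_powr (average s' (tent z)) (p - 1)) *
        (ennreal_powr (emeasure V (tent z)) 1 * ennreal_powr (emeasure V (tent z)) (p - 1))"
      using p by (simp add: ennreal_powr_mult mult_ac)
    also have "ennreal_powr (emeasure V (tent z)) 1 * ennreal_powr (emeasure V (tent z)) (p - 1)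
        = ennreal_powr (emeasure V (tent z)) p"
      using p ennreal_powr_add[of 1 "p - 1"] by simp
    also have "(average \<sigma> (tent z) * ennreal_powr (average s' (tent z)) (p - 1)) * ennreal_powr (emeasure V (tent z)) p
        \<le> ennreal k * ennreal_powr (ennreal (T * (6 * t) ^ N)) p"
    proof (intro mult_mono ennreal_powr_mono)
      have "average \<sigma> (tent z) * ennreal_powr (average s' (tent z)) (p - 1) \<le> Bp_const p \<sigma>"
        unfolding Bp_const_def s'_def by (rule SUP_upper[OF z(1)])
      then show "average \<sigma> (tent z) * ennreal_powr (average s' (tent z)) (p - 1) \<le> ennreal k"
        using k(2) by (rule order_trans)
      have "emeasure V (tent z) \<le> ennreal (T * (1 - norm z) ^ N)"
        using z emeasure_tent_le[of z] by (simp add: T_def N_def)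
      also have "\<dots> \<le> ennreal (T * (6 * t) ^ N)"
        using z T by (intro ennreal_leI mult_left_mono power_mono) auto
      finally show "emeasure V (tent z) \<le> ennreal (T * (6 * t) ^ N)" .
    qed (use p in auto)
    also have "\<dots> = ennreal (k * (T * 6 ^ N) powr p * t powr (real N * p))"
    proof -
      have "(T * (6 * t) ^ N) powr p = (T * 6 ^ N) powr p * t powr (real N * p)"
        using t T by (simp add: power_mult_distrib powr_mult powr_powr powr_realpow[symmetric])
      then show ?thesis using k T t by (simp add: ennreal_powr_ennreal ennreal_mult[symmetric] mult.assoc)
    qed
    finally show "?m (ball.Q x t) * ennreal_powr (ball.mass (\<lambda>y. ennreal (\<sigma> y powr (1 - p / (p - 1)))) (ball.Q x t)) (p - 1)
        \<le> ennreal (k * (T * 6 ^ N) powr p * t powr (real (CARD('n) + 1) * p))"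
      by (simp add: s'_def N_def)
  qed
qed


text \<open>
  The normalised volume of the tent over the origin is 1.
\<close>

lemma nn_integral_V_eq_average:
  "(\<integral>\<^sup>+w. ennreal (f w) \<partial>V) = average f (tent 0)"
proof -
  have "(\<integral>\<^sup>+w. ennreal (f w) \<partial>V) = (\<integral>\<^sup>+w. ennreal (f w) * indicator (tent 0) w \<partial>V)"
    by (intro nn_integral_cong) (simp add: tent_def)
  then show ?thesis by (simp add: average_def tent_def emeasure_V_space divide_ennreal_def)
qed

lemma average_weight_pos:
  assumes [measurable]: "f \<in> borel_measurable V" and "AE w in V. 0 < f w"
  shows "average f (tent (0 :: complex ^ 'n)) \<noteq> 0"
proof
  assume "average f (tent (0 :: complex ^ 'n)) = 0"
  then have "AE w in V. ennreal (f w) = 0"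
    unfolding nn_integral_V_eq_average[symmetric] by (simp add: nn_integral_0_iff_AE)
  then have "AE w in (V :: (complex ^ 'n) measure). False"
    using assms(2) by eventually_elim (simp add: ennreal_eq_0_iff)
  then have "emeasure V (space (V :: (complex ^ 'n) measure)) = 0"
    by (simp add: ae_filter_eq_bot_iff[symmetric] trivial_limit_def del: space_V)
  then show False by (simp add: emeasure_V_space)
qed

text \<open>
  The tent over the origin makes the product of both integrals finite. Neither factor is 0, so each
  of them is finite.
\<close>

lemma Bp_class_integrable:
  fixes \<sigma> :: "complex ^ 'n \<Rightarrow> real"
  assumes p: "1 < p" and \<sigma>: "\<sigma> \<in> Bp_class p"
  shows "(\<integral>\<^sup>+w. ennreal (\<sigma> w) \<partial>V) < \<infinity>"
    and "(\<integral>\<^sup>+w. ennreal (\<sigma> w powr (1 - p / (p - 1))) \<partial>V) < \<infinity>"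
proof -
  define s' where "s' w = \<sigma> w powr (1 - p / (p - 1))" for w
  have s'_eq: "s' = (\<lambda>w. \<sigma> w powr (1 - p / (p - 1)))" by (simp add: fun_eq_iff s'_def)
  have meas [measurable]: "\<sigma> \<in> borel_measurable V" and pos: "AE w in V. 0 < \<sigma> w"
    using \<sigma> by (auto simp: Bp_class_def weight_def)
  have [measurable]: "s' \<in> borel_measurable V" unfolding s'_def by measurable
  have pos': "AE w in V. 0 < s' w" using pos by eventually_elim (simp add: s'_def)
  have "average \<sigma> (tent 0) * ennreal_powr (average s' (tent 0)) (p - 1) \<le> Bp_const p \<sigma>"
    unfolding Bp_const_def s'_def by (rule SUP_upper) simp
  also have "\<dots> < \<infinity>" using \<sigma> by (simp add: Bp_class_def)
  finally have "average \<sigma> (tent 0) * ennreal_powr (average s' (tent 0)) (p - 1) < top" by simp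
  then have "average \<sigma> (tent 0) < top" "average s' (tent 0) < top"
    using average_weight_pos[OF meas pos] average_weight_pos[OF _ pos']
    by (auto simp: ennreal_mult_less_top)
  then show "(\<integral>\<^sup>+w. ennreal (\<sigma> w) \<partial>V) < \<infinity>"
    "(\<integral>\<^sup>+w. ennreal (\<sigma> w powr (1 - p / (p - 1))) \<partial>V) < \<infinity>"
    by (simp_all add: nn_integral_V_eq_average s'_eq)
qed

lemma B1_class_tent:
  fixes \<sigma> :: "complex ^ 'n \<Rightarrow> real"
  assumes \<sigma>: "\<sigma> \<in> B1_class" and B1: "B1_const \<sigma> \<le> ennreal k" and z: "z \<in> ball 0 1"
  shows "AE v in V. v \<in> tent z \<longrightarrow> average \<sigma> (tent z) \<le> ennreal k * ennreal (\<sigma> v)"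
proof -
  have pos: "AE w in V. 0 < \<sigma> w" using \<sigma> by (auto simp: B1_class_def weight_def)
  let ?e = "esssup (restrict_space V (tent z)) (\<lambda>w. ennreal (inverse (\<sigma> w)))"
  have "average \<sigma> (tent z) * ?e \<le> B1_const \<sigma>" unfolding B1_const_def by (rule SUP_upper[OF z])
  then have le: "average \<sigma> (tent z) * ?e \<le> ennreal k" using B1 by (rule order_trans)
  have "AE w in restrict_space V (tent z). ennreal (inverse (\<sigma> w)) \<le> ?e" by (rule esssup_AE)
  then have "AE w in V. w \<in> tent z \<longrightarrow> ennreal (inverse (\<sigma> w)) \<le> ?e"
    by (subst (asm) AE_restrict_space_iff) (use sets.Int[OF sets.top sets_tent] in \<open>auto simp: Int_commute\<close>)
  with pos show ?thesis
  proof eventually_elim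
    fix v assume v: "0 < \<sigma> v" "v \<in> tent z \<longrightarrow> ennreal (inverse (\<sigma> v)) \<le> ?e"
    show "v \<in> tent z \<longrightarrow> average \<sigma> (tent z) \<le> ennreal k * ennreal (\<sigma> v)"
    proof
      assume "v \<in> tent z"
      then have "average \<sigma> (tent z) * ennreal (inverse (\<sigma> v)) \<le> average \<sigma> (tent z) * ?e"
        using v by (intro mult_left_mono) auto
      then have "average \<sigma> (tent z) * ennreal (inverse (\<sigma> v)) \<le> ennreal k" using le by (rule order_trans)
      then have "average \<sigma> (tent z) * ennreal (inverse (\<sigma> v)) * ennreal (\<sigma> v) \<le> ennreal k * ennreal (\<sigma> v)"
        by (rule mult_right_mono) simp
      moreover have "ennreal (inverse (\<sigma> v)) * ennreal (\<sigma> v) = 1"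
        using v by (simp add: ennreal_mult[symmetric])
      ultimately show "average \<sigma> (tent z) \<le> ennreal k * ennreal (\<sigma> v)"
        by (simp only: mult.assoc mult_1_right)
    qed
  qed
qed

text \<open>
  The exceptional null set of the \<open>B_1\<close> condition depends on the tent, so only countably many tents can
  be used at once. A quasiball of radius \<open>t\<close> lies in the cap of radius \<open>6 t\<close> in the direction \<open>e\<close>. This leaves
  room to perturb the vertex \<open>(1 - 15/2 t) e\<close> of a slightly larger tent to a point of a dense set, keeping the
  height between \<open>7 t\<close> and \<open>8 t\<close> and moving the direction by less than \<open>t\<close>.
\<close>

lemma tent_near_quasiball:
  fixes v :: "complex ^ 'n"
  assumes v: "norm v < 1" and t: "1 - norm v \<le> t" "8 * t < 1"
    and dense: "\<And>X :: (complex ^ 'n) set. open X \<Longrightarrow> X \<noteq> {} \<Longrightarrow> \<exists>d\<in>A. d \<in> X"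
  obtains z where "z \<in> A" "z \<in> ball 0 1" "v \<in> tent z" "ball.Q v t \<subseteq> tent z" "1 - norm z \<le> 8 * t"
proof -
  have t0: "0 < t" using v t by simp
  obtain e where e: "norm e = 1" "v = norm v *\<^sub>R e" "qdist e v = 1 - norm v"
    using exists_direction[OF v] by auto
  define c where "c = (1 - 15 / 2 * t) *\<^sub>R e"
  have c: "norm c = 1 - 15 / 2 * t" "c \<noteq> 0" using t t0 e by (auto simp: c_def)
  have "c /\<^sub>R norm c = e" using c t by (simp add: c_def)
  moreover have "((\<lambda>z. z /\<^sub>R norm z) \<longlongrightarrow> c /\<^sub>R norm c) (nhds c)"
    using c by (intro tendsto_intros filterlim_ident) auto
  ultimately have 1: "\<forall>\<^sub>F z in nhds c. dist (z /\<^sub>R norm z) e < t"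
    using t0 by (auto dest: tendstoD)
  have lim: "(norm \<longlongrightarrow> norm c) (nhds c)" by (intro tendsto_norm filterlim_ident)
  have 2: "\<forall>\<^sub>F z in nhds c. norm z < 1 - 7 * t" by (rule order_tendstoD(2)[OF lim]) (use c t0 in simp)
  have 3: "\<forall>\<^sub>F z in nhds c. 1 - 8 * t < norm z" by (rule order_tendstoD(1)[OF lim]) (use c t0 in simp)
  from 1 2 3 have "\<forall>\<^sub>F z in nhds c. dist (z /\<^sub>R norm z) e < t \<and> norm z < 1 - 7 * t \<and> 1 - 8 * t < norm z"
    by eventually_elim simp
  then obtain X where X: "open X" "c \<in> X"
    "\<And>z. z \<in> X \<Longrightarrow> dist (z /\<^sub>R norm z) e < t \<and> norm z < 1 - 7 * t \<and> 1 - 8 * t < norm z"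
    unfolding eventually_nhds by blast
  then obtain z where z: "z \<in> A" "dist (z /\<^sub>R norm z) e < t" "norm z < 1 - 7 * t" "1 - 8 * t < norm z"
    using dense[of X] by blast
  have z0: "z \<noteq> 0" using z t by auto
  define e' where "e' = z /\<^sub>R norm z"
  have near: "qdist e' w \<le> qdist e w + t" if "norm w < 1" for w
  proof -
    have "norm (herm (e - e') w) \<le> norm (e - e') * norm w" by (rule norm_herm_le)
    also have "\<dots> \<le> norm (e - e') * 1" using that by (intro mult_left_mono) auto
    also have "\<dots> \<le> t" using z(2) by (simp add: e'_def dist_norm norm_minus_commute)
    finally have "norm (herm (e - e') w) \<le> t" .
    moreover have "norm (1 - herm e' w) = norm ((1 - herm e w) + herm (e - e') w)"
      by (simp add: herm_diff_left)
    ultimately show ?thesis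
      unfolding qdist_def using norm_triangle_ineq[of "1 - herm e w" "herm (e - e') w"] by linarith
  qed
  have tent: "tent z = cap e' (1 - norm z)" using z0 by (simp add: tent_eq_cap e'_def)
  have "v \<in> tent z"
    unfolding tent cap_def using near[OF v] e(3) t z(3) t0 v by simp
  moreover have "ball.Q v t \<subseteq> tent z"
  proof
    fix w assume w: "w \<in> ball.Q v t"
    then have "w \<in> cap e (6 * t)"
      using quasiball_subset_cap[OF v e(1) e(3) t(1)] by (auto simp: ball.Q_def)
    then have "norm w < 1" "qdist e w < 6 * t" by (auto simp: cap_def)
    then show "w \<in> tent z" unfolding tent cap_def using near[of w] z(3) by simp
  qed
  ultimately show thesis using that z t0 by (simp add: less_imp_le)
qed

lemma B1_class_quasiballs:
  fixes \<sigma> :: "complex ^ 'n \<Rightarrow> real"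
  assumes \<sigma>: "\<sigma> \<in> B1_class"
  obtains K where "0 < K" and "AE v in V. \<forall>t\<ge>1 - norm v.
      ball.mass (\<lambda>y. ennreal (\<sigma> y)) (ball.Q v t) \<le> ennreal (K * t ^ (CARD('n) + 1) * \<sigma> v)"
proof -
  define N where "N = CARD('n) + 1"
  define T where "T = tent_const TYPE('n)"
  have T: "0 < T" using tent_const_ge_1[where 'n='n] by (simp add: T_def)
  have "B1_const \<sigma> < \<infinity>" using \<sigma> by (simp add: B1_class_def)
  then obtain k where k: "0 < k" "B1_const \<sigma> \<le> ennreal k" by (rule ennreal_less_top_obtain)
  have pos: "AE w in V. 0 < \<sigma> w" using \<sigma> by (auto simp: B1_class_def weight_def)
  obtain A :: "(complex ^ 'n) set" where A: "countable A" "\<And>X. open X \<Longrightarrow> X \<noteq> {} \<Longrightarrow> \<exists>d\<in>A. d \<in> X"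
    using countable_dense_exists by blast
  define A' where "A' = insert 0 (A \<inter> ball 0 1)"
  have "countable A'" using A by (auto simp: A'_def)
  moreover have "AE v in V. v \<in> tent z \<longrightarrow> average \<sigma> (tent z) \<le> ennreal k * ennreal (\<sigma> v)" if "z \<in> A'" for z
    using that by (intro B1_class_tent \<sigma> k) (auto simp: A'_def)
  ultimately have all: "AE v in V. \<forall>z\<in>A'. v \<in> tent z \<longrightarrow> average \<sigma> (tent z) \<le> ennreal k * ennreal (\<sigma> v)"
    by (simp add: AE_ball_countable)
  show thesis
  proof (rule that)
    show "0 < k * (T * 8 ^ N)" using k T by simp
    show "AE v in V. \<forall>t\<ge>1 - norm v. ball.mass (\<lambda>y. ennreal (\<sigma> y)) (ball.Q v t)
        \<le> ennreal (k * (T * 8 ^ N) * t ^ (CARD('n) + 1) * \<sigma> v)"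
      using all pos AE_space
    proof eventually_elim
      fix v :: "complex ^ 'n" assume v: "\<forall>z\<in>A'. v \<in> tent z \<longrightarrow> average \<sigma> (tent z) \<le> ennreal k * ennreal (\<sigma> v)"
        "0 < \<sigma> v" "v \<in> space V"
      show "\<forall>t\<ge>1 - norm v. ball.mass (\<lambda>y. ennreal (\<sigma> y)) (ball.Q v t)
        \<le> ennreal (k * (T * 8 ^ N) * t ^ (CARD('n) + 1) * \<sigma> v)"
      proof (intro allI impI)
        fix t assume t: "1 - norm v \<le> t"
        have t0: "0 < t" using v t by simp
        obtain z where z: "z \<in> A'" "z \<in> ball 0 1" "v \<in> tent z" "ball.Q v t \<subseteq> tent z" "1 - norm z \<le> 8 * t"
        proof (cases "8 * t < 1")
          case True
          obtain z where "z \<in> A" "z \<in> ball 0 1" "v \<in> tent z" "ball.Q v t \<subseteq> tent z" "1 - norm z \<le> 8 * t"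
            by (rule tent_near_quasiball[of v t A]) (use v t True A in auto)
          then show thesis using that[of z] by (simp add: A'_def)
        next
          case False
          have "tent (0 :: complex ^ 'n) = space V" by (simp add: tent_def)
          moreover have "ball.Q v t \<subseteq> space V" by (auto simp: ball.Q_def)
          ultimately show thesis using that[of 0] v False by (simp add: A'_def)
        qed
        have "ball.mass (\<lambda>y. ennreal (\<sigma> y)) (ball.Q v t) \<le> ball.mass (\<lambda>y. ennreal (\<sigma> y)) (tent z)"
          by (intro ball.mass_mono z)
        also have "\<dots> \<le> average \<sigma> (tent z) * emeasure V (tent z)" by (intro mass_le_average) simp
        also have "\<dots> \<le> (ennreal k * ennreal (\<sigma> v)) * ennreal (T * (8 * t) ^ N)"
        proof (intro mult_mono)
          show "average \<sigma> (tent z) \<le> ennreal k * ennreal (\<sigma> v)" using v z by blast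
          have "emeasure V (tent z) \<le> ennreal (T * (1 - norm z) ^ N)"
            using z emeasure_tent_le[of z] by (simp add: T_def N_def)
          also have "\<dots> \<le> ennreal (T * (8 * t) ^ N)"
            using z T by (intro ennreal_leI mult_left_mono power_mono) auto
          finally show "emeasure V (tent z) \<le> ennreal (T * (8 * t) ^ N)" .
        qed auto
        also have "\<dots> = ennreal (k * \<sigma> v * (T * (8 * t) ^ N))"
          using k v T t0 by (simp add: ennreal_mult)
        also have "k * \<sigma> v * (T * (8 * t) ^ N) = k * (T * 8 ^ N) * t ^ (CARD('n) + 1) * \<sigma> v"
          by (simp add: N_def power_mult_distrib)
        finally show "ball.mass (\<lambda>y. ennreal (\<sigma> y)) (ball.Q v t)
          \<le> ennreal (k * (T * 8 ^ N) * t ^ (CARD('n) + 1) * \<sigma> v)" .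
      qed
    qed
  qed
qed

section \<open>Compactness in quasi-normed function spaces\<close>

text \<open>
  Sequential compactness implies compactness, as in metric spaces, for a symmetric distance that
  satisfies the triangle inequality up to the factor \<open>K\<close>. Balls need not be open, but by the
  quasi-triangle inequality the points that have a ball inside a given ball form an open set. Hence
  every point of the closure of \<open>S\<close> is approximated by \<open>S\<close>. A Lebesgue number of an open cover of
  the closure and a finite net then give a finite subcover.
\<close>

lemma precompact_in_qnorm_topology:
  fixes X :: "('a \<Rightarrow> complex) set" and N :: "('a \<Rightarrow> complex) \<Rightarrow> ennreal"
  assumes SX: "S \<subseteq> X" and K: "0 < K"
    and refl: "\<And>f. f \<in> X \<Longrightarrow> N (\<lambda>z. f z - f z) = 0"
    and sym: "\<And>f g. f \<in> X \<Longrightarrow> g \<in> X \<Longrightarrow> N (\<lambda>z. f z - g z) = N (\<lambda>z. g z - f z)"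
    and tri: "\<And>f g h. f \<in> X \<Longrightarrow> g \<in> X \<Longrightarrow> h \<in> X \<Longrightarrow>
      N (\<lambda>z. f z - h z) \<le> ennreal K * (N (\<lambda>z. f z - g z) + N (\<lambda>z. g z - h z))"
    and seq: "\<And>s :: nat \<Rightarrow> 'a \<Rightarrow> complex. range s \<subseteq> S \<Longrightarrow>
      \<exists>\<phi> g. strict_mono \<phi> \<and> g \<in> X \<and> (\<forall>e>0. \<forall>\<^sub>F n in sequentially. N (\<lambda>z. s (\<phi> n) z - g z) < ennreal e)"
  shows "precompact_in (qnorm_topology X N) S"
proof -
  define d where "d f g = N (\<lambda>z. f z - g z)" for f g
  define \<tau> where "\<tau> = qnorm_topology X N"
  have opn: "openin \<tau> U \<longleftrightarrow> U \<subseteq> X \<and> (\<forall>f\<in>U. \<exists>e>0. \<forall>g\<in>X. d g f < ennreal e \<longrightarrow> g \<in> U)" for U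
    unfolding \<tau>_def d_def by (rule openin_qnorm_topology)
  have top [simp]: "topspace \<tau> = X" by (simp add: \<tau>_def)
  have half: "d f h < ennreal e"
    if "f \<in> X" "g \<in> X" "h \<in> X" "0 < e" "d f g < ennreal (e / (4 * K))" "d g h < ennreal (e / (4 * K))" for f g h e
  proof -
    have "d f h \<le> ennreal K * (d f g + d g h)" unfolding d_def by (rule tri) (use that in auto)
    also have "\<dots> \<le> ennreal K * (ennreal (e / (4 * K)) + ennreal (e / (4 * K)))"
      using that by (intro mult_left_mono add_mono) auto
    also have "\<dots> = ennreal (e / 2)"
      using that K by (simp add: ennreal_plus[symmetric] ennreal_mult[symmetric] del: ennreal_plus)
    also have "\<dots> < ennreal e" using that by (simp add: ennreal_lessI)
    finally show ?thesis .
  qed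
  have dsym: "d f g = d g f" if "f \<in> X" "g \<in> X" for f g using that sym by (simp add: d_def)
  have approx: "\<exists>s\<in>S. d s g < ennreal e" if g: "g \<in> \<tau> closure_of S" and e: "0 < e" for g e
  proof -
    define W where "W = {f \<in> X. \<exists>e'>0. \<forall>h\<in>X. d h f < ennreal e' \<longrightarrow> d h g < ennreal e}"
    have "openin \<tau> W" unfolding opn
    proof (intro conjI ballI)
      fix f assume "f \<in> W"
      then obtain e' where f: "f \<in> X" "0 < e'" "\<And>h. h \<in> X \<Longrightarrow> d h f < ennreal e' \<Longrightarrow> d h g < ennreal e"
        by (auto simp: W_def)
      show "\<exists>e''>0. \<forall>f'\<in>X. d f' f < ennreal e'' \<longrightarrow> f' \<in> W"
      proof (intro exI[of _ "e' / (4 * K)"] conjI ballI impI)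
        show "0 < e' / (4 * K)" using f K by simp
        fix f' assume f': "f' \<in> X" "d f' f < ennreal (e' / (4 * K))"
        have "d h g < ennreal e" if "h \<in> X" "d h f' < ennreal (e' / (4 * K))" for h
          using half[OF that(1) f'(1) f(1) f(2) that(2) f'(2)] f(3) that by blast
        then show "f' \<in> W" using f' \<open>0 < e' / (4 * K)\<close> by (auto simp: W_def)
      qed
    qed (auto simp: W_def)
    moreover have gX: "g \<in> X" using g by (simp add: in_closure_of)
    then have "g \<in> W" using e by (auto simp: W_def)
    ultimately obtain s where s: "s \<in> S" "s \<in> W" using g by (auto simp: in_closure_of)
    have "d s s = 0" using s SX refl by (auto simp: d_def)
    then have "d s g < ennreal e" using s by (auto simp: W_def)
    then show ?thesis using s by blast
  qed
  define C where "C = \<tau> closure_of S"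
  have CX: "C \<subseteq> X" unfolding C_def using closure_of_subset_topspace[of \<tau> S] by simp
  have conv: "\<exists>\<phi> g. strict_mono \<phi> \<and> g \<in> C \<and> (\<forall>e>0. \<forall>\<^sub>F n in sequentially. d (c (\<phi> n)) g < ennreal e)"
    if c: "range c \<subseteq> C" for c :: "nat \<Rightarrow> 'a \<Rightarrow> complex"
  proof -
    have "\<forall>n. \<exists>s\<in>S. d s (c n) < ennreal (1 / real (Suc n))"
      using c approx unfolding C_def by (metis rangeI subsetD of_nat_0_less_iff zero_less_Suc zero_less_divide_1_iff)
    then obtain s where s: "\<And>n. s n \<in> S" "\<And>n. d (s n) (c n) < ennreal (1 / real (Suc n))" by metis
    then obtain \<phi> g where \<phi>: "strict_mono \<phi>" "g \<in> X"
      and lim: "\<And>e. 0 < e \<Longrightarrow> \<forall>\<^sub>F n in sequentially. d (s (\<phi> n)) g < ennreal e"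
      using seq[of s] unfolding d_def by blast
    have "g \<in> C" unfolding C_def in_closure_of
    proof (intro conjI allI impI)
      fix T assume T: "g \<in> T \<and> openin \<tau> T"
      then obtain e where e: "0 < e" "\<And>h. h \<in> X \<Longrightarrow> d h g < ennreal e \<Longrightarrow> h \<in> T" unfolding opn by blast
      obtain n where "d (s (\<phi> n)) g < ennreal e" using lim[OF e(1)] by (auto simp: eventually_sequentially)
      then show "\<exists>y. y \<in> S \<and> y \<in> T" using e s SX by blast
    qed (use \<phi> in simp)
    moreover have "\<forall>\<^sub>F n in sequentially. d (c (\<phi> n)) g < ennreal e" if e: "0 < e" for e
    proof -
      have e2: "0 < e / (4 * K)" using e K by simp
      have "\<forall>\<^sub>F n in sequentially. 1 / real (Suc n) < e / (4 * K)"
        using lim_inverse_n'[THEN LIMSEQ_Suc] e2 by (rule order_tendstoD)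
      with lim[OF e2] show ?thesis
      proof eventually_elim
        fix n assume n: "d (s (\<phi> n)) g < ennreal (e / (4 * K))" "1 / real (Suc n) < e / (4 * K)"
        have "n \<le> \<phi> n" using \<phi>(1) by (rule seq_suble)
        then have "1 / real (Suc (\<phi> n)) \<le> 1 / real (Suc n)" by (simp add: frac_le)
        then have "ennreal (1 / real (Suc (\<phi> n))) \<le> ennreal (e / (4 * K))" using n by (intro ennreal_leI) simp
        then have "d (s (\<phi> n)) (c (\<phi> n)) < ennreal (e / (4 * K))" using s(2) by (rule less_le_trans[rotated])
        moreover have "s (\<phi> n) \<in> X" "c (\<phi> n) \<in> X" using s(1) SX c CX by blast+
        ultimately show "d (c (\<phi> n)) g < ennreal e"
          using n \<phi>(2) e half[of "c (\<phi> n)" "s (\<phi> n)" g e] dsym[of "s (\<phi> n)" "c (\<phi> n)"] by simp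
      qed
    qed
    ultimately show ?thesis using \<phi> by blast
  qed
  have "compactin \<tau> C" unfolding compactin_def
  proof (intro conjI allI impI)
    show "C \<subseteq> topspace \<tau>" using CX by simp
    fix \<U> assume \<U>: "(\<forall>U\<in>\<U>. openin \<tau> U) \<and> C \<subseteq> \<Union>\<U>"
    have "\<exists>n. \<forall>x\<in>C. \<exists>U\<in>\<U>. \<forall>h\<in>X. d h x < ennreal (1 / real (Suc n)) \<longrightarrow> h \<in> U"
    proof (rule ccontr)
      assume "\<not> ?thesis"
      then have "\<forall>n. \<exists>x. x \<in> C \<and> (\<forall>U\<in>\<U>. \<exists>h\<in>X. d h x < ennreal (1 / real (Suc n)) \<and> h \<notin> U)"
        by (simp add: Bex_def[of C])
      then have "\<exists>c. \<forall>n. c n \<in> C \<and> (\<forall>U\<in>\<U>. \<exists>h\<in>X. d h (c n) < ennreal (1 / real (Suc n)) \<and> h \<notin> U)"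
        by (rule choice)
      then obtain c where c: "\<And>n. c n \<in> C"
        "\<And>n U. U \<in> \<U> \<Longrightarrow> \<exists>h\<in>X. d h (c n) < ennreal (1 / real (Suc n)) \<and> h \<notin> U" by blast
      obtain \<phi> g where \<phi>: "strict_mono \<phi>" "g \<in> C"
        and lim: "\<And>e. 0 < e \<Longrightarrow> \<forall>\<^sub>F n in sequentially. d (c (\<phi> n)) g < ennreal e"
        using conv[OF image_subsetI[of UNIV c C, OF c(1)]] by auto
      obtain U where U: "U \<in> \<U>" "g \<in> U" using \<U> \<phi> by blast
      then have "openin \<tau> U" using \<U> by blast
      then have "\<exists>e>0. \<forall>h\<in>X. d h g < ennreal e \<longrightarrow> h \<in> U" using U(2) by (simp add: opn)
      then obtain e where e: "0 < e" "\<And>h. h \<in> X \<Longrightarrow> d h g < ennreal e \<Longrightarrow> h \<in> U" by blast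
      have e2: "0 < e / (4 * K)" using e K by simp
      have "\<forall>\<^sub>F n in sequentially. 1 / real (Suc n) < e / (4 * K)"
        using lim_inverse_n'[THEN LIMSEQ_Suc] e2 by (rule order_tendstoD)
      with lim[OF e2] have "\<forall>\<^sub>F n in sequentially. d (c (\<phi> n)) g < ennreal (e / (4 * K)) \<and> 1 / real (Suc n) < e / (4 * K)"
        by eventually_elim simp
      then obtain n where n: "d (c (\<phi> n)) g < ennreal (e / (4 * K))" "1 / real (Suc n) < e / (4 * K)"
        by (auto simp: eventually_sequentially)
      obtain h where h: "h \<in> X" "d h (c (\<phi> n)) < ennreal (1 / real (Suc (\<phi> n)))" "h \<notin> U"
        using c(2)[OF U(1), of "\<phi> n"] by auto
      have "n \<le> \<phi> n" using \<phi>(1) by (rule seq_suble)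
      then have "1 / real (Suc (\<phi> n)) \<le> 1 / real (Suc n)" by (simp add: frac_le)
      then have "ennreal (1 / real (Suc (\<phi> n))) \<le> ennreal (e / (4 * K))" using n by (intro ennreal_leI) simp
      then have "d h (c (\<phi> n)) < ennreal (e / (4 * K))" using h(2) by (rule less_le_trans[rotated])
      moreover have "c (\<phi> n) \<in> X" "g \<in> X" using c CX \<phi> by auto
      ultimately have "d h g < ennreal e" using half[OF h(1) _ _ e(1) _ n(1)] by blast
      then show False using e h by blast
    qed
    then obtain m where m: "\<And>x. x \<in> C \<Longrightarrow> \<exists>U\<in>\<U>. \<forall>h\<in>X. d h x < ennreal (1 / real (Suc m)) \<longrightarrow> h \<in> U" by blast
    define e where "e = 1 / real (Suc m)"
    have e: "0 < e" by (simp add: e_def)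
    have "\<exists>F. finite F \<and> F \<subseteq> C \<and> (\<forall>x\<in>C. \<exists>f\<in>F. d x f < ennreal e)"
    proof (rule ccontr)
      assume no: "\<not> ?thesis"
      have "\<exists>c :: nat \<Rightarrow> 'a \<Rightarrow> complex. \<forall>n. c n \<in> C \<and> (\<forall>i<n. \<not> d (c n) (c i) < ennreal e)"
      proof (rule dependent_wellorder_choice)
        fix n :: nat and c :: "nat \<Rightarrow> 'a \<Rightarrow> complex"
        assume "\<And>y. y < n \<Longrightarrow> c y \<in> C \<and> (\<forall>i<y. \<not> d (c y) (c i) < ennreal e)"
        then have "finite (c ` {..<n})" "c ` {..<n} \<subseteq> C" by auto
        then have "\<not> (\<forall>x\<in>C. \<exists>f\<in>c ` {..<n}. d x f < ennreal e)" using no by meson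
        then obtain x where "x \<in> C" "\<And>f. f \<in> c ` {..<n} \<Longrightarrow> \<not> d x f < ennreal e" by blast
        then show "\<exists>r. r \<in> C \<and> (\<forall>i<n. \<not> d r (c i) < ennreal e)" by blast
      qed auto
      then obtain c :: "nat \<Rightarrow> 'a \<Rightarrow> complex" where c: "\<And>n. c n \<in> C" "\<And>n i. i < n \<Longrightarrow> \<not> d (c n) (c i) < ennreal e" by blast
      obtain \<phi> g where \<phi>: "strict_mono \<phi>" "g \<in> C"
        and lim: "\<And>e. 0 < e \<Longrightarrow> \<forall>\<^sub>F n in sequentially. d (c (\<phi> n)) g < ennreal e"
        using conv[OF image_subsetI[of UNIV c C, OF c(1)]] by auto
      have e2: "0 < e / (4 * K)" using e K by simp
      obtain n where n: "\<And>i. n \<le> i \<Longrightarrow> d (c (\<phi> i)) g < ennreal (e / (4 * K))"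
        using lim[OF e2] by (auto simp: eventually_sequentially)
      have mem: "c (\<phi> i) \<in> X" "g \<in> X" for i using c CX \<phi> by auto
      have "d g (c (\<phi> n)) < ennreal (e / (4 * K))" using n[of n] dsym[OF mem] by simp
      then have "d (c (\<phi> (Suc n))) (c (\<phi> n)) < ennreal e"
        using half[OF mem(1) mem(2) mem(1) e] n[of "Suc n"] by simp
      moreover have "\<phi> n < \<phi> (Suc n)" using \<phi>(1) by (simp add: strict_mono_def)
      ultimately show False using c(2) by blast
    qed
    then obtain F where F: "finite F" "F \<subseteq> C" "\<And>x. x \<in> C \<Longrightarrow> \<exists>f\<in>F. d x f < ennreal e" by blast
    obtain U where U: "\<And>f. f \<in> F \<Longrightarrow> U f \<in> \<U>" "\<And>f h. f \<in> F \<Longrightarrow> h \<in> X \<Longrightarrow> d h f < ennreal e \<Longrightarrow> h \<in> U f"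
      using m F(2) unfolding e_def by (metis subsetD)
    show "\<exists>\<F>. finite \<F> \<and> \<F> \<subseteq> \<U> \<and> C \<subseteq> \<Union>\<F>"
    proof (intro exI conjI)
      show "finite (U ` F)" "U ` F \<subseteq> \<U>" using F U by auto
      show "C \<subseteq> \<Union>(U ` F)" using F(3) U(2) CX by blast
    qed
  qed
  then show ?thesis using SX unfolding precompact_in_def C_def \<tau>_def[symmetric] by simp
qed

section \<open>Toeplitz operators\<close>

text \<open>
  After scaling by \<open>1 - r\<close> both inverses are in the unit disc, where \<open>m\<close> is a Lipschitz constant of the
  \<open>m\<close>-th power.
\<close>

lemma norm_inverse_power_diff_le:
  fixes a b :: complex
  assumes r: "r < 1" and a: "norm a \<le> r" and b: "norm b \<le> r"
  shows "norm (1 / (1 - a) ^ m - 1 / (1 - b) ^ m) \<le> real m / (1 - r) ^ (m + 1) * norm (a - b)"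
proof -
  have lower: "1 - r \<le> norm (1 - a)" "1 - r \<le> norm (1 - b)"
    using norm_triangle_ineq2[of 1 a] norm_triangle_ineq2[of 1 b] a b by auto
  then have nz: "1 - a \<noteq> 0" "1 - b \<noteq> 0" using r by auto
  define x where "x = of_real (1 - r) / (1 - a)"
  define y where "y = of_real (1 - r) / (1 - b)"
  have x: "norm x \<le> 1" "norm y \<le> 1" using lower r nz by (auto simp: x_def y_def norm_divide divide_le_eq simp del: of_real_diff)
  have "1 / (1 - a) ^ m - 1 / (1 - b) ^ m = (x ^ m - y ^ m) / of_real (1 - r) ^ m"
    using r nz by (simp add: x_def y_def power_divide diff_divide_distrib del: of_real_diff)
  then have "norm (1 / (1 - a) ^ m - 1 / (1 - b) ^ m) = norm (x ^ m - y ^ m) / (1 - r) ^ m"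
    using r by (simp add: norm_divide norm_power del: of_real_diff)
  also have "\<dots> \<le> (real m * norm (x - y)) / (1 - r) ^ m"
    using r x by (intro divide_right_mono norm_power_diff) auto
  finally have 1: "norm (1 / (1 - a) ^ m - 1 / (1 - b) ^ m) \<le> (real m * norm (x - y)) / (1 - r) ^ m" .
  have "c / A - c / B = c / A * (c / B) * (B - A) / c" if "c \<noteq> 0" "A \<noteq> 0" "B \<noteq> 0" for c A B :: complex
    using that by (simp add: field_simps)
  from this[of "of_real (1 - r)" "1 - a" "1 - b"] nz have "x - y = x * y * (a - b) / of_real (1 - r)"
    using r by (simp add: x_def y_def del: of_real_diff)
  then have "norm (x - y) = norm x * norm y * norm (a - b) / (1 - r)"
    using r by (simp add: norm_mult norm_divide del: of_real_diff)
  then have "norm (x - y) \<le> 1 * 1 * norm (a - b) / (1 - r)"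
    using r x by (simp only:) (intro divide_right_mono mult_mono, auto)
  then have "(real m * norm (x - y)) / (1 - r) ^ m \<le> (real m * (norm (a - b) / (1 - r))) / (1 - r) ^ m"
    using r by (intro divide_right_mono mult_left_mono) auto
  with 1 show ?thesis by simp
qed

lemma measurable_herm_V [measurable]: "(\<lambda>w. herm z w) \<in> borel_measurable V"
  by (intro borel_measurable_V borel_measurable_continuous_onI continuous_intros)

lemma measurable_toeplitz_integrand [measurable]:
  assumes [measurable]: "v \<in> borel_measurable V" "f \<in> borel_measurable V"
  shows "toeplitz_integrand v f z \<in> borel_measurable V"
  unfolding toeplitz_integrand_def by measurable

definition L1_norm :: "(complex ^ 'n \<Rightarrow> complex) \<Rightarrow> real"
  where "L1_norm f = (LINT w|V. norm (f w))"

lemma AE_le_toeplitz_integrand: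
  fixes v f :: "complex ^ 'n \<Rightarrow> complex"
  assumes M: "AE w in V. norm (v w) \<le> M" and r: "r < 1"
    and z: "\<And>w. norm w < 1 \<Longrightarrow> v w \<noteq> 0 \<Longrightarrow> norm (herm z w) \<le> r"
  shows "AE w in V. norm (toeplitz_integrand v f z w) \<le> M / (1 - r) ^ (CARD('n) + 1) * norm (f w)"
  using M AE_space
proof eventually_elim
  fix w :: "complex ^ 'n" assume w: "norm (v w) \<le> M" "w \<in> space V"
  show "norm (toeplitz_integrand v f z w) \<le> M / (1 - r) ^ (CARD('n) + 1) * norm (f w)"
  proof (cases "v w = 0")
    case True
    then show ?thesis using w r by (simp add: toeplitz_integrand_def)
  next
    case False
    have "1 - r \<le> norm (1 - herm z w)"
      using norm_triangle_ineq2[of 1 "herm z w"] z[of w] w False by auto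
    then have "(1 - r) ^ (CARD('n) + 1) \<le> norm (1 - herm z w) ^ (CARD('n) + 1)"
      using r by (intro power_mono) auto
    then have "norm (v w) * norm (f w) / norm (1 - herm z w) ^ (CARD('n) + 1)
        \<le> (M * norm (f w)) / (1 - r) ^ (CARD('n) + 1)"
      using w r by (intro frac_le mult_right_mono mult_nonneg_nonneg) (auto intro: order_trans[OF norm_ge_zero])
    then show ?thesis by (simp only: toeplitz_integrand_def norm_divide norm_mult norm_power) simp
  qed
qed

lemma integrable_toeplitz_integrand:
  fixes v f :: "complex ^ 'n \<Rightarrow> complex"
  assumes [measurable]: "v \<in> borel_measurable V" and f: "integrable V f"
    and M: "AE w in V. norm (v w) \<le> M" and r: "r < 1"
    and z: "\<And>w. norm w < 1 \<Longrightarrow> v w \<noteq> 0 \<Longrightarrow> norm (herm z w) \<le> r"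
  shows "integrable V (toeplitz_integrand v f z)"
    and "norm (toeplitz v f z) \<le> M / (1 - r) ^ (CARD('n) + 1) * L1_norm f"
proof -
  have [measurable]: "f \<in> borel_measurable V" using f by auto
  have int: "integrable V (\<lambda>w. M / (1 - r) ^ (CARD('n) + 1) * norm (f w))"
    using f by (intro integrable_mult_right integrable_norm)
  have le: "AE w in V. norm (toeplitz_integrand v f z w) \<le> M / (1 - r) ^ (CARD('n) + 1) * norm (f w)"
    by (rule AE_le_toeplitz_integrand[OF M r]) (rule z)
  show i: "integrable V (toeplitz_integrand v f z)"
    by (rule Bochner_Integration.integrable_bound[OF int]) (measurable, use le in eventually_elim, metis abs_ge_self order_trans real_norm_def)
  have "norm (toeplitz v f z) \<le> (LINT w|V. norm (toeplitz_integrand v f z w))"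
    unfolding toeplitz_def by (rule integral_norm_bound)
  also have "\<dots> \<le> (LINT w|V. M / (1 - r) ^ (CARD('n) + 1) * norm (f w))"
    by (intro integral_mono_AE integrable_norm i int le)
  finally show "norm (toeplitz v f z) \<le> M / (1 - r) ^ (CARD('n) + 1) * L1_norm f"
    by (simp add: L1_norm_def)
qed

text \<open>
  The hypotheses on \<open>z\<close> and \<open>z'\<close> concern only points of the support of \<open>v\<close>. They hold in two
  situations: for arbitrary \<open>v\<close> when \<open>z\<close> and \<open>z'\<close> stay in a compact subset of the ball, and up to the
  boundary when \<open>v\<close> is supported in a compact subset of the ball.
\<close>

lemma norm_toeplitz_diff_le:
  fixes v f :: "complex ^ 'n \<Rightarrow> complex"
  assumes v [measurable]: "v \<in> borel_measurable V" and f: "integrable V f"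
    and M: "AE w in V. norm (v w) \<le> M" and r: "r < 1"
    and z: "\<And>w. norm w < 1 \<Longrightarrow> v w \<noteq> 0 \<Longrightarrow> norm (herm z w) \<le> r"
    and z': "\<And>w. norm w < 1 \<Longrightarrow> v w \<noteq> 0 \<Longrightarrow> norm (herm z' w) \<le> r"
  shows "norm (toeplitz v f z - toeplitz v f z')
    \<le> M * (real (CARD('n) + 1) / (1 - r) ^ (CARD('n) + 2)) * L1_norm f * norm (z - z')"
proof -
  have [measurable]: "f \<in> borel_measurable V" using f by auto
  define L where "L = real (CARD('n) + 1) / (1 - r) ^ (CARD('n) + 2)"
  have L: "0 \<le> L" using r by (simp add: L_def)
  have i: "integrable V (toeplitz_integrand v f z)" "integrable V (toeplitz_integrand v f z')"
    by (rule integrable_toeplitz_integrand(1)[OF v f M r], erule (1) z)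
      (rule integrable_toeplitz_integrand(1)[OF v f M r], erule (1) z')
  have "AE w in V. norm (toeplitz_integrand v f z w - toeplitz_integrand v f z' w)
      \<le> M * L * norm (z - z') * norm (f w)"
    using M AE_space
  proof eventually_elim
    fix w :: "complex ^ 'n" assume w: "norm (v w) \<le> M" "w \<in> space V"
    then have M0: "0 \<le> M" by (metis norm_ge_zero order_trans)
    show "norm (toeplitz_integrand v f z w - toeplitz_integrand v f z' w) \<le> M * L * norm (z - z') * norm (f w)"
    proof (cases "v w = 0")
      case True
      then show ?thesis using M0 L by (simp add: toeplitz_integrand_def)
    next
      case False
      have "toeplitz_integrand v f z w - toeplitz_integrand v f z' w = v w * f w *
          (1 / (1 - herm z w) ^ (CARD('n) + 1) - 1 / (1 - herm z' w) ^ (CARD('n) + 1))"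
        by (simp add: toeplitz_integrand_def right_diff_distrib)
      then have "norm (toeplitz_integrand v f z w - toeplitz_integrand v f z' w) = norm (v w) * norm (f w) *
          norm (1 / (1 - herm z w) ^ (CARD('n) + 1) - 1 / (1 - herm z' w) ^ (CARD('n) + 1))"
        by (simp only: norm_mult)
      also have "\<dots> \<le> norm (v w) * norm (f w) * (L * norm (herm z w - herm z' w))"
        using norm_inverse_power_diff_le[OF r z[of w] z'[of w], of "CARD('n) + 1"] w False
        by (intro mult_left_mono) (auto simp: L_def)
      also have "\<dots> \<le> M * norm (f w) * (L * (norm (z - z') * 1))"
      proof (intro mult_mono mult_right_mono mult_left_mono w L)
        have "norm (herm z w - herm z' w) \<le> norm (z - z') * norm w"
          unfolding herm_diff_left[symmetric] by (rule norm_herm_le)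
        also have "\<dots> \<le> norm (z - z') * 1" using w by (intro mult_left_mono) auto
        finally show "norm (herm z w - herm z' w) \<le> norm (z - z') * 1" .
      qed (use M0 L in auto)
      finally show ?thesis by (simp add: mult_ac)
    qed
  qed
  moreover have "toeplitz v f z - toeplitz v f z' = (LINT w|V. toeplitz_integrand v f z w - toeplitz_integrand v f z' w)"
    unfolding toeplitz_def using i by simp
  moreover have "integrable V (\<lambda>w. M * L * norm (z - z') * norm (f w))"
    using f by (intro integrable_mult_right integrable_norm)
  ultimately have "norm (toeplitz v f z - toeplitz v f z') \<le> (LINT w|V. M * L * norm (z - z') * norm (f w))"
    using i by (simp only:) (intro order_trans[OF integral_norm_bound] integral_mono_AE integrable_norm, auto)
  then show ?thesis by (simp add: L1_norm_def L_def mult_ac)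
qed

lemma norm_herm_le_left: "norm w < 1 \<Longrightarrow> norm (herm z w) \<le> norm z"
  using norm_herm_le[of z w] mult_left_mono[of "norm w" 1 "norm z"] by simp

lemma norm_herm_le_right: "norm z \<le> 1 \<Longrightarrow> norm (herm z w) \<le> norm w"
  using norm_herm_le[of z w] mult_right_mono[of "norm z" 1 "norm w"] by simp

lemma L1_norm_nonneg: "0 \<le> L1_norm f"
  unfolding L1_norm_def by (intro integral_nonneg_AE) auto

lemma continuous_on_toeplitz:
  fixes v f :: "complex ^ 'n \<Rightarrow> complex"
  assumes v: "v \<in> borel_measurable V" "AE w in V. norm (v w) \<le> M" and f: "integrable V f"
  shows "continuous_on (ball 0 1) (toeplitz v f)"
proof (rule continuous_at_imp_continuous_on, rule ballI)
  fix x :: "complex ^ 'n" assume x: "x \<in> ball 0 1"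
  define r where "r = (1 + norm x) / 2"
  have r: "r < 1" "norm x < r" using x by (auto simp: r_def)
  define L where "L = \<bar>M\<bar> * (real (CARD('n) + 1) / (1 - r) ^ (CARD('n) + 2)) * L1_norm f"
  have M: "AE w in V. norm (v w) \<le> \<bar>M\<bar>" using v(2) by eventually_elim simp
  have "L-lipschitz_on (ball 0 r) (toeplitz v f)"
  proof (rule lipschitz_onI)
    show "0 \<le> L" using r L1_norm_nonneg[of f] by (simp add: L_def)
    fix z z' :: "complex ^ 'n" assume "z \<in> ball 0 r" "z' \<in> ball 0 r"
    then show "dist (toeplitz v f z) (toeplitz v f z') \<le> L * dist z z'"
      unfolding dist_norm L_def
      by (intro norm_toeplitz_diff_le v(1) f M r(1)) (auto intro: order_trans[OF norm_herm_le_left])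
  qed
  then have "continuous_on (ball 0 r) (toeplitz v f)" by (rule lipschitz_on_continuous_on)
  then show "isCont (toeplitz v f) x"
    using r by (simp add: continuous_on_eq_continuous_at)
qed

lemma measurable_toeplitz:
  fixes v f :: "complex ^ 'n \<Rightarrow> complex"
  assumes "v \<in> borel_measurable V" "AE w in V. norm (v w) \<le> M" "integrable V f"
  shows "toeplitz v f \<in> borel_measurable V"
proof -
  have "toeplitz v f \<in> borel_measurable (restrict_space borel (ball 0 1))"
    using continuous_on_toeplitz[OF assms] by (rule borel_measurable_continuous_on_restrict)
  moreover have "(\<lambda>x. x) \<in> V \<rightarrow>\<^sub>M restrict_space borel (ball (0 :: complex ^ 'n) 1)"
    by (intro measurable_restrict_space2 measurable_V_borel) auto
  ultimately show ?thesis using measurable_compose by blast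
qed

lemma norm_toeplitz_le_bergman:
  fixes v f :: "complex ^ 'n \<Rightarrow> complex"
  assumes "AE w in V. norm (v w) \<le> e" and f: "f \<in> borel_measurable V"
  shows "ennreal (norm (toeplitz v f z)) \<le> ennreal e * ball.bergman (\<lambda>w. ennreal (norm (f w))) z"
proof -
  have "ennreal (norm (toeplitz v f z)) \<le> (\<integral>\<^sup>+w. ennreal (norm (toeplitz_integrand v f z w)) \<partial>V)"
    unfolding toeplitz_def
    by (cases "integrable V (toeplitz_integrand v f z)")
      (auto intro: integral_norm_bound_ennreal simp: not_integrable_integral_eq)
  also have "\<dots> \<le> (\<integral>\<^sup>+w. ennreal e * (ennreal (1 / qdist z w ^ (CARD('n) + 1)) * ennreal (norm (f w))) \<partial>V)"
  proof (rule nn_integral_mono_AE, use assms(1) in eventually_elim)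
    fix w assume w: "norm (v w) \<le> e"
    then have e0: "0 \<le> e" by (metis norm_ge_zero order_trans)
    have "norm (toeplitz_integrand v f z w) = norm (v w) * (1 / qdist z w ^ (CARD('n) + 1) * norm (f w))"
      by (simp add: toeplitz_integrand_def qdist_def norm_mult norm_divide norm_power)
    also have "\<dots> \<le> e * (1 / qdist z w ^ (CARD('n) + 1) * norm (f w))"
      using w by (intro mult_right_mono) (auto simp: qdist_def)
    finally have "ennreal (norm (toeplitz_integrand v f z w)) \<le> ennreal (e * (1 / qdist z w ^ (CARD('n) + 1) * norm (f w)))"
      by (rule ennreal_leI)
    also have "\<dots> = ennreal e * (ennreal (1 / qdist z w ^ (CARD('n) + 1)) * ennreal (norm (f w)))"
    proof -
      have "0 \<le> 1 / qdist z w ^ (CARD('n) + 1)" by (simp add: qdist_def)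
      then show ?thesis using e0 by (simp only: ennreal_mult norm_ge_zero mult_nonneg_nonneg)
    qed
    finally show "ennreal (norm (toeplitz_integrand v f z w)) \<le> ennreal e * (ennreal (1 / qdist z w ^ (CARD('n) + 1)) * ennreal (norm (f w)))" .
  qed
  also have "\<dots> = ennreal e * ball.bergman (\<lambda>w. ennreal (norm (f w))) z"
    unfolding ball.bergman_def
  proof (rule nn_integral_cmult)
    have [measurable]: "qdist z \<in> borel_measurable V"
      by (intro borel_measurable_V borel_measurable_continuous_onI continuous_qdist)
    show "(\<lambda>w. ennreal (1 / qdist z w ^ (CARD('n) + 1)) * ennreal (norm (f w))) \<in> borel_measurable V"
      using f by measurable
  qed
  finally show ?thesis .
qed

section \<open>Compactness from a bound by the symbol\<close>

lemma vanishes_at_boundary_AE: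
  fixes u :: "complex ^ 'n \<Rightarrow> complex"
  assumes "vanishes_at_boundary u" and e: "0 < e"
  obtains t where "0 < t" "t < 1" "AE w in V. t < norm w \<longrightarrow> norm (u w) \<le> e"
proof -
  obtain v where v: "AE z in V. u z = v z" "(v \<longlongrightarrow> 0) (filtercomap norm (at_left 1))"
    using assms(1) by (auto simp: vanishes_at_boundary_def)
  have "\<forall>\<^sub>F z in filtercomap norm (at_left 1). dist (v z) 0 < e" using v(2) e by (rule tendstoD)
  then obtain P where P: "\<forall>\<^sub>F x in at_left (1::real). P x" "\<And>z. P (norm z) \<Longrightarrow> dist (v z) 0 < e"
    unfolding eventually_filtercomap by blast
  then obtain b where b: "b < 1" "\<And>y. b < y \<Longrightarrow> y < 1 \<Longrightarrow> P y"
    unfolding eventually_at_left_field by blast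
  show thesis
  proof (rule that)
    show "0 < max b (1/2)" "max b (1/2) < 1" using b by auto
    show "AE w in V. max b (1/2) < norm w \<longrightarrow> norm (u w) \<le> e"
      using v(1) AE_space
    proof eventually_elim
      fix w assume "u w = v w" "w \<in> space V"
      then show "max b (1/2) < norm w \<longrightarrow> norm (u w) \<le> e"
        using P(2)[of w] b(2)[of "norm w"] by auto
    qed
  qed
qed

text \<open>
  The common part of both assertions: \<open>N\<close> is the \<open>L^p\<close> norm or the weak \<open>L^1\<close> norm. Given a sequence of
  functions \<open>f n\<close> bounded in \<open>X\<close>, let \<open>u1 k\<close> be the part of the symbol inside the radius \<open>t k\<close> beyond which
  it is at most \<open>1 / (k + 1)\<close>. By Arzela-Ascoli and a diagonal argument, a subsequence has the
  property that for every \<open>k\<close> the images under the operator with symbol \<open>u1 k\<close> are eventually within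
  \<open>1 / (k + 1)\<close> of each other, uniformly on the closed ball. The operators with the remaining symbols are
  small, so the images under the full operator form a Cauchy sequence for \<open>N\<close>, and also at each point
  of the ball. Fatou's lemma passes from the Cauchy property to convergence to the pointwise limit.
\<close>

lemma toeplitz_acts_compactly_if_bounded:
  fixes u :: "complex ^ 'n \<Rightarrow> complex" and N :: "(complex ^ 'n \<Rightarrow> complex) \<Rightarrow> ennreal"
  assumes u [measurable]: "u \<in> borel_measurable V" and uM: "AE w in V. norm (u w) \<le> M"
    and van: "vanishes_at_boundary u"
    and X: "\<And>f. f \<in> X \<Longrightarrow> f \<in> borel_measurable V" "\<And>f. f \<in> X \<Longrightarrow> NX f < \<infinity>"
    and A: "0 < A" "\<And>f. f \<in> X \<Longrightarrow> (\<integral>\<^sup>+w. ennreal (norm (f w)) \<partial>V) \<le> ennreal A * NX f"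
    and Y: "Y = {f. f \<in> borel_measurable V \<and> N f < \<infinity>}"
    and mono: "\<And>f g. f \<in> borel_measurable V \<Longrightarrow> g \<in> borel_measurable V \<Longrightarrow>
      (\<And>z. norm z < 1 \<Longrightarrow> norm (f z) \<le> norm (g z)) \<Longrightarrow> N f \<le> N g"
    and K: "0 < K" and add: "\<And>f g. f \<in> borel_measurable V \<Longrightarrow> g \<in> borel_measurable V \<Longrightarrow>
      N (\<lambda>z. f z + g z) \<le> ennreal K * (N f + N g)"
    and L: "0 < L" and const: "\<And>c. 0 \<le> c \<Longrightarrow> N (\<lambda>_. of_real c) \<le> ennreal (L * c)"
    and fatou: "\<And>h g a. (\<And>n::nat. h n \<in> borel_measurable V) \<Longrightarrow> g \<in> borel_measurable V \<Longrightarrow>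
      (\<And>z. norm z < 1 \<Longrightarrow> (\<lambda>n. h n z) \<longlonglongrightarrow> g z) \<Longrightarrow> (\<And>n. N (h n) \<le> a) \<Longrightarrow> N g \<le> a"
    and B: "0 < B" and bound: "\<And>f v e. f \<in> X \<Longrightarrow> v \<in> borel_measurable V \<Longrightarrow> 0 < e \<Longrightarrow>
      AE w in V. norm (v w) \<le> e \<Longrightarrow> N (toeplitz v f) \<le> ennreal (B * e) * NX f"
  shows "toeplitz_acts_compactly u X NX Y N"
proof -
  define M' where "M' = \<bar>M\<bar> + 1"
  have M': "0 < M'" "AE w in V. norm (u w) \<le> M'"
    using uM by (auto simp: M'_def elim!: eventually_mono)
  have int: "integrable V f" if "f \<in> X" for f
  proof (rule integrableI_bounded)
    have "ennreal A * NX f < \<infinity>" using X(2)[OF that] by (simp add: ennreal_mult_less_top)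
    then show "(\<integral>\<^sup>+w. ennreal (norm (f w)) \<partial>V) < \<infinity>" using A(2)[OF that] by (rule le_less_trans[rotated])
  qed (use X that in auto)
  have L1: "L1_norm f \<le> A * m" if "f \<in> X" "NX f \<le> ennreal m" "0 \<le> m" for f m
  proof -
    have "ennreal (L1_norm f) = (\<integral>\<^sup>+w. ennreal (norm (f w)) \<partial>V)"
      unfolding L1_norm_def using int[OF that(1)] by (subst nn_integral_eq_integral) auto
    also have "\<dots> \<le> ennreal A * ennreal m" using A(2)[OF that(1)] that(2) by (meson mult_left_mono order_trans zero_le)
    also have "\<dots> = ennreal (A * m)" using A that by (simp add: ennreal_mult)
    finally show ?thesis using A that by (simp add: ennreal_le_iff)
  qed
  have herm_lt: "norm (herm z w) \<le> norm z" if "norm w < 1" for z w :: "complex ^ 'n"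
    using norm_herm_le_left that by blast
  have N_cong: "N f = N g" if "f \<in> borel_measurable V" "g \<in> borel_measurable V" "\<And>z. norm z < 1 \<Longrightarrow> norm (f z) = norm (g z)" for f g
    using mono[of f g] mono[of g f] that by (auto intro: antisym)
  have N_add_le: "N f \<le> ennreal K * (N g + N h)"
    if "f \<in> borel_measurable V" "g \<in> borel_measurable V" "h \<in> borel_measurable V"
      "\<And>z. norm z < 1 \<Longrightarrow> f z = g z + h z \<or> f z = g z - h z" for f g h
  proof -
    have [measurable]: "f \<in> borel_measurable V" "g \<in> borel_measurable V" "h \<in> borel_measurable V" by fact+
    have "N f \<le> N (\<lambda>z. of_real (norm (g z)) + of_real (norm (h z)))"
    proof (rule mono)
      fix z :: "complex ^ 'n" assume "norm z < 1"
      then have "norm (f z) \<le> norm (g z) + norm (h z)"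
        using that(4)[of z] norm_triangle_ineq[of "g z" "h z"] norm_triangle_ineq4[of "g z" "h z"] by auto
      then show "norm (f z) \<le> norm (complex_of_real (norm (g z)) + complex_of_real (norm (h z)))"
        by (simp flip: of_real_add)
    qed measurable
    also have "\<dots> \<le> ennreal K * (N (\<lambda>z. of_real (norm (g z))) + N (\<lambda>z. of_real (norm (h z))))"
      by (rule add) measurable
    also have "N (\<lambda>z. of_real (norm (g z))) = N g" by (rule N_cong) auto
    also have "N (\<lambda>z. of_real (norm (h z))) = N h" by (rule N_cong) auto
    finally show ?thesis .
  qed
  have meas: "toeplitz v f \<in> borel_measurable V" if "f \<in> X" "v \<in> borel_measurable V" "AE w in V. norm (v w) \<le> e" for v f e
    using measurable_toeplitz[OF that(2,3) int[OF that(1)]] .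
  have into: "toeplitz u f \<in> Y" if f: "f \<in> X" for f
  proof -
    have "N (toeplitz u f) \<le> ennreal (B * M') * NX f" by (intro bound f u M')
    also have "\<dots> < \<infinity>" using X(2)[OF f] by (simp add: ennreal_mult_less_top)
    finally show ?thesis using meas[OF f u M'(2)] by (simp add: Y)
  qed
  have integrable_integrand: "integrable V (toeplitz_integrand v f z)"
    if "f \<in> X" "norm z < 1" "v \<in> borel_measurable V" "AE w in V. norm (v w) \<le> e" for f z v e
    by (rule integrable_toeplitz_integrand(1)[OF that(3) int[OF that(1)] that(4) that(2)]) (rule herm_lt)

  have "\<forall>k. \<exists>t. 0 < t \<and> t < 1 \<and> (AE w in V. t < norm w \<longrightarrow> norm (u w) \<le> 1 / real (Suc k))"
  proof
    fix k
    obtain t where "0 < t" "t < 1" "AE w in V. t < norm w \<longrightarrow> norm (u w) \<le> 1 / real (Suc k)"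
      by (rule vanishes_at_boundary_AE[OF van, of "1 / real (Suc k)"]) auto
    then show "\<exists>t. 0 < t \<and> t < 1 \<and> (AE w in V. t < norm w \<longrightarrow> norm (u w) \<le> 1 / real (Suc k))" by blast
  qed
  from choice[OF this] obtain t where t: "\<And>k. 0 < t k" "\<And>k. t k < 1"
    "\<And>k. AE w in V. t k < norm w \<longrightarrow> norm (u w) \<le> 1 / real (Suc k)" by blast
  define u1 where "u1 k w = (if norm w \<le> t k then u w else 0)" for k w
  define u2 where "u2 k w = (if norm w \<le> t k then 0 else u w)" for k w
  have m1 [measurable]: "u1 k \<in> borel_measurable V" for k unfolding u1_def by measurable
  have m2 [measurable]: "u2 k \<in> borel_measurable V" for k unfolding u2_def by measurable
  have b1: "AE w in V. norm (u1 k w) \<le> M'" for k using M'(2) by eventually_elim (use M' in \<open>auto simp: u1_def\<close>)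
  have b2: "AE w in V. norm (u2 k w) \<le> 1 / real (Suc k)" for k using t(3)[of k] by eventually_elim (auto simp: u2_def)
  have split: "toeplitz u f z = toeplitz (u1 k) f z + toeplitz (u2 k) f z" if "f \<in> X" "norm z < 1" for f z k
  proof -
    have "toeplitz u f z = (LINT w|V. toeplitz_integrand (u1 k) f z w + toeplitz_integrand (u2 k) f z w)"
      unfolding toeplitz_def
      by (intro arg_cong[where f="integral\<^sup>L V"] ext) (auto simp: toeplitz_integrand_def u1_def u2_def)
    then show ?thesis
      unfolding toeplitz_def using integrable_integrand[OF that m1 b1] integrable_integrand[OF that m2 b2] by simp
  qed
  have herm_u1: "norm (herm z w) \<le> t k" if "norm z \<le> 1" "norm w < 1" "u1 k w \<noteq> 0" for k and z w :: "complex ^ 'n"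
    using norm_herm_le_right[OF that(1), of w] that(3) by (auto simp: u1_def split: if_splits)
  have u1_bound: "norm (toeplitz (u1 k) f z) \<le> M' / (1 - t k) ^ (CARD('n) + 1) * L1_norm f"
    if "f \<in> X" "norm z \<le> 1" for k f z
    by (rule integrable_toeplitz_integrand(2)[OF m1 int[OF that(1)] b1 t(2)]) (rule herm_u1[OF that(2)])
  have u1_lipschitz: "norm (toeplitz (u1 k) f z - toeplitz (u1 k) f z')
      \<le> M' * (real (CARD('n) + 1) / (1 - t k) ^ (CARD('n) + 2)) * L1_norm f * norm (z - z')"
    if "f \<in> X" "norm z \<le> 1" "norm z' \<le> 1" for k f z z'
    by (rule norm_toeplitz_diff_le[OF m1 int[OF that(1)] b1 t(2)])
      (erule (1) herm_u1[OF that(2)], erule (1) herm_u1[OF that(3)])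
  have u2_bound: "norm (toeplitz (u2 k) f z) \<le> 1 / real (Suc k) / (1 - norm z) ^ (CARD('n) + 1) * L1_norm f"
    if "f \<in> X" "norm z < 1" for k f z
    by (rule integrable_toeplitz_integrand(2)[OF m2 int[OF that(1)] b2 that(2)]) (rule herm_lt)

  have compact: "precompact_in (qnorm_topology Y N) (toeplitz u ` S)"
    if SX: "S \<subseteq> X" and Sm: "\<forall>f\<in>S. NX f \<le> ennreal m0" for S m0
  proof (rule precompact_in_qnorm_topology[where K=K])
    define m where "m = max 0 m0"
    have m: "0 \<le> m" "NX f \<le> ennreal m" if "f \<in> S" for f
    proof -
      have "NX f \<le> ennreal m0" using Sm that by blast
      also have "\<dots> \<le> ennreal m" by (intro ennreal_leI) (simp add: m_def)
      finally show "NX f \<le> ennreal m" .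
    qed (simp add: m_def)
    have m0: "0 \<le> m" by (simp add: m_def)
    show "toeplitz u ` S \<subseteq> Y" using SX into by blast
    show "0 < K" by (rule K)
    have N0: "N (\<lambda>z. 0) = 0" using const[of 0] by simp
    show "N (\<lambda>z. f z - f z) = 0" for f using N0 by simp
    show "N (\<lambda>z. f z - g z) = N (\<lambda>z. g z - f z)" if "f \<in> Y" "g \<in> Y" for f g
      using that by (intro N_cong) (auto simp: Y norm_minus_commute)
    show "N (\<lambda>z. f z - h z) \<le> ennreal K * (N (\<lambda>z. f z - g z) + N (\<lambda>z. g z - h z))"
      if "f \<in> Y" "g \<in> Y" "h \<in> Y" for f g h
      using that by (intro N_add_le) (auto simp: Y)
    fix s :: "nat \<Rightarrow> complex ^ 'n \<Rightarrow> complex" assume "range s \<subseteq> toeplitz u ` S"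
    then have "\<forall>n. \<exists>f. f \<in> S \<and> s n = toeplitz u f" by blast
    from choice[OF this] obtain f where f: "\<And>n. f n \<in> S" "\<And>n. s n = toeplitz u (f n)" by blast
    have fX: "f n \<in> X" for n using f SX by blast
    have fL: "L1_norm (f n) \<le> A * m" for n using f m(2) m0 fX by (intro L1) auto
    \<comment> \<open>Cauchy up to \<open>1 / (k + 1)\<close> only, which suffices and is inherited by subsequences.\<close>
    define P where "P k \<phi> \<longleftrightarrow> (\<exists>n0::nat. \<forall>i\<ge>n0. \<forall>j\<ge>n0. \<forall>z. norm z \<le> 1 \<longrightarrow>
      norm (toeplitz (u1 k) (f (\<phi> i)) z - toeplitz (u1 k) (f (\<phi> j)) z) \<le> 1 / real (Suc k))"
      for k :: nat and \<phi> :: "nat \<Rightarrow> nat"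
    interpret subseqs P
    proof
      fix k and r :: "nat \<Rightarrow> nat"
      define H where "H n z = toeplitz (u1 k) (f (r n)) z" for n z
      define a where "a = M' / (1 - t k) ^ (CARD('n) + 1) * (A * m)"
      define b where "b = M' * (real (CARD('n) + 1) / (1 - t k) ^ (CARD('n) + 2)) * (A * m) + 1"
      have b: "0 < b" using M' A m0 t(2)[of k] by (simp add: b_def add_nonneg_pos)
      obtain g \<psi> where \<psi>: "strict_mono (\<psi> :: nat \<Rightarrow> nat)"
        "\<And>e. 0 < e \<Longrightarrow> \<exists>n0. \<forall>n z. n0 \<le> n \<and> z \<in> cball 0 1 \<longrightarrow> norm (H (\<psi> n) z - g z) < e"
      proof (rule Arzela_Ascoli[of "cball (0 :: complex ^ 'n) 1" H a])
        fix n and z :: "complex ^ 'n" assume z: "z \<in> cball 0 1"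
        have "norm (H n z) \<le> M' / (1 - t k) ^ (CARD('n) + 1) * L1_norm (f (r n))"
          unfolding H_def using u1_bound[OF fX] z by simp
        also have "\<dots> \<le> a" unfolding a_def using fL M' t(2)[of k] by (intro mult_left_mono) auto
        finally show "norm (H n z) \<le> a" .
      next
        fix x :: "complex ^ 'n" and e :: real assume x: "x \<in> cball 0 1" and e: "0 < e"
        show "\<exists>d>0. \<forall>n y. y \<in> cball 0 1 \<and> norm (x - y) < d \<longrightarrow> norm (H n x - H n y) < e"
        proof (intro exI[of _ "e / b"] conjI allI impI)
          show "0 < e / b" using e b by simp
          fix n and y :: "complex ^ 'n" assume y: "y \<in> cball 0 1 \<and> norm (x - y) < e / b"
          have "norm (H n x - H n y) \<le> M' * (real (CARD('n) + 1) / (1 - t k) ^ (CARD('n) + 2)) * L1_norm (f (r n)) * norm (x - y)"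
            unfolding H_def using u1_lipschitz[OF fX] x y by simp
          also have "\<dots> \<le> b * norm (x - y)"
          proof (rule mult_right_mono)
            have "M' * (real (CARD('n) + 1) / (1 - t k) ^ (CARD('n) + 2)) * L1_norm (f (r n))
                \<le> M' * (real (CARD('n) + 1) / (1 - t k) ^ (CARD('n) + 2)) * (A * m)"
              using fL M' t(2)[of k] by (intro mult_left_mono) auto
            then show "M' * (real (CARD('n) + 1) / (1 - t k) ^ (CARD('n) + 2)) * L1_norm (f (r n)) \<le> b"
              by (simp add: b_def)
          qed simp
          also have "\<dots> < b * (e / b)" using y b by (intro mult_strict_left_mono) auto
          finally show "norm (H n x - H n y) < e" using b by simp
        qed
      qed auto
      have "0 < 1 / (2 * real (Suc k))" by simp
      from \<psi>(2)[OF this] obtain n0 where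
        n0: "\<And>n z. n0 \<le> n \<Longrightarrow> norm z \<le> 1 \<Longrightarrow> norm (H (\<psi> n) z - g z) < 1 / (2 * real (Suc k))" by auto
      have "P k (r \<circ> \<psi>)" unfolding P_def
      proof (intro exI[of _ n0] allI impI)
        fix i j and z :: "complex ^ 'n" assume "n0 \<le> i" "n0 \<le> j" "norm z \<le> 1"
        then have "norm ((H (\<psi> i) z - g z) - (H (\<psi> j) z - g z)) \<le> 1 / (2 * real (Suc k)) + 1 / (2 * real (Suc k))"
          using n0[of i z] n0[of j z] by (intro order_trans[OF norm_triangle_ineq4]) auto
        moreover have "1 / (2 * real (Suc k)) + 1 / (2 * real (Suc k)) = 1 / real (Suc k)"
          by (simp only: mult.commute[of 2] divide_divide_eq_left[symmetric] field_sum_of_halves)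
        ultimately show "norm (toeplitz (u1 k) (f ((r \<circ> \<psi>) i)) z - toeplitz (u1 k) (f ((r \<circ> \<psi>) j)) z) \<le> 1 / real (Suc k)"
          by (simp only: H_def o_def) simp
      qed
      then show "\<exists>r'. strict_mono r' \<and> P k (r \<circ> r')" using \<psi>(1) by blast
    qed
    have stable: "P k (\<phi> \<circ> \<psi>)" if \<psi>: "strict_mono \<psi>" and Pk: "P k \<phi>" for k \<phi> and \<psi> :: "nat \<Rightarrow> nat"
    proof -
      obtain n0 where n0: "\<forall>i\<ge>n0. \<forall>j\<ge>n0. \<forall>z. norm z \<le> 1 \<longrightarrow>
        norm (toeplitz (u1 k) (f (\<phi> i)) z - toeplitz (u1 k) (f (\<phi> j)) z) \<le> 1 / real (Suc k)"
        using Pk unfolding P_def by blast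
      have "n0 \<le> \<psi> i" if "n0 \<le> i" for i
        using seq_suble[OF \<psi>, of i] that by simp
      then show ?thesis unfolding P_def using n0 by (intro exI[of _ n0]) auto
    qed
    define \<phi> where "\<phi> = diagseq"
    have \<phi>: "strict_mono \<phi>" unfolding \<phi>_def by (rule subseq_diagseq)
    have "\<forall>k. \<exists>n0. \<forall>i\<ge>n0. \<forall>j\<ge>n0. \<forall>z. norm z \<le> 1 \<longrightarrow>
        norm (toeplitz (u1 k) (f (\<phi> i)) z - toeplitz (u1 k) (f (\<phi> j)) z) \<le> 1 / real (Suc k)"
    proof
      fix k
      have "P k (diagseq \<circ> ((+) (Suc k)))" using stable by (rule diagseq_holds)
      then obtain n0 where n0: "\<forall>i\<ge>n0. \<forall>j\<ge>n0. \<forall>z. norm z \<le> 1 \<longrightarrow>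
        norm (toeplitz (u1 k) (f (\<phi> (Suc k + i))) z - toeplitz (u1 k) (f (\<phi> (Suc k + j))) z) \<le> 1 / real (Suc k)"
        unfolding P_def \<phi>_def o_def by blast
      show "\<exists>n0. \<forall>i\<ge>n0. \<forall>j\<ge>n0. \<forall>z. norm z \<le> 1 \<longrightarrow>
        norm (toeplitz (u1 k) (f (\<phi> i)) z - toeplitz (u1 k) (f (\<phi> j)) z) \<le> 1 / real (Suc k)"
      proof (intro exI[of _ "n0 + Suc k"] allI impI)
        fix i j and z :: "complex ^ 'n" assume ij: "n0 + Suc k \<le> i" "n0 + Suc k \<le> j" "norm z \<le> 1"
        then have "Suc k + (i - Suc k) = i" "Suc k + (j - Suc k) = j" "n0 \<le> i - Suc k" "n0 \<le> j - Suc k" by auto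
        then show "norm (toeplitz (u1 k) (f (\<phi> i)) z - toeplitz (u1 k) (f (\<phi> j)) z) \<le> 1 / real (Suc k)"
          using n0 ij(3) by metis
      qed
    qed
    from choice[OF this] obtain n0 where n0: "\<And>k i j z. n0 k \<le> i \<Longrightarrow> n0 k \<le> j \<Longrightarrow> norm z \<le> 1 \<Longrightarrow>
        norm (toeplitz (u1 k) (f (\<phi> i)) z - toeplitz (u1 k) (f (\<phi> j)) z) \<le> 1 / real (Suc k)" by blast
    define T where "T i = toeplitz u (f (\<phi> i))" for i
    have T_meas [measurable]: "T i \<in> borel_measurable V" for i unfolding T_def by (rule meas[OF fX u M'(2)])
    have T1_meas [measurable]: "toeplitz (u1 k) (f (\<phi> i)) \<in> borel_measurable V" for k i by (rule meas[OF fX m1 b1])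
    have T2_meas [measurable]: "toeplitz (u2 k) (f (\<phi> i)) \<in> borel_measurable V" for k i by (rule meas[OF fX m2 b2])

    have pointwise: "norm (T i z - T j z) \<le> (1 + 2 * (A * m) / (1 - norm z) ^ (CARD('n) + 1)) / real (Suc k)"
      if ij: "n0 k \<le> i" "n0 k \<le> j" and z: "norm z < 1" for i j k z
    proof -
      have u2b: "norm (toeplitz (u2 k) (f (\<phi> i)) z) \<le> (A * m) / (1 - norm z) ^ (CARD('n) + 1) / real (Suc k)" for i
      proof -
        have "norm (toeplitz (u2 k) (f (\<phi> i)) z) \<le> 1 / real (Suc k) / (1 - norm z) ^ (CARD('n) + 1) * L1_norm (f (\<phi> i))"
          by (rule u2_bound[OF fX z])
        also have "\<dots> \<le> 1 / real (Suc k) / (1 - norm z) ^ (CARD('n) + 1) * (A * m)"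
          using z fL by (intro mult_left_mono) auto
        finally show ?thesis by (simp add: mult_ac)
      qed
      have "T i z - T j z = (toeplitz (u1 k) (f (\<phi> i)) z - toeplitz (u1 k) (f (\<phi> j)) z) +
          (toeplitz (u2 k) (f (\<phi> i)) z - toeplitz (u2 k) (f (\<phi> j)) z)"
        by (simp add: T_def split[OF fX z, of _ k])
      then have "norm (T i z - T j z) \<le> norm (toeplitz (u1 k) (f (\<phi> i)) z - toeplitz (u1 k) (f (\<phi> j)) z) +
          (norm (toeplitz (u2 k) (f (\<phi> i)) z) + norm (toeplitz (u2 k) (f (\<phi> j)) z))"
        by (simp only:) (intro order_trans[OF norm_triangle_ineq] add_left_mono norm_triangle_ineq4)
      also have "\<dots> \<le> 1 / real (Suc k) + ((A * m) / (1 - norm z) ^ (CARD('n) + 1) / real (Suc k) +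
          (A * m) / (1 - norm z) ^ (CARD('n) + 1) / real (Suc k))"
        using n0[OF ij, of z] z u2b[of i] u2b[of j] by (intro add_mono) auto
      also have "\<dots> = (1 + 2 * (A * m) / (1 - norm z) ^ (CARD('n) + 1)) / real (Suc k)"
        by (simp add: add_divide_distrib)
      finally show ?thesis .
    qed
    have small: "\<exists>k. c / real (Suc k) < e" if "0 < e" for c e :: real
    proof -
      have "(\<lambda>k. c / real (Suc k)) \<longlonglongrightarrow> 0" by (rule LIMSEQ_Suc[OF lim_const_over_n])
      then have "\<forall>\<^sub>F k in sequentially. c / real (Suc k) < e" using that by (rule order_tendstoD)
      then show ?thesis by (auto simp: eventually_sequentially)
    qed
    have conv: "convergent (\<lambda>i. T i z)" if z: "norm z < 1" for z
    proof (rule Cauchy_convergent, rule metric_CauchyI)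
      fix e :: real assume "0 < e"
      then obtain k where k: "(1 + 2 * (A * m) / (1 - norm z) ^ (CARD('n) + 1)) / real (Suc k) < e" using small by blast
      show "\<exists>n. \<forall>i\<ge>n. \<forall>j\<ge>n. dist (T i z) (T j z) < e"
        unfolding dist_norm
        by (intro exI[of _ "n0 k"] allI impI le_less_trans[OF pointwise[OF _ _ z] k])
    qed
    define g where "g z = lim (\<lambda>i. T i z)" for z
    have g_lim: "(\<lambda>i. T i z) \<longlonglongrightarrow> g z" if "norm z < 1" for z
      unfolding g_def using conv[OF that] by (simp add: convergent_LIMSEQ_iff)
    have g_meas [measurable]: "g \<in> borel_measurable V"
      by (rule borel_measurable_LIMSEQ_metric[where f=T]) (use g_lim in auto)

    define R where "R = K * (L + K * (2 * (B * m)))"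
    have Cauchy_N: "N (\<lambda>z. T i z - T j z) \<le> ennreal (R / real (Suc k))" if ij: "n0 k \<le> i" "n0 k \<le> j" for i j k
    proof -
      have u2b: "N (toeplitz (u2 k) (f (\<phi> i))) \<le> ennreal (B * (1 / real (Suc k)) * m)" for i
      proof -
        have "N (toeplitz (u2 k) (f (\<phi> i))) \<le> ennreal (B * (1 / real (Suc k))) * NX (f (\<phi> i))"
          by (rule bound[OF fX m2 _ b2]) simp
        also have "\<dots> \<le> ennreal (B * (1 / real (Suc k))) * ennreal m"
          using f m(2) by (intro mult_left_mono) auto
        also have "\<dots> = ennreal (B * (1 / real (Suc k)) * m)" using B m0 by (intro ennreal_mult[symmetric]) auto
        finally show ?thesis .
      qed
      have "N (\<lambda>z. T i z - T j z) \<le> ennreal K * (N (\<lambda>z. toeplitz (u1 k) (f (\<phi> i)) z - toeplitz (u1 k) (f (\<phi> j)) z) +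
          N (\<lambda>z. toeplitz (u2 k) (f (\<phi> i)) z - toeplitz (u2 k) (f (\<phi> j)) z))"
        by (intro N_add_le borel_measurable_diff T_meas T1_meas T2_meas)
          (simp add: T_def split[OF fX, of _ _ k])
      also have "N (\<lambda>z. toeplitz (u1 k) (f (\<phi> i)) z - toeplitz (u1 k) (f (\<phi> j)) z) \<le> N (\<lambda>_. of_real (1 / real (Suc k)))"
        using n0[OF ij] by (intro mono) (auto simp del: of_real_divide)
      also have "\<dots> \<le> ennreal (L * (1 / real (Suc k)))" by (rule const) simp
      also have "N (\<lambda>z. toeplitz (u2 k) (f (\<phi> i)) z - toeplitz (u2 k) (f (\<phi> j)) z) \<le>
          ennreal K * (N (toeplitz (u2 k) (f (\<phi> i))) + N (toeplitz (u2 k) (f (\<phi> j))))"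
        by (rule N_add_le) auto
      also have "\<dots> \<le> ennreal K * (ennreal (B * (1 / real (Suc k)) * m) + ennreal (B * (1 / real (Suc k)) * m))"
        by (intro mult_left_mono add_mono u2b) auto
      finally have "N (\<lambda>z. T i z - T j z) \<le> ennreal K * (ennreal (L * (1 / real (Suc k))) +
          ennreal K * (ennreal (B * (1 / real (Suc k)) * m) + ennreal (B * (1 / real (Suc k)) * m)))"
        by (simp add: mult_left_mono add_left_mono add_right_mono)
      also have "\<dots> = ennreal (K * (L * (1 / real (Suc k)) + K * (B * (1 / real (Suc k)) * m + B * (1 / real (Suc k)) * m)))"
      proof -
        have "ennreal a * (ennreal b + ennreal a * (ennreal d + ennreal d)) = ennreal (a * (b + a * (d + d)))"
          if "0 \<le> a" "0 \<le> b" "0 \<le> d" for a b d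
          using that by (simp only: ennreal_mult ennreal_plus add_nonneg_nonneg mult_nonneg_nonneg)
        then show ?thesis using K L B m0 by simp
      qed
      also have "K * (L * (1 / real (Suc k)) + K * (B * (1 / real (Suc k)) * m + B * (1 / real (Suc k)) * m)) = R / real (Suc k)"
      proof -
        have "K * (L * x + K * (B * x * m + B * x * m)) = R * x" for x
          by (simp add: R_def algebra_simps)
        then show ?thesis by (metis mult.right_neutral times_divide_eq_right)
      qed
      finally show ?thesis .
    qed
    have lim_N: "N (\<lambda>z. T i z - g z) \<le> ennreal (R / real (Suc k))" if i: "n0 k \<le> i" for i k
    proof (rule fatou)
      show "(\<lambda>n. T i z - T (n + n0 k) z) \<longlonglongrightarrow> T i z - g z" if "norm z < 1" for z
        by (intro tendsto_diff tendsto_const LIMSEQ_ignore_initial_segment g_lim that)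
      show "N (\<lambda>z. T i z - T (n + n0 k) z) \<le> ennreal (R / real (Suc k))" for n
        using i by (intro Cauchy_N) auto
    qed measurable
    have "N g \<le> ennreal K * (N (T (n0 0)) + N (\<lambda>z. T (n0 0) z - g z))"
      by (rule N_add_le) auto
    also have "\<dots> < \<infinity>"
      using lim_N[of 0 "n0 0"] into[OF fX, of "\<phi> (n0 0)"]
      by (auto simp: ennreal_mult_less_top Y T_def intro: le_less_trans)
    finally have "g \<in> Y" by (simp add: Y)
    moreover have "\<forall>\<^sub>F n in sequentially. N (\<lambda>z. s (\<phi> n) z - g z) < ennreal e" if e: "0 < e" for e
    proof -
      obtain k where k: "R / real (Suc k) < e" using small[OF e] by blast
      have "N (\<lambda>z. s (\<phi> n) z - g z) < ennreal e" if "n0 k \<le> n" for n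
      proof -
        have "N (\<lambda>z. s (\<phi> n) z - g z) \<le> ennreal (R / real (Suc k))"
          using lim_N[OF that] by (simp add: T_def f)
        also have "\<dots> < ennreal e" using k e by (simp add: ennreal_lessI)
        finally show ?thesis .
      qed
      then show ?thesis by (auto simp: eventually_sequentially)
    qed
    ultimately show "\<exists>\<phi> g. strict_mono \<phi> \<and> g \<in> Y \<and> (\<forall>e>0. \<forall>\<^sub>F n in sequentially. N (\<lambda>z. s (\<phi> n) z - g z) < ennreal e)"
      using \<phi> by blast
  qed
  show ?thesis
    unfolding toeplitz_acts_compactly_def compact_operator_def
  proof (intro conjI ballI allI impI)
    show "integrable V (toeplitz_integrand u f z)" if "f \<in> X" "z \<in> ball 0 1" for f z
      using integrable_integrand[OF that(1) _ u M'(2)] that by simp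
    show "toeplitz u ` X \<subseteq> Y" using into by blast
    show "precompact_in (qnorm_topology Y N) (toeplitz u ` S)"
      if "S \<subseteq> X" "\<exists>M. \<forall>f\<in>S. NX f \<le> ennreal M" for S
      using that compact by blast
  qed
qed

section \<open>Weighted Lebesgue spaces\<close>

lemma Lp_norm_eq:
  "Lp_norm p \<sigma> f = ennreal_powr (\<integral>\<^sup>+z. ennreal_powr (ennreal (norm (f z))) p * ennreal (\<sigma> z) \<partial>V) (1 / p)"
  unfolding Lp_norm_def by (simp add: ennreal_powr_ennreal ennreal_mult')

lemma Lp_norm_le_iff:
  assumes "0 < p"
  shows "Lp_norm p \<sigma> f \<le> a \<longleftrightarrow>
    (\<integral>\<^sup>+z. ennreal_powr (ennreal (norm (f z))) p * ennreal (\<sigma> z) \<partial>V) \<le> ennreal_powr a p"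
  unfolding Lp_norm_eq using ennreal_powr_le_iff[OF assms] .

lemma ennreal_powr_Lp_norm:
  assumes "0 < p"
  shows "ennreal_powr (Lp_norm p \<sigma> f) p = (\<integral>\<^sup>+z. ennreal_powr (ennreal (norm (f z))) p * ennreal (\<sigma> z) \<partial>V)"
  unfolding Lp_norm_eq using ennreal_powr_inverse(2)[OF assms] .

lemma esssup_bounded:
  assumes "u \<in> L_infinity"
  obtains M where "u \<in> borel_measurable V" "AE w in V. norm (u w) \<le> M"
proof -
  have u: "u \<in> borel_measurable V" "esssup V (\<lambda>z. ennreal (norm (u z))) < \<infinity>"
    using assms by (auto simp: L_infinity_def)
  obtain k where k: "0 < k" "esssup V (\<lambda>z. ennreal (norm (u z))) \<le> ennreal k"
    using ennreal_less_top_obtain[OF u(2)] .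
  have "AE w in V. ennreal (norm (u w)) \<le> esssup V (\<lambda>z. ennreal (norm (u z)))" by (rule esssup_AE)
  then have "AE w in V. norm (u w) \<le> k"
  proof eventually_elim
    fix w assume "ennreal (norm (u w)) \<le> esssup V (\<lambda>z. ennreal (norm (u z)))"
    then have "ennreal (norm (u w)) \<le> ennreal k" using k(2) by (rule order_trans)
    then show "norm (u w) \<le> k" using k(1) by simp
  qed
  then show thesis using u that by blast
qed

text \<open>
  The functions in the space are integrable because the dual weight has finite mass, constants belong
  to it because the weight has, and the bound by the symbol is the strong-type inequality.
\<close>

theorem toeplitz_compact_Lp:
  fixes u :: "complex ^ 'n \<Rightarrow> complex"
  assumes u: "u \<in> L_infinity" "vanishes_at_boundary u" and p: "1 < p" and \<sigma>: "\<sigma> \<in> Bp_class p"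
  shows "toeplitz_acts_compactly u (Lp_space p \<sigma>) (Lp_norm p \<sigma>) (Lp_space p \<sigma>) (Lp_norm p \<sigma>)"
proof -
  obtain M where M: "u \<in> borel_measurable V" "AE w in V. norm (u w) \<le> M" using esssup_bounded[OF u(1)] .
  have p0: "0 < p" using p by simp
  have \<sigma>_meas [measurable]: "\<sigma> \<in> borel_measurable V" and pos: "AE w in V. 0 < \<sigma> w"
    using \<sigma> by (auto simp: Bp_class_def weight_def)
  obtain k where k: "0 < k" "(\<integral>\<^sup>+w. ennreal (\<sigma> w) \<partial>V) \<le> ennreal k"
    using ennreal_less_top_obtain[OF Bp_class_integrable(1)[OF p \<sigma>]] .
  obtain k' where k': "0 < k'" "(\<integral>\<^sup>+w. ennreal (\<sigma> w powr (1 - p / (p - 1))) \<partial>V) \<le> ennreal k'"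
    using ennreal_less_top_obtain[OF Bp_class_integrable(2)[OF p \<sigma>]] .
  obtain K0 where K0: "0 < K0" "\<And>x t. x \<in> space V \<Longrightarrow> 1 - norm x \<le> t \<Longrightarrow>
      ball.mass (\<lambda>y. ennreal (\<sigma> y)) (ball.Q x t) *
      ennreal_powr (ball.mass (\<lambda>y. ennreal (\<sigma> y powr (1 - p / (p - 1)))) (ball.Q x t)) (p - 1)
        \<le> ennreal (K0 * t powr (real (CARD('n) + 1) * p))"
    using Bp_class_quasiballs[OF p \<sigma>] by blast
  obtain B where B: "0 < B" "\<And>f :: complex ^ 'n \<Rightarrow> ennreal. f \<in> borel_measurable V \<Longrightarrow>
    (\<integral>\<^sup>+z. ennreal_powr (ball.bergman f z) p * ennreal (\<sigma> z) \<partial>V)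
      \<le> ennreal B * (\<integral>\<^sup>+z. ennreal_powr (f z) p * ennreal (\<sigma> z) \<partial>V)"
    by (rule ball.bergman_strong_bound[OF p \<sigma>_meas pos K0]) auto
  show ?thesis
  proof (rule toeplitz_acts_compactly_if_bounded[OF M u(2), where A="k' powr ((p - 1) / p)"
        and K="2 * 2 powr (1 / p)" and L="k powr (1 / p)" and B="B powr (1 / p)"])
    show "f \<in> borel_measurable V" "Lp_norm p \<sigma> f < \<infinity>" if "f \<in> Lp_space p \<sigma>" for f
      using that by (auto simp: Lp_space_def)
    show "Lp_space p \<sigma> = {f. f \<in> borel_measurable V \<and> Lp_norm p \<sigma> f < \<infinity>}"
      by (simp add: Lp_space_def)
    show "0 < k' powr ((p - 1) / p)" "0 < 2 * 2 powr (1 / p)" "0 < k powr (1 / p)" "0 < B powr (1 / p)"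
      using k k' B by auto
    show "(\<integral>\<^sup>+w. ennreal (norm (f w)) \<partial>V) \<le> ennreal (k' powr ((p - 1) / p)) * Lp_norm p \<sigma> f"
      if f: "f \<in> Lp_space p \<sigma>" for f
    proof -
      have [measurable]: "f \<in> borel_measurable V" using f by (simp add: Lp_space_def)
      have ind: "(\<integral>\<^sup>+w. h w * indicator (space V) w \<partial>V) = (\<integral>\<^sup>+w. h w \<partial>V)" for h :: "complex ^ 'n \<Rightarrow> ennreal"
        by (intro nn_integral_cong) (simp only: indicator_simps mult_1_right)
      have "ennreal_powr (\<integral>\<^sup>+w. ennreal (norm (f w)) * indicator (space V) w \<partial>V) p \<le>
          (\<integral>\<^sup>+w. ennreal_powr (ennreal (norm (f w))) p * ennreal (\<sigma> w) * indicator (space V) w \<partial>V) *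
          ennreal_powr (\<integral>\<^sup>+w. ennreal (\<sigma> w powr (1 - p / (p - 1))) * indicator (space V) w \<partial>V) (p - 1)"
        by (rule weighted_Holder[OF p _ \<sigma>_meas pos sets.top]) auto
      then have "ennreal_powr (\<integral>\<^sup>+w. ennreal (norm (f w)) \<partial>V) p \<le>
          ennreal_powr (Lp_norm p \<sigma> f) p * ennreal_powr (\<integral>\<^sup>+w. ennreal (\<sigma> w powr (1 - p / (p - 1))) \<partial>V) (p - 1)"
        unfolding ind ennreal_powr_Lp_norm[OF p0] .
      also have "\<dots> \<le> ennreal_powr (Lp_norm p \<sigma> f) p * ennreal_powr (ennreal k') (p - 1)"
        using p k' by (intro mult_left_mono ennreal_powr_mono) auto
      also have "ennreal_powr (ennreal k') (p - 1) = ennreal_powr (ennreal (k' powr ((p - 1) / p))) p"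
        using k' p by (simp add: ennreal_powr_ennreal powr_powr)
      also have "ennreal_powr (Lp_norm p \<sigma> f) p * \<dots> = ennreal_powr (Lp_norm p \<sigma> f * ennreal (k' powr ((p - 1) / p))) p"
        using p by (simp add: ennreal_powr_mult)
      finally have "ennreal_powr (ennreal_powr (\<integral>\<^sup>+w. ennreal (norm (f w)) \<partial>V) p) (1 / p) \<le>
          ennreal_powr (ennreal_powr (Lp_norm p \<sigma> f * ennreal (k' powr ((p - 1) / p))) p) (1 / p)"
        by (rule ennreal_powr_mono[rotated]) (use p in simp)
      then show ?thesis unfolding ennreal_powr_inverse[OF p0] by (simp only: mult.commute)
    qed
    show "Lp_norm p \<sigma> f \<le> Lp_norm p \<sigma> g"
      if "\<And>z. norm z < 1 \<Longrightarrow> norm (f z) \<le> norm (g z)" for f g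
      unfolding Lp_norm_eq using that p
      by (intro ennreal_powr_mono nn_integral_mono mult_right_mono ennreal_leI) auto
    show "Lp_norm p \<sigma> (\<lambda>z. f z + g z) \<le> ennreal (2 * 2 powr (1 / p)) * (Lp_norm p \<sigma> f + Lp_norm p \<sigma> g)"
      if [measurable]: "f \<in> borel_measurable V" "g \<in> borel_measurable V" for f g
    proof -
      let ?I = "\<lambda>f. \<integral>\<^sup>+z. ennreal_powr (ennreal (norm (f z :: complex))) p * ennreal (\<sigma> z) \<partial>V"
      have "?I (\<lambda>z. f z + g z) \<le> (\<integral>\<^sup>+z. ennreal (2 powr p) * (ennreal_powr (ennreal (norm (f z))) p * ennreal (\<sigma> z) +
          ennreal_powr (ennreal (norm (g z))) p * ennreal (\<sigma> z)) \<partial>V)"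
      proof (intro nn_integral_mono)
        fix z :: "complex ^ 'n"
        have "ennreal (norm (f z + g z)) \<le> ennreal (norm (f z)) + ennreal (norm (g z))"
          by (simp add: norm_triangle_ineq ennreal_leI flip: ennreal_plus)
        then have "ennreal_powr (ennreal (norm (f z + g z))) p \<le> ennreal_powr (ennreal (norm (f z)) + ennreal (norm (g z))) p"
          using p by (intro ennreal_powr_mono) auto
        also have "\<dots> \<le> ennreal (2 powr p) * (ennreal_powr (ennreal (norm (f z))) p + ennreal_powr (ennreal (norm (g z))) p)"
          using p by (intro ennreal_powr_add_le) auto
        finally have "ennreal_powr (ennreal (norm (f z + g z))) p * ennreal (\<sigma> z) \<le>
          ennreal (2 powr p) * (ennreal_powr (ennreal (norm (f z))) p + ennreal_powr (ennreal (norm (g z))) p) * ennreal (\<sigma> z)"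
          by (rule mult_right_mono) simp
        then show "ennreal_powr (ennreal (norm (f z + g z))) p * ennreal (\<sigma> z) \<le> ennreal (2 powr p) *
            (ennreal_powr (ennreal (norm (f z))) p * ennreal (\<sigma> z) + ennreal_powr (ennreal (norm (g z))) p * ennreal (\<sigma> z))"
          by (simp only: mult.assoc distrib_right)
      qed
      also have "\<dots> = ennreal (2 powr p) * (?I f + ?I g)"
        by (simp add: nn_integral_cmult nn_integral_add)
      finally have "Lp_norm p \<sigma> (\<lambda>z. f z + g z) \<le> ennreal_powr (ennreal (2 powr p) * (?I f + ?I g)) (1 / p)"
        unfolding Lp_norm_eq using p by (intro ennreal_powr_mono) auto
      also have "\<dots> = ennreal 2 * ennreal_powr (?I f + ?I g) (1 / p)"
        using p by (simp add: ennreal_powr_mult ennreal_powr_ennreal powr_powr)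
      also have "\<dots> \<le> ennreal 2 * (ennreal (2 powr (1 / p)) * (Lp_norm p \<sigma> f + Lp_norm p \<sigma> g))"
        unfolding Lp_norm_eq using p by (intro mult_left_mono ennreal_powr_add_le) auto
      also have "\<dots> = ennreal (2 * 2 powr (1 / p)) * (Lp_norm p \<sigma> f + Lp_norm p \<sigma> g)"
        by (subst ennreal_mult) (auto simp: mult.assoc)
      finally show ?thesis .
    qed
    show "Lp_norm p \<sigma> (\<lambda>_. of_real c) \<le> ennreal (k powr (1 / p) * c)" if c: "0 \<le> c" for c
    proof -
      have "(\<integral>\<^sup>+z. ennreal_powr (ennreal (norm (complex_of_real c))) p * ennreal (\<sigma> z) \<partial>V)
          = ennreal_powr (ennreal c) p * (\<integral>\<^sup>+z. ennreal (\<sigma> z) \<partial>V)"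
        using c by (simp add: nn_integral_cmult)
      also have "\<dots> \<le> ennreal_powr (ennreal c) p * ennreal k" by (intro mult_left_mono k) auto
      also have "\<dots> = ennreal_powr (ennreal (k powr (1 / p) * c)) p"
        using c k p by (simp add: ennreal_powr_ennreal powr_mult powr_powr ennreal_mult[symmetric] mult.commute)
      finally show ?thesis using Lp_norm_le_iff[OF p0] by blast
    qed
    show "Lp_norm p \<sigma> g \<le> a"
      if h: "\<And>n::nat. h n \<in> borel_measurable V" and g: "g \<in> borel_measurable V"
        and lim: "\<And>z. norm z < 1 \<Longrightarrow> (\<lambda>n. h n z) \<longlonglongrightarrow> g z" and le: "\<And>n. Lp_norm p \<sigma> (h n) \<le> a" for h g a
      unfolding Lp_norm_le_iff[OF p0]
    proof (rule nn_integral_le_of_tendsto)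
      show "(\<lambda>z. ennreal_powr (ennreal (norm (h n z))) p * ennreal (\<sigma> z)) \<in> borel_measurable V" for n
        using h[of n] by measurable
      show "AE z in V. (\<lambda>n. ennreal_powr (ennreal (norm (h n z))) p * ennreal (\<sigma> z))
          \<longlonglongrightarrow> ennreal_powr (ennreal (norm (g z))) p * ennreal (\<sigma> z)"
      proof (rule AE_I2)
        fix z :: "complex ^ 'n" assume z: "z \<in> space V"
        have "(\<lambda>n. ennreal (norm (h n z) powr p * \<sigma> z)) \<longlonglongrightarrow> ennreal (norm (g z) powr p * \<sigma> z)"
          using z p by (intro tendsto_ennrealI tendsto_mult tendsto_const tendsto_powr' tendsto_norm lim) auto
        then show "(\<lambda>n. ennreal_powr (ennreal (norm (h n z))) p * ennreal (\<sigma> z))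
          \<longlonglongrightarrow> ennreal_powr (ennreal (norm (g z))) p * ennreal (\<sigma> z)"
          by (simp add: ennreal_powr_ennreal ennreal_mult')
      qed
      show "(\<integral>\<^sup>+z. ennreal_powr (ennreal (norm (h n z))) p * ennreal (\<sigma> z) \<partial>V) \<le> ennreal_powr a p" for n
        using le[of n] unfolding Lp_norm_le_iff[OF p0] .
    qed
    show "Lp_norm p \<sigma> (toeplitz v f) \<le> ennreal (B powr (1 / p) * e) * Lp_norm p \<sigma> f"
      if f: "f \<in> Lp_space p \<sigma>" and e: "0 < e" and v: "AE w in V. norm (v w) \<le> e" for f v e
      unfolding Lp_norm_le_iff[OF p0]
    proof -
      have f_meas [measurable]: "f \<in> borel_measurable V" using f by (simp add: Lp_space_def)
      let ?b = "ball.bergman (\<lambda>w. ennreal (norm (f w)))"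
      have "(\<integral>\<^sup>+z. ennreal_powr (ennreal (norm (toeplitz v f z))) p * ennreal (\<sigma> z) \<partial>V)
          \<le> (\<integral>\<^sup>+z. ennreal (e powr p) * (ennreal_powr (?b z) p * ennreal (\<sigma> z)) \<partial>V)"
      proof (intro nn_integral_mono)
        fix z :: "complex ^ 'n"
        have "ennreal_powr (ennreal (norm (toeplitz v f z))) p \<le> ennreal_powr (ennreal e * ?b z) p"
          using p by (intro ennreal_powr_mono norm_toeplitz_le_bergman v f_meas) auto
        also have "\<dots> = ennreal (e powr p) * ennreal_powr (?b z) p"
          using p e by (simp add: ennreal_powr_mult ennreal_powr_ennreal)
        finally show "ennreal_powr (ennreal (norm (toeplitz v f z))) p * ennreal (\<sigma> z)
            \<le> ennreal (e powr p) * (ennreal_powr (?b z) p * ennreal (\<sigma> z))"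
          unfolding mult.assoc[symmetric] by (rule mult_right_mono) simp
      qed
      also have "\<dots> = ennreal (e powr p) * (\<integral>\<^sup>+z. ennreal_powr (?b z) p * ennreal (\<sigma> z) \<partial>V)"
        by (rule nn_integral_cmult) measurable
      also have "\<dots> \<le> ennreal (e powr p) * (ennreal B * ennreal_powr (Lp_norm p \<sigma> f) p)"
        unfolding ennreal_powr_Lp_norm[OF p0] by (intro mult_left_mono B) auto
      also have "\<dots> = ennreal (e powr p * B) * ennreal_powr (Lp_norm p \<sigma> f) p"
        using B by (subst ennreal_mult) (auto simp: mult.assoc)
      also have "ennreal (e powr p * B) = ennreal_powr (ennreal (B powr (1 / p) * e)) p"
        using e B p by (simp add: ennreal_powr_ennreal powr_mult powr_powr mult.commute)
      also have "\<dots> * ennreal_powr (Lp_norm p \<sigma> f) p = ennreal_powr (ennreal (B powr (1 / p) * e) * Lp_norm p \<sigma> f) p"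
        using p by (intro ennreal_powr_mult[symmetric]) auto
      finally show "(\<integral>\<^sup>+z. ennreal_powr (ennreal (norm (toeplitz v f z))) p * ennreal (\<sigma> z) \<partial>V)
        \<le> ennreal_powr (ennreal (B powr (1 / p) * e) * Lp_norm p \<sigma> f) p" .
    qed
  qed
qed

lemma Lp_norm_1: "Lp_norm 1 \<sigma> f = (\<integral>\<^sup>+z. ennreal (norm (f z)) * ennreal (\<sigma> z) \<partial>V)"
  by (simp add: Lp_norm_eq)

lemma weak_L1_norm_le_iff:
  fixes f :: "complex ^ 'n \<Rightarrow> complex"
  shows "weak_L1_norm \<sigma> f \<le> a \<longleftrightarrow> (\<forall>t>0. ennreal t * ball.mass (\<lambda>z. ennreal (\<sigma> z)) {z \<in> ball 0 1. t < norm (f z)} \<le> a)"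
  unfolding weak_L1_norm_def weight_measure_def SUP_le_iff by auto

lemma weak_L1_norm_upper:
  fixes f :: "complex ^ 'n \<Rightarrow> complex"
  assumes "0 < t"
  shows "ennreal t * ball.mass (\<lambda>z. ennreal (\<sigma> z)) {z \<in> ball 0 1. t < norm (f z)} \<le> weak_L1_norm \<sigma> f"
  using weak_L1_norm_le_iff[of \<sigma> f "weak_L1_norm \<sigma> f"] assms by auto

text \<open>
  A \<open>B_1\<close> weight is essentially bounded below, by the condition for the tent over the origin, so
  functions in the weighted \<open>L^1\<close> space are integrable.
\<close>

lemma B1_class_lower_bound:
  fixes \<sigma> :: "complex ^ 'n \<Rightarrow> real"
  assumes \<sigma>: "\<sigma> \<in> B1_class"
  obtains S k where "0 < S" "0 < k" "(\<integral>\<^sup>+w. ennreal (\<sigma> w) \<partial>V) = ennreal S" "AE w in V. S \<le> k * \<sigma> w"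
proof -
  have \<sigma>_meas: "\<sigma> \<in> borel_measurable V" and pos: "AE w in V. 0 < \<sigma> w"
    using \<sigma> by (auto simp: B1_class_def weight_def)
  have "B1_const \<sigma> < \<infinity>" using \<sigma> by (simp add: B1_class_def)
  then obtain k where k: "0 < k" "B1_const \<sigma> \<le> ennreal k" by (rule ennreal_less_top_obtain)
  define S where "S = (\<integral>\<^sup>+w. ennreal (\<sigma> w) \<partial>V)"
  have S0: "S \<noteq> 0" unfolding S_def nn_integral_V_eq_average using average_weight_pos[OF \<sigma>_meas pos] .
  have "AE v in V. v \<in> tent 0 \<longrightarrow> average \<sigma> (tent 0) \<le> ennreal k * ennreal (\<sigma> v)"
    by (rule B1_class_tent[OF \<sigma> k(2)]) simp
  with pos AE_space have le: "AE v in V. S \<le> ennreal (k * \<sigma> v)"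
  proof eventually_elim
    fix v assume "0 < \<sigma> v" "v \<in> space V" "v \<in> tent 0 \<longrightarrow> average \<sigma> (tent 0) \<le> ennreal k * ennreal (\<sigma> v)"
    then show "S \<le> ennreal (k * \<sigma> v)"
      using k by (simp add: S_def nn_integral_V_eq_average ennreal_mult tent_def)
  qed
  have "S \<noteq> \<infinity>"
  proof
    assume top: "S = \<infinity>"
    from le have "AE v in (V :: (complex ^ 'n) measure). False"
      by eventually_elim (use top in \<open>simp add: top_unique\<close>)
    then have "emeasure V (space (V :: (complex ^ 'n) measure)) = 0"
      by (simp add: ae_filter_eq_bot_iff[symmetric] trivial_limit_def del: space_V)
    then show False by (simp add: emeasure_V_space)
  qed
  then obtain s where s: "S = ennreal s" "0 \<le> s" by (cases S) auto
  then have "0 < s" using S0 by (cases "s = 0") auto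
  moreover have "AE w in V. s \<le> k * \<sigma> w"
    using le pos by eventually_elim (use s k in \<open>auto simp: ennreal_le_iff\<close>)
  ultimately show thesis using that[of s k] k s by (simp add: S_def)
qed

text \<open>
  The weak norm satisfies the triangle inequality up to the factor 2, by splitting the level \<open>t\<close> into
  halves, and Fatou's lemma because level sets of the limit are eventually in those of the sequence.
\<close>

theorem toeplitz_compact_weak_L1:
  fixes u :: "complex ^ 'n \<Rightarrow> complex"
  assumes u: "u \<in> L_infinity" "vanishes_at_boundary u" and \<sigma>: "\<sigma> \<in> B1_class"
  shows "toeplitz_acts_compactly u (Lp_space 1 \<sigma>) (Lp_norm 1 \<sigma>) (weak_L1_space \<sigma>) (weak_L1_norm \<sigma>)"
proof -
  obtain M where M: "u \<in> borel_measurable V" "AE w in V. norm (u w) \<le> M" using esssup_bounded[OF u(1)] .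
  have \<sigma>_meas [measurable]: "\<sigma> \<in> borel_measurable V" and pos: "AE w in V. 0 < \<sigma> w"
    using \<sigma> by (auto simp: B1_class_def weight_def)
  obtain S k where S: "0 < S" "0 < k" "(\<integral>\<^sup>+w. ennreal (\<sigma> w) \<partial>V) = ennreal S" "AE w in V. S \<le> k * \<sigma> w"
    using B1_class_lower_bound[OF \<sigma>] .
  obtain K0 where K0: "0 < K0" "AE v in V. \<forall>t\<ge>1 - norm v.
      ball.mass (\<lambda>y. ennreal (\<sigma> y)) (ball.Q v t) \<le> ennreal (K0 * t ^ (CARD('n) + 1) * \<sigma> v)"
    using B1_class_quasiballs[OF \<sigma>] .
  obtain B where B: "0 < B" "\<And>(f :: complex ^ 'n \<Rightarrow> ennreal) l. f \<in> borel_measurable V \<Longrightarrow> 0 < l \<Longrightarrow>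
    ennreal l * ball.mass (\<lambda>y. ennreal (\<sigma> y)) {z \<in> space V. ennreal l < ball.bergman f z}
      \<le> ennreal B * (\<integral>\<^sup>+z. f z * ennreal (\<sigma> z) \<partial>V)"
    using ball.bergman_weak_bound[OF \<sigma>_meas pos K0] by blast
  let ?m = "ball.mass (\<lambda>y. ennreal (\<sigma> y))"
  have indicator_le: "indicator W z \<le> (indicator F z + indicator G z :: ennreal)"
    if "z \<in> W \<Longrightarrow> z \<in> F \<or> z \<in> G" for W F G and z :: "complex ^ 'n"
    using that by (cases "z \<in> W"; cases "z \<in> F"; cases "z \<in> G") auto
  have sets_level: "{z \<in> ball 0 1. t < norm (f z)} \<in> sets V" if "f \<in> borel_measurable V" for f :: "complex ^ 'n \<Rightarrow> complex" and t
  proof -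
    have [measurable]: "f \<in> borel_measurable V" by fact
    have "{z \<in> space V. t < norm (f z)} \<in> sets V" by measurable
    then show ?thesis by simp
  qed
  show ?thesis
  proof (rule toeplitz_acts_compactly_if_bounded[OF M u(2), where A="k / S" and K=2 and L=S and B=B])
    show "f \<in> borel_measurable V" "Lp_norm 1 \<sigma> f < \<infinity>" if "f \<in> Lp_space 1 \<sigma>" for f
      using that by (auto simp: Lp_space_def)
    show "weak_L1_space \<sigma> = {f. f \<in> borel_measurable V \<and> weak_L1_norm \<sigma> f < \<infinity>}"
      by (simp add: weak_L1_space_def)
    show "0 < k / S" "0 < S" "0 < B" "0 < (2::real)" using S B by auto
    show "(\<integral>\<^sup>+w. ennreal (norm (f w)) \<partial>V) \<le> ennreal (k / S) * Lp_norm 1 \<sigma> f" if f: "f \<in> Lp_space 1 \<sigma>" for f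
    proof -
      have [measurable]: "f \<in> borel_measurable V" using f by (simp add: Lp_space_def)
      have "(\<integral>\<^sup>+w. ennreal (norm (f w)) \<partial>V) \<le> (\<integral>\<^sup>+w. ennreal (k / S) * (ennreal (norm (f w)) * ennreal (\<sigma> w)) \<partial>V)"
      proof (rule nn_integral_mono_AE, use S(4) pos in eventually_elim)
        fix w assume w: "S \<le> k * \<sigma> w" "0 < \<sigma> w"
        have "1 \<le> k / S * \<sigma> w" using w S by (simp add: field_simps)
        then have "norm (f w) * 1 \<le> norm (f w) * (k / S * \<sigma> w)" by (intro mult_left_mono) auto
        then have "ennreal (norm (f w)) \<le> ennreal (norm (f w) * (k / S * \<sigma> w))" by (intro ennreal_leI) simp
        also have "\<dots> = ennreal (k / S) * (ennreal (norm (f w)) * ennreal (\<sigma> w))"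
          using w S by (subst ennreal_mult[symmetric], simp, simp, subst ennreal_mult[symmetric]) (auto simp: mult_ac)
        finally show "ennreal (norm (f w)) \<le> ennreal (k / S) * (ennreal (norm (f w)) * ennreal (\<sigma> w))" .
      qed
      also have "\<dots> = ennreal (k / S) * Lp_norm 1 \<sigma> f"
        unfolding Lp_norm_1 by (rule nn_integral_cmult) measurable
      finally show ?thesis .
    qed
    show "weak_L1_norm \<sigma> f \<le> weak_L1_norm \<sigma> g"
      if "\<And>z. norm z < 1 \<Longrightarrow> norm (f z) \<le> norm (g z)" for f g :: "complex ^ 'n \<Rightarrow> complex"
      unfolding weak_L1_norm_le_iff
    proof (intro allI impI)
      fix t :: real assume t: "0 < t"
      have "ennreal t * ?m {z \<in> ball 0 1. t < norm (f z)} \<le> ennreal t * ?m {z \<in> ball 0 1. t < norm (g z)}"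
        using that by (intro mult_left_mono ball.mass_mono) (auto intro: less_le_trans)
      also have "\<dots> \<le> weak_L1_norm \<sigma> g" using t by (rule weak_L1_norm_upper)
      finally show "ennreal t * ?m {z \<in> ball 0 1. t < norm (f z)} \<le> weak_L1_norm \<sigma> g" .
    qed
    show "weak_L1_norm \<sigma> (\<lambda>z. f z + g z) \<le> ennreal 2 * (weak_L1_norm \<sigma> f + weak_L1_norm \<sigma> g)"
      if f: "f \<in> borel_measurable V" and g: "g \<in> borel_measurable V" for f g :: "complex ^ 'n \<Rightarrow> complex"
      unfolding weak_L1_norm_le_iff
    proof (intro allI impI)
      fix t :: real assume t: "0 < t"
      let ?F = "{z \<in> ball 0 1. t / 2 < norm (f z)}" and ?G = "{z \<in> ball 0 1. t / 2 < norm (g z)}"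
      have [measurable]: "?F \<in> sets V" "?G \<in> sets V" by (rule sets_level[OF f], rule sets_level[OF g])
      have "?m {z \<in> ball 0 1. t < norm (f z + g z)} \<le> (\<integral>\<^sup>+z. ennreal (\<sigma> z) * indicator ?F z + ennreal (\<sigma> z) * indicator ?G z \<partial>V)"
      proof (intro nn_integral_mono)
        fix z :: "complex ^ 'n"
        have "z \<in> ?F \<or> z \<in> ?G" if "z \<in> {z \<in> ball 0 1. t < norm (f z + g z)}"
        proof (rule ccontr)
          assume "\<not> (z \<in> ?F \<or> z \<in> ?G)"
          then have "norm (f z) \<le> t / 2" "norm (g z) \<le> t / 2" using that by auto
          then show False using that norm_triangle_ineq[of "f z" "g z"] by auto
        qed
        then have "indicator {z \<in> ball 0 1. t < norm (f z + g z)} z \<le> (indicator ?F z + indicator ?G z :: ennreal)"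
          by (rule indicator_le)
        then show "ennreal (\<sigma> z) * indicator {z \<in> ball 0 1. t < norm (f z + g z)} z
            \<le> ennreal (\<sigma> z) * indicator ?F z + ennreal (\<sigma> z) * indicator ?G z"
          unfolding distrib_left[symmetric] by (rule mult_left_mono) simp
      qed
      also have "\<dots> = ?m ?F + ?m ?G" by (rule nn_integral_add) measurable
      finally have "ennreal t * ?m {z \<in> ball 0 1. t < norm (f z + g z)} \<le> ennreal t * (?m ?F + ?m ?G)"
        by (intro mult_left_mono) auto
      also have "\<dots> = ennreal 2 * (ennreal (t / 2) * ?m ?F + ennreal (t / 2) * ?m ?G)"
      proof -
        have "ennreal t = ennreal 2 * ennreal (t / 2)" using t by (simp add: ennreal_mult[symmetric] del: ennreal_numeral)
        then show ?thesis by (simp only: mult.assoc distrib_left)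
      qed
      also have "\<dots> \<le> ennreal 2 * (weak_L1_norm \<sigma> f + weak_L1_norm \<sigma> g)"
        using t by (intro mult_left_mono add_mono weak_L1_norm_upper) auto
      finally show "ennreal t * ?m {z \<in> ball 0 1. t < norm (f z + g z)} \<le> ennreal 2 * (weak_L1_norm \<sigma> f + weak_L1_norm \<sigma> g)" .
    qed
    show "weak_L1_norm \<sigma> (\<lambda>_ :: complex ^ 'n. of_real c) \<le> ennreal (S * c)" if c: "0 \<le> c" for c
      unfolding weak_L1_norm_le_iff
    proof (intro allI impI)
      fix t :: real assume t: "0 < t"
      show "ennreal t * ?m {z \<in> ball 0 1. t < norm (complex_of_real c)} \<le> ennreal (S * c)"
      proof (cases "t < c")
        case True
        have "?m {z \<in> ball 0 1. t < norm (complex_of_real c)} \<le> (\<integral>\<^sup>+w. ennreal (\<sigma> w) \<partial>V)"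
          by (intro nn_integral_mono) (auto simp: indicator_def)
        then have "ennreal t * ?m {z \<in> ball 0 1. t < norm (complex_of_real c)} \<le> ennreal c * ennreal S"
          using True S(3) by (intro mult_mono ennreal_leI) auto
        also have "\<dots> = ennreal (S * c)" using c S by (simp add: ennreal_mult[symmetric] mult.commute)
        finally show ?thesis .
      next
        case False
        then have empty: "{z \<in> ball (0 :: complex ^ 'n) 1. t < norm (complex_of_real c)} = {}" using c by auto
        show ?thesis unfolding empty by simp
      qed
    qed
    show "weak_L1_norm \<sigma> g \<le> a"
      if h: "\<And>n::nat. h n \<in> borel_measurable V" and g: "g \<in> borel_measurable V"
        and lim: "\<And>z. norm z < 1 \<Longrightarrow> (\<lambda>n. h n z) \<longlonglongrightarrow> g z" and le: "\<And>n. weak_L1_norm \<sigma> (h n) \<le> a"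
      for h and g :: "complex ^ 'n \<Rightarrow> complex" and a
      unfolding weak_L1_norm_le_iff
    proof (intro allI impI)
      fix t :: real assume t: "0 < t"
      have sets_h [measurable]: "{z \<in> ball 0 1. t < norm (h n z)} \<in> sets V" for n by (rule sets_level[OF h])
      have sets_g: "{z \<in> ball 0 1. t < norm (g z)} \<in> sets V" by (rule sets_level[OF g])
      have "(\<integral>\<^sup>+z. ennreal t * (ennreal (\<sigma> z) * indicator {z \<in> ball 0 1. t < norm (g z)} z) \<partial>V) \<le> a"
      proof (rule nn_integral_le_of_eventually_le)
        show "(\<lambda>z. ennreal t * (ennreal (\<sigma> z) * indicator {z \<in> ball 0 1. t < norm (h n z)} z)) \<in> borel_measurable V" for n
          by (intro borel_measurable_times_ennreal borel_measurable_indicator sets_h) auto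
        show "(\<integral>\<^sup>+z. ennreal t * (ennreal (\<sigma> z) * indicator {z \<in> ball 0 1. t < norm (h n z)} z) \<partial>V) \<le> a" for n
        proof -
          have "(\<integral>\<^sup>+z. ennreal t * (ennreal (\<sigma> z) * indicator {z \<in> ball 0 1. t < norm (h n z)} z) \<partial>V)
              = ennreal t * ?m {z \<in> ball 0 1. t < norm (h n z)}"
            by (intro nn_integral_cmult borel_measurable_times_ennreal borel_measurable_indicator sets_h) auto
          also have "\<dots> \<le> a" using le[of n] t unfolding weak_L1_norm_le_iff by blast
          finally show ?thesis .
        qed
        fix z :: "complex ^ 'n" assume z: "z \<in> space V"
        show "\<forall>\<^sub>F n in sequentially. ennreal t * (ennreal (\<sigma> z) * indicator {z \<in> ball 0 1. t < norm (g z)} z)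
          \<le> ennreal t * (ennreal (\<sigma> z) * indicator {z \<in> ball 0 1. t < norm (h n z)} z)"
        proof (cases "t < norm (g z)")
          case True
          have "(\<lambda>n. norm (h n z)) \<longlonglongrightarrow> norm (g z)" using z by (intro tendsto_norm lim) simp
          then have "\<forall>\<^sub>F n in sequentially. t < norm (h n z)" using True by (rule order_tendstoD)
          then show ?thesis by eventually_elim (use z True in simp)
        qed simp
      qed
      also have "(\<integral>\<^sup>+z. ennreal t * (ennreal (\<sigma> z) * indicator {z \<in> ball 0 1. t < norm (g z)} z) \<partial>V)
          = ennreal t * ?m {z \<in> ball 0 1. t < norm (g z)}"
        by (intro nn_integral_cmult borel_measurable_times_ennreal borel_measurable_indicator sets_g) auto
      finally show "ennreal t * ?m {z \<in> ball 0 1. t < norm (g z)} \<le> a" .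
    qed
    show "weak_L1_norm \<sigma> (toeplitz v f) \<le> ennreal (B * e) * Lp_norm 1 \<sigma> f"
      if f: "f \<in> Lp_space 1 \<sigma>" and e: "0 < e" and v: "AE w in V. norm (v w) \<le> e" for f v e
      unfolding weak_L1_norm_le_iff
    proof (intro allI impI)
      fix t :: real assume t: "0 < t"
      have f_meas [measurable]: "f \<in> borel_measurable V" using f by (simp add: Lp_space_def)
      let ?b = "ball.bergman (\<lambda>w. ennreal (norm (f w)))"
      have "{z \<in> ball 0 1. t < norm (toeplitz v f z)} \<subseteq> {z \<in> space V. ennreal (t / e) < ?b z}"
      proof
        fix z assume z: "z \<in> {z \<in> ball 0 1. t < norm (toeplitz v f z)}"
        have "ennreal (t / e) < ?b z"
        proof (rule ccontr)
          assume "\<not> ennreal (t / e) < ?b z"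
          then have "ennreal e * ?b z \<le> ennreal e * ennreal (t / e)" by (intro mult_left_mono) auto
          also have "\<dots> = ennreal t" using e t by (simp add: ennreal_mult[symmetric])
          finally have "ennreal (norm (toeplitz v f z)) \<le> ennreal t"
            using norm_toeplitz_le_bergman[OF v f_meas, of z] by (meson order_trans)
          then show False using z t by simp
        qed
        then show "z \<in> {z \<in> space V. ennreal (t / e) < ?b z}" using z by simp
      qed
      then have "ennreal t * ?m {z \<in> ball 0 1. t < norm (toeplitz v f z)} \<le> ennreal t * ?m {z \<in> space V. ennreal (t / e) < ?b z}"
        by (intro mult_left_mono ball.mass_mono) auto
      also have "\<dots> = ennreal e * (ennreal (t / e) * ?m {z \<in> space V. ennreal (t / e) < ?b z})"
        using e t by (simp add: mult.assoc[symmetric] ennreal_mult[symmetric])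
      also have "\<dots> \<le> ennreal e * (ennreal B * Lp_norm 1 \<sigma> f)"
        unfolding Lp_norm_1 using t e by (intro mult_left_mono B) auto
      also have "\<dots> = ennreal (B * e) * Lp_norm 1 \<sigma> f"
        using e B by (subst ennreal_mult) (auto simp: mult_ac)
      finally show "ennreal t * ?m {z \<in> ball 0 1. t < norm (toeplitz v f z)} \<le> ennreal (B * e) * Lp_norm 1 \<sigma> f" .
    qed
  qed
qed

theorem theorem1p1:
  fixes u :: "complex ^ 'n \<Rightarrow> complex" and p :: real
  assumes "u \<in> L_infinity" and "1 < p" and "vanishes_at_boundary u"
  shows "(\<forall>\<sigma>\<in>Bp_class p. toeplitz_acts_compactly u
            (Lp_space p \<sigma>) (Lp_norm p \<sigma>) (Lp_space p \<sigma>) (Lp_norm p \<sigma>)) \<and>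
         (\<forall>\<sigma>\<in>B1_class. toeplitz_acts_compactly u
            (Lp_space 1 \<sigma>) (Lp_norm 1 \<sigma>) (weak_L1_space \<sigma>) (weak_L1_norm \<sigma>))"
  using toeplitz_compact_Lp[OF assms(1,3,2)] toeplitz_compact_weak_L1[OF assms(1,3)] by blast

end
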